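(* For the family of maps $\Lambda_t:\mathcal T\to\mathcal T$ the following holds. (i) There exists a decreasing sequence $\{t_n\}_{n\in\mathbb N}$ converging to $\frac1{\sqrt2}$ such that $\Lambda_t$ is an $n$ times renormalizable EBM for every $t\in(\frac1{\sqrt2},t_n)$. (ii) For each natural number $n$ there exists an interval $I_n$ of parameters such that $\Lambda_t$ displays at least $2^n$ different strange attractors whenever $t\in I_n$.
   Context: The maps. Let $\mathcal T_0=\{(x,y):0\le x\le1,\ 0\le y\le x\}$, $\mathcal T_1=\{(x,y):1\le x\le2,\ 0\le y\le2-x\}$, $\mathcal T=\mathcal T_0\cup\mathcal T_1$, and for $0\le t\le1$ $$\Lambda_t(x,y)=\begin{cases}(t(x+y),t(x-y)),&(x,y)\in\mathcal T_0,\\(t(2-x+y),t(2-x-y)),&(x,y)\in\mathcal T_1.\end{cases}$$ The triangle $\mathcal T$ is invariant under $\Lambda_t$. For $t>1/\sqrt2$, $\Lambda_t$ is an Expanding Baker Map in the sense below: the fold along $x=1$ with base point $(0,0)$, followed by the linear map with matrix $\begin{pmatrix}t&t\\t&-t\end{pmatrix}$. Intervals of parameters are nondegenerate. Folds. Let $\mathcal K\subset\mathbb R^2$ be compact and convex with nonempty interior, $P\in\mathcal K$, and $\mathcal L$ a line with $\mathcal L\cap\mathrm{int}(\mathcal K)\ne\emptyset$ and $P\notin\mathcal L$. Then $\mathcal L$ divides $\mathcal K$ into $\mathcal K_0\ni P$ and $\mathcal K_1$. The fold $\mathcal F_{\mathcal L,P}$ is the identity on $\mathcal K_0$ and sends $Q\in\mathcal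 K_1$ to its mirror image with respect to $\mathcal L$. It is a good fold if $\mathcal F_{\mathcal L,P}(\mathcal K)=\mathcal K_0$. A sequence of good folds $\mathcal F_{\mathcal L_1,P},\dots,\mathcal F_{\mathcal L_n,P}$ of $\mathcal K$ is obtained by taking the first to be a good fold of $\mathcal K$ onto $\mathcal K_0$, and each subsequent one a good fold of the image of the preceding one, that image always containing $P$. Expanding Baker Map (EBM). Given a compact and convex set $\mathcal K\subset\mathbb R^2$ with nonempty interior, a point $P\in\mathcal K$ and a sequence of good folds $\mathcal F_{\mathcal L_1,P},\dots,\mathcal F_{\mathcal L_n,P}$ of $\mathcal K$ (the first a good fold of $\mathcal K$ onto $\mathcal K_0$, each subsequent one a good fold of the image of the preceding one, that image always containing $P$), with final image $\mathcal K_{0\cdots0}$, let $A:\mathbb R^2\to\mathbb R^2$ be linear with $|\det A|>1$ and $\widetilde A(Q)=P+A(Q-P)$. If $\widetilde A(\mathcal K_{0\cdots0})\subset\mathcal K$, then $\Gamma=\widetilde A\circ\mathcal F_{\mathcal L_n,P}\circ\dots\circ\mathcal F_{\mathcal L_1,P}:\mathcal K\to\mathcal K$ is called an EBM. Renormalization. A set $\mathcal D\subsetneq\mathcal K$ is a restrictive domain for $\Gamma:\mathcal K\to\mathcal K$ if there is $k=k(\mathcal D)\in\mathbb N$ such that $\Gamma^j(\mathcal D)$ and $\mathcal D$ have disjoint interiors for $j=1,\dots,k-1$, and $\Gamma^k(\mathcal D)\subset\mathcal D$. An EBM $\Gamma$ on $\mathcal K$ is (once) renormalizable if there is a restrictive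 domain $\mathcal D$ such that $\Gamma^k|_{\mathcal D}$ is, up to an affine change of coordinates, an EBM $\Gamma_1$ defined on $\mathcal K$. It is twice renormalizable if moreover such a $\Gamma_1$ is itself a renormalizable EBM, and inductively $n$ times renormalizable if such a $\Gamma_1$ is $n-1$ times renormalizable. Strange attractors. An attractor of $f:\mathcal M\to\mathcal M$ is a compact, $f$-invariant, transitive set $\mathcal A$ whose stable set $W^s(\mathcal A)=\{z\in\mathcal M: d(f^n(z),\mathcal A)\to0\}$ has nonempty interior. It is strange if it contains a dense orbit $\{f^n(z_1):n\ge0\}$ for which there is $c>0$ with $\|Df^n(z_1)\|\ge e^{cn}$ for every $n\ge0$. *)

theory Defs
  imports "HOL-Analysis.Analysis"
begin

section \<open>Folds\<close>

text \<open>A pair \<open>(a, b)\<close> with \<open>a \<noteq> 0\<close> stands for the line \<open>{x. a \<bullet> x = b}\<close>.\<close>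

type_synonym line = "(real^2) \<times> real"

definition line_set :: "line \<Rightarrow> (real^2) set" where
  "line_set l = {x. fst l \<bullet> x = snd l}"

definition mirror :: "line \<Rightarrow> real^2 \<Rightarrow> real^2" where
  "mirror l Q = Q - (2 * (fst l \<bullet> Q - snd l) / (fst l \<bullet> fst l)) *\<^sub>R fst l"

definition same_side :: "line \<Rightarrow> real^2 \<Rightarrow> real^2 \<Rightarrow> bool" where
  "same_side l P Q \<longleftrightarrow> 0 \<le> (fst l \<bullet> P - snd l) * (fst l \<bullet> Q - snd l)"

definition near_side :: "line \<Rightarrow> real^2 \<Rightarrow> (real^2) set \<Rightarrow> (real^2) set" where
  "near_side l P K = {Q \<in> K. same_side l P Q}"

definition fold_across :: "line \<Rightarrow> real^2 \<Rightarrow> real^2 \<Rightarrow> real^2" where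
  "fold_across l P Q = (if same_side l P Q then Q else mirror l Q)"

definition good_fold :: "line \<Rightarrow> real^2 \<Rightarrow> (real^2) set \<Rightarrow> bool" where
  "good_fold l P K \<longleftrightarrow>
     compact K \<and> convex K \<and> interior K \<noteq> {} \<and> P \<in> K \<and>
     fst l \<noteq> 0 \<and> line_set l \<inter> interior K \<noteq> {} \<and> P \<notin> line_set l \<and>
     fold_across l P ` K = near_side l P K"

fun folds :: "line list \<Rightarrow> real^2 \<Rightarrow> real^2 \<Rightarrow> real^2" where
  "folds [] P Q = Q"
| "folds (l # ls) P Q = folds ls P (fold_across l P Q)"

fun good_folds :: "line list \<Rightarrow> real^2 \<Rightarrow> (real^2) set \<Rightarrow> bool" where
  "good_folds [] P K \<longleftrightarrow> True"
| "good_folds (l # ls) P K \<longleftrightarrow> good_fold l P K \<and> good_folds ls P (fold_across l P ` K)"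

section \<open>Expanding Baker Maps and renormalization\<close>

text \<open>A map \<open>K \<rightarrow> K\<close> is represented by a total function of which only the values on \<open>K\<close> matter.\<close>

definition is_EBM :: "(real^2) set \<Rightarrow> (real^2 \<Rightarrow> real^2) \<Rightarrow> bool" where
  "is_EBM K \<Gamma> \<longleftrightarrow>
     compact K \<and> convex K \<and> interior K \<noteq> {} \<and>
     (\<exists>P \<in> K. \<exists>ls. \<exists>A :: real^2^2.
        ls \<noteq> [] \<and> good_folds ls P K \<and> \<bar>det A\<bar> > 1 \<and>
        (\<lambda>Q. P + A *v (Q - P)) ` (folds ls P ` K) \<subseteq> K \<and>
        (\<forall>Q \<in> K. \<Gamma> Q = P + A *v (folds ls P Q - P)))"

definition restrictive_domain ::
    "(real^2) set \<Rightarrow> (real^2 \<Rightarrow> real^2) \<Rightarrow> (real^2) set \<Rightarrow> nat \<Rightarrow> bool" where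
  "restrictive_domain K \<Gamma> D k \<longleftrightarrow>
     D \<subset> K \<and> 1 \<le> k \<and>
     (\<forall>j \<in> {1..<k}. interior ((\<Gamma> ^^ j) ` D) \<inter> interior D = {}) \<and>
     (\<Gamma> ^^ k) ` D \<subseteq> D"

text \<open>\<open>renormalizes_to K \<Gamma> \<Gamma>1\<close>: the EBM \<open>\<Gamma>1\<close> on \<open>K\<close> is affinely conjugate to an iterate of
  \<open>\<Gamma>\<close> restricted to a restrictive domain, the affine change \<open>Q \<mapsto> B *v Q + v\<close> carrying that
  domain onto \<open>K\<close>.\<close>

definition renormalizes_to ::
    "(real^2) set \<Rightarrow> (real^2 \<Rightarrow> real^2) \<Rightarrow> (real^2 \<Rightarrow> real^2) \<Rightarrow> bool" where
  "renormalizes_to K \<Gamma> \<Gamma>1 \<longleftrightarrow>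
     is_EBM K \<Gamma>1 \<and>
     (\<exists>D k. restrictive_domain K \<Gamma> D k \<and>
        (\<exists>(B :: real^2^2) v. invertible B \<and>
           (\<lambda>Q. B *v Q + v) ` D = K \<and>
           (\<forall>Q \<in> D. B *v ((\<Gamma> ^^ k) Q) + v = \<Gamma>1 (B *v Q + v))))"

fun renormalizable_EBM :: "nat \<Rightarrow> (real^2) set \<Rightarrow> (real^2 \<Rightarrow> real^2) \<Rightarrow> bool" where
  "renormalizable_EBM 0 K \<Gamma> \<longleftrightarrow> is_EBM K \<Gamma>"
| "renormalizable_EBM (Suc n) K \<Gamma> \<longleftrightarrow>
     is_EBM K \<Gamma> \<and> (\<exists>\<Gamma>1. renormalizes_to K \<Gamma> \<Gamma>1 \<and> renormalizable_EBM n K \<Gamma>1)"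

section \<open>Strange attractors\<close>

definition transitive_on :: "('a::topological_space \<Rightarrow> 'a) \<Rightarrow> 'a set \<Rightarrow> bool" where
  "transitive_on f A \<longleftrightarrow>
     (\<forall>U V. open U \<and> open V \<and> U \<inter> A \<noteq> {} \<and> V \<inter> A \<noteq> {} \<longrightarrow>
        (\<exists>n \<ge> 1. (f ^^ n) ` (U \<inter> A) \<inter> V \<noteq> {}))"

definition stable_set :: "'a::metric_space set \<Rightarrow> ('a \<Rightarrow> 'a) \<Rightarrow> 'a set \<Rightarrow> 'a set" where
  "stable_set M f A = {z \<in> M. (\<lambda>n. infdist ((f ^^ n) z) A) \<longlonglongrightarrow> 0}"

text \<open>The condition \<open>A \<noteq> {}\<close> is needed because \<open>infdist z {} = 0\<close>.  The interior of the stable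
  set is taken in the phase space \<open>M\<close>.\<close>

definition attractor :: "'a::metric_space set \<Rightarrow> ('a \<Rightarrow> 'a) \<Rightarrow> 'a set \<Rightarrow> bool" where
  "attractor M f A \<longleftrightarrow>
     A \<noteq> {} \<and> A \<subseteq> M \<and> compact A \<and> f ` A = A \<and> transitive_on f A \<and>
     top_of_set M interior_of (stable_set M f A) \<noteq> {}"

text \<open>The derivative is taken within \<open>M\<close>, as \<open>f\<close> is a map \<open>M \<rightarrow> M\<close>; it is unique whenever
  \<open>M\<close> is convex with nonempty interior.\<close>

definition strange_attractor ::
    "'a::euclidean_space set \<Rightarrow> ('a \<Rightarrow> 'a) \<Rightarrow> 'a set \<Rightarrow> bool" where
  "strange_attractor M f A \<longleftrightarrow>
     attractor M f A \<and>
     (\<exists>z \<in> A. A \<subseteq> closure (range (\<lambda>n. (f ^^ n) z)) \<and>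
        (\<exists>c > 0. \<forall>n. \<exists>D. ((f ^^ n) has_derivative D) (at z within M) \<and>
           exp (c * real n) \<le> onorm D))"

section \<open>The family of maps\<close>

definition T0 :: "(real^2) set" where
  "T0 = {p. 0 \<le> p$1 \<and> p$1 \<le> 1 \<and> 0 \<le> p$2 \<and> p$2 \<le> p$1}"

definition T1 :: "(real^2) set" where
  "T1 = {p. 1 \<le> p$1 \<and> p$1 \<le> 2 \<and> 0 \<le> p$2 \<and> p$2 \<le> 2 - p$1}"

definition T :: "(real^2) set" where
  "T = T0 \<union> T1"

text \<open>The two branches agree on \<open>T0 \<inter> T1\<close>; values outside \<open>T\<close> are irrelevant.\<close>

definition Lambda :: "real \<Rightarrow> real^2 \<Rightarrow> real^2" where
  "Lambda t p =
     (if p \<in> T0 then vector [t * (p$1 + p$2), t * (p$1 - p$2)]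
      else vector [t * (2 - p$1 + p$2), t * (2 - p$1 - p$2)])"

end

theory Submission
  imports Defs
begin

text \<open>The map \<open>Lambda t\<close> folds the triangle along \<open>x = 1\<close> and then applies a similarity of ratio
\<open>t * sqrt 2\<close>, which exceeds 1 only slightly when \<open>t\<close> is close to \<open>1 / sqrt 2\<close>.

Renormalization. At \<open>t = 1 / sqrt 2\<close> the fixed point of the second branch lies on the fold line; for
\<open>t\<close> slightly larger it is a small distance away from it. Seen from this fixed point the map is a
fold across a nearby line followed by a rotation by \<open>- 3 * pi / 4\<close> and an expansion, so the fold line
and its images under the rotation bound a small octagon. Take a triangle with one vertex at the
fixed point that contains one of the eight congruent corners of this octagon. Its first seven images
lie in the other seven sectors, and along the way it is folded exactly twice, across the two edges
of the octagon that meet in the corner (\<open>spinner_orbit\<close>). The eighth iterate is thus a fold across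
two lines at an angle of 135 degrees followed by a homothety of ratio \<open>s = 16 * t ^ 8\<close> centred at
the fixed point: after rescaling, the map \<open>Psi s b\<close> of the triangle, which folds along \<open>x = 4/3\<close>
and \<open>x + y = b\<close> and multiplies by \<open>s\<close>.

For \<open>s\<close> close to 1 the same happens to \<open>Psi s b\<close>. Around one of its fixed points it is a fold
across two lines followed by a quarter turn and an expansion by \<open>s\<close>. The quarter turns of the two
lines again bound an octagon, but its eight corners now form two cycles of length four. In each
of them the fourth iterate is again a map \<open>Psi\<close>, with parameters \<open>s ^ 4\<close> and \<open>ratio s b / s\<^sup>2\<close> or
\<open>ratio s b / s\<close> (\<open>rotor_orbit_plus\<close>, \<open>rotor_orbit_minus\<close>). Both maps of the parameters are continuous
at \<open>(1, 4/3 * sqrt 2)\<close> and fix this point, and the parameters obtained from \<open>Lambda t\<close> tend to it as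
\<open>t\<close> decreases to \<open>1 / sqrt 2\<close>. Hence any given number of steps can be carried out for all \<open>t\<close>
close enough to \<open>1 / sqrt 2\<close> (\<open>near_limit_induct\<close>), which is (i). As every step on \<open>Psi\<close> doubles the
number of cycles, it also yields \<open>2 ^ n\<close> open sets such that no iterates of two of them overlap in
a set with interior (\<open>eventually_separated_Lambda\<close>).

Attractors. All lines along which some iterate of \<open>Lambda t\<close> fails to be affine have one of four
directions, since the linear parts generate a finite group up to scaling. A sufficiently
small disc meets at most one line of each direction for the \<open>N\<close>-th iterate. It therefore contains
a disc 16 times smaller on which the \<open>N\<close>-th iterate is a similarity of ratio \<open>(t * sqrt 2) ^ N\<close>, and
for \<open>N\<close> large the image contains a disc twice as large as the original one. So every open set has an
iterate containing a disc of a fixed radius (\<open>Lambda_expands_to_scale\<close>). Consequently only finitely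
many discs matter, and every open set reaches a disc that is reached back from everything
that it reaches (\<open>recurrent_ball_exists\<close>). The closure of the orbit of such a disc is an attractor, and
by Baire's theorem it contains a dense orbit that never meets the fold line
(\<open>dense_orbit_avoiding\<close>); along that orbit the derivative of the \<open>n\<close>-th iterate is
\<open>(t * sqrt 2) ^ n\<close> times an isometry. Attractors that start in different sets of a separated
family are different, which proves (ii).\<close>

section \<open>Coordinates in the plane\<close>

definition pt :: "real \<Rightarrow> real \<Rightarrow> real^2" where
  "pt x y = vector [x, y]"

lemma pt_nth [simp]: "pt x y $ 1 = x" "pt x y $ 2 = y"
  by (simp_all add: pt_def)

lemma pt_eq_iff: "p = q \<longleftrightarrow> p $ 1 = q $ 1 \<and> p $ 2 = q $ (2::2)" for p q :: "real^2"
  by (simp add: vec_eq_iff forall_2)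

lemma pt_collapse [simp]: "pt (p $ 1) (p $ 2) = p"
  by (simp add: pt_eq_iff)

lemma pt_inject [simp]: "pt x y = pt x' y' \<longleftrightarrow> x = x' \<and> y = y'"
  by (simp add: pt_eq_iff)

lemma pt_arith [simp]:
  "pt x y + pt x' y' = pt (x + x') (y + y')"
  "pt x y - pt x' y' = pt (x - x') (y - y')"
  "c *\<^sub>R pt x y = pt (c * x) (c * y)"
  "- pt x y = pt (- x) (- y)"
  by (simp_all add: pt_eq_iff)

lemma zero_eq_pt: "0 = pt 0 0"
  by (simp add: pt_eq_iff)

lemma inner_pt: "p \<bullet> q = p $ 1 * q $ 1 + p $ 2 * q $ (2::2)" for p q :: "real^2"
  by (simp add: inner_vec_def sum_2)

lemma norm_pt_square: "(norm p)\<^sup>2 = (p $ 1)\<^sup>2 + (p $ (2::2))\<^sup>2" for p :: "real^2"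
  by (simp add: norm_vec_def L2_set_def sum_2)

lemma closed_halfplane: "closed {p :: real^2. c * p $ 1 + d * p $ 2 \<le> e}"
  by (intro closed_Collect_le continuous_intros)

lemma open_halfplane: "open {p :: real^2. c * p $ 1 + d * p $ 2 < e}"
  by (intro open_Collect_less continuous_intros)

lemma convex_halfplane: "convex {p :: real^2. c * p $ 1 + d * p $ 2 \<le> e}"
  using convex_halfspace_le[of "pt c d" e] by (simp add: inner_pt)

section \<open>The triangle and its folds\<close>

lemma T_iff: "p \<in> T \<longleftrightarrow> 0 \<le> p $ 2 \<and> p $ 2 \<le> p $ 1 \<and> p $ 1 + p $ 2 \<le> 2"
  by (auto simp: T_def T0_def T1_def)

lemma T_halfplanes:
  "T = {p. 0 * p $ 1 + (-1) * p $ 2 \<le> 0} \<inter> {p. (-1) * p $ 1 + 1 * p $ 2 \<le> 0}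
     \<inter> {p. 1 * p $ 1 + 1 * p $ 2 \<le> 2}"
  by (auto simp: T_iff)

lemma bounded_T: "bounded T"
proof -
  have "norm p \<le> 3" if "p \<in> T" for p
    using that norm_le_l1_cart[of p] by (auto simp: T_iff sum_2)
  then show ?thesis by (auto simp: bounded_iff)
qed

lemma closed_T: "closed T"
  unfolding T_halfplanes by (intro closed_Int closed_halfplane)

lemma compact_T: "compact T"
  using closed_T bounded_T by (simp add: compact_eq_bounded_closed)

lemma convex_T: "convex T"
  unfolding T_halfplanes by (intro convex_Int convex_halfplane)

lemma interior_TI:
  assumes "0 < p $ 2" "p $ 2 < p $ 1" "p $ 1 + p $ 2 < 2"
  shows "p \<in> interior T"
proof -
  let ?U = "{p. 0 * p $ 1 + (-1) * p $ 2 < 0} \<inter> {p. (-1) * p $ 1 + 1 * p $ 2 < 0}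
     \<inter> {p :: real^2. 1 * p $ 1 + 1 * p $ 2 < 2}"
  have "open ?U" by (intro open_Int open_halfplane)
  moreover have "?U \<subseteq> T" by (auto simp: T_iff)
  ultimately have "?U \<subseteq> interior T" by (rule interior_maximal[rotated])
  then show ?thesis using assms by auto
qed

lemma interior_T_nonempty: "interior T \<noteq> {}"
  using interior_TI[of "pt 1 (1/2)"] by auto

definition fold_x :: "real \<Rightarrow> real^2 \<Rightarrow> real^2" where
  "fold_x a p = pt (min (p $ 1) (2 * a - p $ 1)) (p $ 2)"

definition fold_diag :: "real \<Rightarrow> real^2 \<Rightarrow> real^2" where
  "fold_diag b p = (let m = max 0 (p $ 1 + p $ 2 - b) in pt (p $ 1 - m) (p $ 2 - m))"

text \<open>The constant \<open>4/3\<close> is a normalization. With the first fold at the midpoint \<open>x = 1\<close> of the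
hypotenuse the fold line would end at the vertex \<open>(1, 1)\<close>, and images of this vertex would be folded
once more than intended in the renormalization; any value strictly between 1 and \<open>sqrt 2\<close> would
do.\<close>

definition Psi :: "real \<Rightarrow> real \<Rightarrow> real^2 \<Rightarrow> real^2" where
  "Psi s b p = s *\<^sub>R fold_diag b (fold_x (4/3) p)"

lemma fold_across_x:
  assumes "a > 0" shows "fold_across (pt 1 0, a) 0 = fold_x a"
proof
  fix p :: "real^2"
  have "0 \<le> - (a * (p $ 1 - a)) \<longleftrightarrow> p $ 1 \<le> a"
    using assms by (simp add: mult_le_0_iff)
  then show "fold_across (pt 1 0, a) 0 p = fold_x a p"
    by (auto simp: fold_across_def same_side_def mirror_def inner_pt fold_x_def pt_eq_iff)
qed

lemma fold_across_diag:
  assumes "b > 0" shows "fold_across (pt 1 1, b) 0 = fold_diag b"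
proof
  fix p :: "real^2"
  have "0 \<le> - (b * (p $ 1 + p $ 2 - b)) \<longleftrightarrow> p $ 1 + p $ 2 \<le> b"
    using assms by (simp add: mult_le_0_iff)
  then show "fold_across (pt 1 1, b) 0 p = fold_diag b p"
    by (auto simp: fold_across_def same_side_def mirror_def inner_pt fold_diag_def pt_eq_iff
          Let_def max_def field_simps)
qed

lemma near_side_0:
  assumes "d > 0"
  shows "near_side (n, d) 0 K = K \<inter> {p. n \<bullet> p \<le> d}"
proof -
  have "0 \<le> - (d * (n \<bullet> p - d)) \<longleftrightarrow> n \<bullet> p \<le> d" for p
    using assms by (simp add: mult_le_0_iff)
  then show ?thesis by (auto simp: near_side_def same_side_def)
qed

lemma fold_x_image:
  assumes "a \<ge> 1" shows "fold_x a ` T = T \<inter> {p. p $ 1 \<le> a}"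
proof
  show "fold_x a ` T \<subseteq> T \<inter> {p. p $ 1 \<le> a}"
    using assms by (auto simp: fold_x_def T_iff min_def)
  have "p \<in> fold_x a ` T" if "p \<in> T" "p $ 1 \<le> a" for p
    using that by (intro image_eqI[of _ _ p]) (auto simp: fold_x_def pt_eq_iff)
  then show "T \<inter> {p. p $ 1 \<le> a} \<subseteq> fold_x a ` T" by auto
qed

lemma fold_diag_image:
  assumes "a \<le> b"
  shows "fold_diag b ` (T \<inter> {p. p $ 1 \<le> a}) = T \<inter> {p. p $ 1 \<le> a} \<inter> {p. p $ 1 + p $ 2 \<le> b}"
proof
  show "fold_diag b ` (T \<inter> {p. p $ 1 \<le> a})
      \<subseteq> T \<inter> {p. p $ 1 \<le> a} \<inter> {p. p $ 1 + p $ 2 \<le> b}"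
    using assms by (auto simp: fold_diag_def T_iff max_def Let_def)
  have "p \<in> fold_diag b ` (T \<inter> {p. p $ 1 \<le> a})"
    if "p \<in> T" "p $ 1 \<le> a" "p $ 1 + p $ 2 \<le> b" for p
    using that by (intro image_eqI[of _ _ p]) (auto simp: fold_diag_def pt_eq_iff)
  then show "T \<inter> {p. p $ 1 \<le> a} \<inter> {p. p $ 1 + p $ 2 \<le> b} \<subseteq> fold_diag b ` (T \<inter> {p. p $ 1 \<le> a})"
    by auto
qed

lemma good_fold_x:
  assumes "1 \<le> a" "a < 2" shows "good_fold (pt 1 0, a) 0 T"
proof -
  have "pt a ((2 - a) / 2) \<in> interior T"
    using assms by (intro interior_TI) (auto simp: field_simps)
  then have "line_set (pt 1 0, a) \<inter> interior T \<noteq> {}"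
    by (intro ex_in_conv[THEN iffD1] exI[of _ "pt a ((2 - a) / 2)"] IntI)
      (simp_all add: line_set_def inner_pt)
  then show ?thesis
    using assms compact_T convex_T interior_T_nonempty
    by (simp add: good_fold_def fold_across_x fold_x_image near_side_0 inner_pt T_iff
        line_set_def pt_eq_iff)
qed

text \<open>The second fold acts on the quadrilateral that is left over by the first one. Its line crosses the
interior near the point \<open>(b/2, b/2)\<close> of the leg, which has to be moved inside by \<open>1/6\<close>.\<close>

lemma good_fold_diag:
  assumes "4/3 < b" "b < 2"
  shows "good_fold (pt 1 1, b) 0 (T \<inter> {p. p $ 1 \<le> 4/3})" (is "good_fold _ _ ?K")
proof -
  have K: "?K = T \<inter> {p. 1 * p $ 1 + 0 * p $ 2 \<le> 4/3}" by auto
  let ?p = "pt (b/2 + 1/6) (b/2 - 1/6)"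
  have "?p \<in> interior T" using assms by (intro interior_TI) auto
  moreover have "?p \<in> interior {p. 1 * p $ 1 + 0 * p $ 2 \<le> 4/3}"
    by (rule interiorI[OF open_halfplane[of 1 0 "4/3"]]) (use assms in auto)
  ultimately have p: "?p \<in> interior ?K" unfolding K by simp
  then have "line_set (pt 1 1, b) \<inter> interior ?K \<noteq> {}"
    by (intro ex_in_conv[THEN iffD1] exI[of _ ?p] IntI) (simp_all add: line_set_def inner_pt)
  moreover have "compact ?K" unfolding K by (intro compact_Int_closed compact_T closed_halfplane)
  moreover have "convex ?K" unfolding K by (intro convex_Int convex_T convex_halfplane)
  ultimately show ?thesis
    using assms p fold_diag_image[of "4/3" b]
    by (auto simp: good_fold_def fold_across_diag near_side_0 inner_pt T_iff
        line_set_def pt_eq_iff)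
qed

section \<open>Two families of expanding baker maps\<close>

lemma matrix_vector_mult_2: "(A *v p) $ i = A $ i $ 1 * p $ 1 + A $ i $ 2 * p $ (2::2)"
  for A :: "real^2^2"
  by (simp add: matrix_vector_mult_def sum_2)

lemma is_EBM_maps:
  assumes "is_EBM K \<Gamma>" "p \<in> K" shows "\<Gamma> p \<in> K"
proof -
  obtain P ls and A :: "real^2^2" where
    "(\<lambda>Q. P + A *v (Q - P)) ` (folds ls P ` K) \<subseteq> K"
    "\<forall>Q \<in> K. \<Gamma> Q = P + A *v (folds ls P Q - P)"
    using assms(1) unfolding is_EBM_def by blast
  then show ?thesis using assms(2) by auto
qed

text \<open>The bound \<open>s * b \<le> 2\<close> is exactly what keeps the expanded image below the right leg \<open>x + y = 2\<close>.\<close>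

lemma is_EBM_Psi:
  assumes "1 < s" "4/3 < b" "s * b \<le> 2"
  shows "is_EBM T (Psi s b)"
proof -
  have "b < s * b" using assms by simp
  then have b2: "b < 2" using assms by linarith
  let ?ls = "[(pt 1 0, 4/3), (pt 1 1, b)]"
  let ?A = "mat s :: real^2^2"
  have fs: "folds ?ls 0 p = fold_diag b (fold_x (4/3) p)" for p
    using assms by (simp add: fold_across_x fold_across_diag)
  have A: "?A *v p = s *\<^sub>R p" for p
    by (simp add: pt_eq_iff matrix_vector_mult_2 mat_def)
  have admissible: "good_folds ?ls 0 T"
    using assms b2 good_fold_x[of "4/3"] good_fold_diag[of b]
    by (simp add: fold_across_x fold_x_image)
  have "folds ?ls 0 ` T = fold_diag b ` (fold_x (4/3) ` T)"
    unfolding image_image by (rule image_cong[OF refl fs])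
  then have im: "folds ?ls 0 ` T = T \<inter> {p. p $ 1 \<le> 4/3} \<inter> {p. p $ 1 + p $ 2 \<le> b}"
    using assms fold_diag_image[of "4/3" b] fold_x_image[of "4/3"] by simp
  have "s *\<^sub>R p \<in> T" if "p \<in> T" "p $ 1 + p $ 2 \<le> b" for p
  proof -
    have "s * (p $ 1 + p $ 2) \<le> s * b" using that assms by (intro mult_left_mono) auto
    then show ?thesis using that assms by (auto simp: T_iff algebra_simps)
  qed
  then have sub: "(\<lambda>Q. 0 + ?A *v (Q - 0)) ` (folds ?ls 0 ` T) \<subseteq> T"
    unfolding im by (auto simp: A)
  have "\<bar>det ?A\<bar> > 1"
    using assms by (simp add: det_2 mat_def abs_mult less_1_mult)
  moreover have "\<forall>p\<in>T. Psi s b p = 0 + ?A *v (folds ?ls 0 p - 0)"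
    by (simp add: fs A Psi_def del: folds.simps)
  moreover have "0 \<in> T" by (simp add: T_iff)
  ultimately show ?thesis
    unfolding is_EBM_def using compact_T convex_T interior_T_nonempty admissible sub by blast
qed

lemma Psi_T: "1 < s \<Longrightarrow> 4/3 < b \<Longrightarrow> s * b \<le> 2 \<Longrightarrow> p \<in> T \<Longrightarrow> Psi s b p \<in> T"
  by (rule is_EBM_maps[OF is_EBM_Psi])

text \<open>The linear part of \<open>Lambda\<close>: a reflection composed with the homothety of ratio \<open>t * sqrt 2\<close>.\<close>

definition tent_step :: "real \<Rightarrow> real^2 \<Rightarrow> real^2" where
  "tent_step t p = pt (t * (p $ 1 + p $ 2)) (t * (p $ 1 - p $ 2))"

lemma Lambda_eq: "p \<in> T \<Longrightarrow> Lambda t p = tent_step t (fold_x 1 p)"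
  by (auto simp: Lambda_def tent_step_def fold_x_def T_iff T0_def pt_def[symmetric] min_def)

lemma half_less_square:
  assumes "1 / sqrt 2 < t" shows "0 < t" "1 < 2 * t\<^sup>2"
proof -
  have "0 < 1 / sqrt 2" by simp
  then show pos: "0 < t" using assms by (rule less_trans)
  have "(1 / sqrt 2) * (1 / sqrt 2) < t * t"
    using assms pos by (intro mult_strict_mono) auto
  then show "1 < 2 * t\<^sup>2" by (simp add: power2_eq_square)
qed

lemma is_EBM_Lambda:
  assumes "1 / sqrt 2 < t" "t \<le> 1"
  shows "is_EBM T (Lambda t)"
proof -
  have t: "0 < t" "1 < 2 * t * t"
    using half_less_square[OF assms(1)] by (simp_all add: power2_eq_square mult.assoc)
  let ?ls = "[(pt 1 0, 1)]"
  let ?A = "vector [vector [t, t], vector [t, -t]] :: real^2^2"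
  have fs: "folds ?ls 0 p = fold_x 1 p" for p
    by (simp add: fold_across_x)
  have A: "?A *v p = tent_step t p" for p
    by (simp add: pt_eq_iff matrix_vector_mult_2 tent_step_def algebra_simps)
  have admissible: "good_folds ?ls 0 T"
    using good_fold_x[of 1] by simp
  have "tent_step t p \<in> T" if "p \<in> T" "p $ 1 \<le> 1" for p
  proof -
    have "t * p $ 1 \<le> 1" "0 \<le> t * p $ 2" "t * p $ 2 \<le> t * p $ 1"
      using that assms t by (auto simp: T_iff intro: mult_le_one mult_nonneg_nonneg)
    then show ?thesis by (auto simp: T_iff algebra_simps tent_step_def)
  qed
  then have sub: "(\<lambda>Q. 0 + ?A *v (Q - 0)) ` (folds ?ls 0 ` T) \<subseteq> T"
    unfolding fs fold_x_image[OF order_refl] A by (auto simp: A)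
  have "\<bar>det ?A\<bar> > 1"
    using t by (simp add: det_2 abs_if mult.assoc)
  moreover have "\<forall>p\<in>T. Lambda t p = 0 + ?A *v (folds ?ls 0 p - 0)"
    by (simp add: fs A Lambda_eq del: folds.simps)
  moreover have "0 \<in> T" by (simp add: T_iff)
  ultimately show ?thesis
    unfolding is_EBM_def using compact_T convex_T interior_T_nonempty admissible sub by blast
qed

lemma Lambda_T: "1 / sqrt 2 < t \<Longrightarrow> t \<le> 1 \<Longrightarrow> p \<in> T \<Longrightarrow> Lambda t p \<in> T"
  by (rule is_EBM_maps[OF is_EBM_Lambda])

section \<open>Small copies\<close>

lemma interiors_disjoint:
  fixes X Y :: "(real^2) set"
  assumes "(c, d) \<noteq> (0, 0)"
    and "\<And>p. p \<in> X \<Longrightarrow> c * p $ 1 + d * p $ 2 \<le> e"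
    and "\<And>p. p \<in> Y \<Longrightarrow> e \<le> c * p $ 1 + d * p $ 2"
  shows "interior X \<inter> interior Y = {}"
proof -
  have n: "pt c d \<noteq> 0" using assms(1) by (auto simp: zero_eq_pt)
  have "interior X \<subseteq> {p. pt c d \<bullet> p < e}"
    unfolding interior_halfspace_le[OF n, symmetric]
    by (rule interior_mono) (use assms(2) in \<open>auto simp: inner_pt\<close>)
  moreover have "interior Y \<subseteq> {p. e < pt c d \<bullet> p}"
    unfolding interior_halfspace_ge[OF n, symmetric]
    by (rule interior_mono) (use assms(3) in \<open>auto simp: inner_pt\<close>)
  ultimately show ?thesis by force
qed

text \<open>The restrictive domain is the image of the triangle under \<open>h\<close>, and \<open>g\<close> is the renormalized map.\<close>

definition small_copy ::
    "(real^2 \<Rightarrow> real^2) \<Rightarrow> (real^2 \<Rightarrow> real^2) \<Rightarrow> nat \<Rightarrow> (real^2 \<Rightarrow> real^2) \<Rightarrow> bool" where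
  "small_copy f g k h \<longleftrightarrow>
     1 \<le> k \<and> h ` T \<subset> T \<and>
     (\<forall>j\<in>{1..<k}. interior ((f ^^ j) ` h ` T) \<inter> interior (h ` T) = {}) \<and>
     (\<forall>p\<in>T. (f ^^ k) (h p) = h (g p))"

text \<open>The two similarities with \<open>\<sigma> = 1\<close> and \<open>\<sigma> = -1\<close> put the vertex at the origin into \<open>q\<close> and the first
fold line to the left of it; they differ by a reflection, which selects the corner above or
below the direction of the negative \<open>x\<close>-axis.\<close>

definition place :: "real^2 \<Rightarrow> real \<Rightarrow> real \<Rightarrow> real^2 \<Rightarrow> real^2" where
  "place q r \<sigma> p = q + r *\<^sub>R pt (- p $ 1) (\<sigma> * p $ 2)"

lemma renormalizes_to_small_copy:
  assumes sc: "small_copy f g k (place q r \<sigma>)" and r: "0 < r" and \<sigma>: "\<sigma> * \<sigma> = 1"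
    and g: "is_EBM T g"
  shows "renormalizes_to T f g"
proof -
  let ?h = "place q r \<sigma>"
  define B :: "real^2^2" where "B = vector [vector [- 1 / r, 0], vector [0, \<sigma> / r]]"
  let ?v = "- (B *v q)"
  have B: "B *v p = pt (- p $ 1 / r) (\<sigma> * p $ 2 / r)" for p
    by (simp add: B_def pt_eq_iff matrix_vector_mult_2)
  have inv: "B *v ?h p + ?v = p" for p
    using r \<sigma> by (simp add: B place_def pt_eq_iff field_simps)
  have "det B \<noteq> 0" using r \<sigma> by (auto simp: B_def det_2)
  then have "invertible B" by (simp add: invertible_det_nz)
  moreover have "(\<lambda>p. B *v p + ?v) ` ?h ` T = T"
    unfolding image_image inv by simp
  moreover have "\<forall>p\<in>?h ` T. B *v ((f ^^ k) p) + ?v = g (B *v p + ?v)"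
    using sc inv by (simp add: small_copy_def del: add_uminus_conv_diff)
  moreover have "restrictive_domain T f (?h ` T) k"
    using sc is_EBM_maps[OF g] by (auto simp: small_copy_def restrictive_domain_def)
  ultimately show ?thesis
    unfolding renormalizes_to_def using g by blast
qed

section \<open>The double fold near its rotation centre\<close>

text \<open>The fixed point of \<open>s\<close> times the product of the two reflections, which is a quarter turn up to
scaling. The number \<open>scale s b\<close> is its distance to the first fold line in units of \<open>4/3\<close>;
it tends to 0 with \<open>s - 1\<close>.\<close>

definition centre_x :: "real \<Rightarrow> real \<Rightarrow> real" where
  "centre_x s b = s * (b + s * (8/3 - b)) / (1 + s\<^sup>2)"
definition centre_y :: "real \<Rightarrow> real \<Rightarrow> real" where
  "centre_y s b = s * (b - 8/3 + centre_x s b)"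
definition scale :: "real \<Rightarrow> real \<Rightarrow> real" where
  "scale s b = 3/4 * (centre_x s b - 4/3)"
definition ratio :: "real \<Rightarrow> real \<Rightarrow> real" where
  "ratio s b = 4/3 * (b * (1 + s) - 8/3) / (4/3 * (s + 1) - b * s)"

lemma centre_x_eq: "centre_x s b = s * (b - centre_y s b)"
proof -
  have "1 + s\<^sup>2 \<noteq> 0" using zero_le_power2[of s] by linarith
  then have "centre_x s b * (1 + s\<^sup>2) = s * (b + s * (8/3 - b))" by (simp add: centre_x_def)
  then show ?thesis unfolding centre_y_def by (simp add: algebra_simps power2_eq_square)
qed

lemma scale_eq: "scale s b = 3/4 * (s - 1) * (4/3 * (s + 1) - b * s) / (1 + s\<^sup>2)"
proof -
  have "1 + s\<^sup>2 \<noteq> 0" using zero_le_power2[of s] by linarith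
  then show ?thesis unfolding scale_def centre_x_def
    by (simp add: field_simps power2_eq_square)
qed

lemma ratio_scale:
  assumes "4/3 * (s + 1) - b * s \<noteq> 0"
  shows "scale s b * ratio s b = 8/3 - b - centre_x s b + centre_y s b"
proof -
  have N: "1 + s\<^sup>2 \<noteq> 0" using zero_le_power2[of s] by linarith
  have "scale s b * ratio s b = (s - 1) * (b * (1 + s) - 8/3) / (1 + s\<^sup>2)"
  proof -
    define D where "D = 4/3 * (s + 1) - b * s"
    define X where "X = b * (1 + s) - 8/3"
    define N where "N = 1 + s\<^sup>2"
    have "D \<noteq> 0" "N \<noteq> 0" using assms \<open>1 + s\<^sup>2 \<noteq> 0\<close> by (simp_all add: D_def N_def)
    then have "3/4 * (s - 1) * D / N * (4/3 * X / D) = (s - 1) * X / N"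
      by (simp add: field_simps)
    then have "3/4 * (s - 1) * D / (1 + s\<^sup>2) * (4/3 * X / D) = (s - 1) * X / (1 + s\<^sup>2)"
      by (simp only: N_def)
    then show ?thesis unfolding scale_eq ratio_def D_def X_def .
  qed
  also have "\<dots> = (s - 1) * (centre_x s b + b - 8/3)"
    using N unfolding centre_x_def by (simp add: field_simps power2_eq_square)
  also have "\<dots> = 8/3 - b - centre_x s b + centre_y s b"
    unfolding centre_y_def by (simp add: algebra_simps) argo
  finally show ?thesis .
qed

text \<open>The map \<open>Psi\<close> seen from its rotation centre, in units of \<open>scale s b\<close>: near the centre both reflections
of \<open>Psi\<close> act, so relative to their product it is the points on the other sides of the two lines, where
the origin lies, that are folded.\<close>

definition rotor :: "real \<Rightarrow> real \<Rightarrow> real^2 \<Rightarrow> real^2" where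
  "rotor s \<kappa> p = (let u = max (p $ 1) (- 8/3 - p $ 1); m = max 0 (u - p $ 2 - \<kappa>)
                  in pt (- s * (p $ 2 + m)) (s * (u - m)))"

text \<open>Since \<open>fold_x a\<close> is the reflection composed with the fold onto the opposite half plane, and likewise
for the second fold, \<open>Psi\<close> is everywhere equal to the two opposite folds followed by the product of the
reflections. This is an identity of maps of the whole plane.\<close>

lemma Psi_rotor:
  assumes s: "1 < s" and den: "b * s < 4/3 * (s + 1)"
  defines "q \<equiv> pt (centre_x s b) (centre_y s b)"
  shows "Psi s b (q + scale s b *\<^sub>R p) = q + scale s b *\<^sub>R rotor s (ratio s b) p"
proof -
  let ?r = "scale s b" and ?x = "centre_x s b" and ?y = "centre_y s b"
  let ?u = "max (p $ 1) (- 8/3 - p $ 1)"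
  let ?m = "max 0 (?u - p $ 2 - ratio s b)"
  have "1 + s\<^sup>2 > 0" using zero_le_power2[of s] by linarith
  then have r: "0 < ?r" using s den unfolding scale_eq by simp
  have e: "?x = 4/3 + 4/3 * ?r" by (simp add: scale_def field_simps)
  have k: "?r * ratio s b = 8/3 - b - ?x + ?y" using den by (intro ratio_scale) simp
  have y: "?y = s * (b - 8/3 + ?x)" by (rule centre_y_def)
  have x: "?x = s * (b - ?y)" by (rule centre_x_eq)
  have "min (?x + ?r * p $ 1) (8/3 - (?x + ?r * p $ 1)) = 8/3 - ?x - ?r * ?u"
  proof (cases "p $ 1 \<le> - 8/3 - p $ 1")
    case True
    then have "?r * p $ 1 \<le> ?r * (- 8/3 - p $ 1)" using r by (intro mult_left_mono) auto
    with True show ?thesis unfolding e by (simp add: min_def max_def algebra_simps)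
  next
    case False
    then have "?r * (- 8/3 - p $ 1) \<le> ?r * p $ 1" using r by (intro mult_left_mono) auto
    with False show ?thesis unfolding e by (simp add: min_def max_def algebra_simps)
  qed
  then have f1: "fold_x (4/3) (q + ?r *\<^sub>R p) = pt (8/3 - ?x - ?r * ?u) (?y + ?r * p $ 2)"
    by (simp add: fold_x_def q_def)
  have "max 0 (8/3 - ?x - ?r * ?u + (?y + ?r * p $ 2) - b)
      = max (?r * 0) (?r * (- (?u - p $ 2 - ratio s b)))"
    using k by (simp add: algebra_simps)
  also have "\<dots> = ?r * max 0 (- (?u - p $ 2 - ratio s b))"
    using r by (simp add: max_mult_distrib_left)
  also have "\<dots> = ?r * (?m - (?u - p $ 2 - ratio s b))"
    by (simp add: max_def)
  finally have f2: "fold_diag b (fold_x (4/3) (q + ?r *\<^sub>R p))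
     = pt (8/3 - ?x - ?r * ?u - ?r * (?m - (?u - p $ 2 - ratio s b)))
          (?y + ?r * p $ 2 - ?r * (?m - (?u - p $ 2 - ratio s b)))"
    unfolding f1 fold_diag_def by (simp add: Let_def)
  have a1: "8/3 - ?x - ?r * ?u - ?r * (?m - (?u - p $ 2 - ratio s b)) = b - ?y - ?r * (p $ 2 + ?m)"
    using k by (simp add: algebra_simps)
  have a2: "?y + ?r * p $ 2 - ?r * (?m - (?u - p $ 2 - ratio s b)) = b - 8/3 + ?x + ?r * (?u - ?m)"
    using k by (simp add: algebra_simps)
  have "s * (b - ?y - ?r * (p $ 2 + ?m)) = ?x + ?r * (- s * (p $ 2 + ?m))"
    by (subst x) (simp add: algebra_simps)
  moreover have "s * (b - 8/3 + ?x + ?r * (?u - ?m)) = ?y + ?r * (s * (?u - ?m))"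
    by (subst y) (simp add: algebra_simps)
  ultimately show ?thesis
    unfolding Psi_def f2 a1 a2 rotor_def Let_def unfolding q_def by simp
qed

lemma Psi_rotor_iterate:
  assumes "1 < s" "b * s < 4/3 * (s + 1)"
  shows "(Psi s b ^^ n) (pt (centre_x s b) (centre_y s b) + scale s b *\<^sub>R p)
     = pt (centre_x s b) (centre_y s b) + scale s b *\<^sub>R (rotor s (ratio s b) ^^ n) p"
  by (induction n) (simp_all add: Psi_rotor[OF assms])

lemma rotor_unfolded:
  assumes "- 4/3 \<le> x" "x - y \<le> \<kappa>"
  shows "rotor s \<kappa> (pt x y) = pt (- s * y) (s * x)"
  using assms by (simp add: rotor_def Let_def max_def)

lemma folded_bounds:
  assumes "p \<in> T" "4/3 \<le> b"
  defines "p1 \<equiv> fold_x (4/3) p" and "p2 \<equiv> fold_diag b (fold_x (4/3) p)"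
  shows "0 \<le> p1 $ 2" "p1 $ 2 \<le> p1 $ 1" "p1 $ 1 \<le> 4/3" "p1 $ 2 \<le> 1"
    "0 \<le> p2 $ 2" "p2 $ 2 \<le> p2 $ 1" "p2 $ 1 \<le> 4/3" "p2 $ 2 \<le> 1"
    "0 \<le> p1 $ 1" "0 \<le> p2 $ 1"
  using assms(1,2)
  by (auto simp: p1_def p2_def fold_x_def fold_diag_def Let_def T_iff min_def max_def)

lemma fold_x_minus: "max (- p $ 1) (- 8/3 - - p $ 1) = - fold_x (4/3) p $ 1"
  by (simp add: fold_x_def max_def min_def)

text \<open>The four positions of the triangle lie in four sectors of angle 45 degrees around the centre. Of
the eight folds performed, only the first one of the first step and the second one of the third
step move points of the triangle; the latter line appears at distance \<open>\<kappa> / s\<^sup>2\<close> because two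
expansions precede it.\<close>

lemma rotor_orbit_plus:
  assumes s: "1 < s" "s ^ 3 \<le> 4/3" and \<kappa>: "4/3 * s\<^sup>2 \<le> \<kappa>" and p: "p \<in> T"
  defines "p1 \<equiv> fold_x (4/3) p" and "p2 \<equiv> fold_diag (\<kappa> / s\<^sup>2) (fold_x (4/3) p)"
    and "w \<equiv> pt (- p $ 1) (p $ 2)"
  shows "rotor s \<kappa> w = pt (- s * p1 $ 2) (- s * p1 $ 1)"
    "(rotor s \<kappa> ^^ 2) w = pt (s ^ 2 * p1 $ 1) (- (s ^ 2) * p1 $ 2)"
    "(rotor s \<kappa> ^^ 3) w = pt (s ^ 3 * p2 $ 2) (s ^ 3 * p2 $ 1)"
    "(rotor s \<kappa> ^^ 4) w = pt (- (s ^ 4) * p2 $ 1) (s ^ 4 * p2 $ 2)"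
proof -
  have s2: "1 < s\<^sup>2" "s \<le> s\<^sup>2" "s \<le> s ^ 3"
    using s by (simp_all add: less_1_mult power2_eq_square self_le_power)
  have \<kappa>': "4/3 \<le> \<kappa> / s\<^sup>2" using \<kappa> s2 by (subst pos_le_divide_eq) (auto simp: mult.commute)
  note b = folded_bounds[OF p \<kappa>', folded p2_def, folded p1_def]
  \<comment> \<open>the height of the triangle is 1, which is where a first fold at \<open>4/3\<close> instead of 1 is needed\<close>
  have s43: "s * p1 $ 2 \<le> 4/3"
    using mult_mono[of s "4/3" "p1 $ 2" 1] s s2 b by simp
  have s\<kappa>: "s * p1 $ 1 \<le> \<kappa>"
    using mult_mono[of s "s\<^sup>2" "p1 $ 1" "4/3"] s s2 b \<kappa> by simp
  have nn: "0 \<le> s * p1 $ 2" "0 \<le> s * p1 $ 1" "0 \<le> s\<^sup>2 * p1 $ 1" using s b by simp_all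
  have "max (- p $ 1) (- 8/3 - - p $ 1) = - p1 $ 1" "p $ 2 = p1 $ 2"
    by (simp_all only: p1_def fold_x_minus) (simp add: fold_x_def)
  then show 1: "rotor s \<kappa> w = pt (- s * p1 $ 2) (- s * p1 $ 1)"
    using b \<kappa> s2 by (simp add: w_def rotor_def Let_def max_def)
  have "rotor s \<kappa> (pt (- s * p1 $ 2) (- s * p1 $ 1))
      = pt (s ^ 2 * p1 $ 1) (- (s ^ 2) * p1 $ 2)"
    by (subst rotor_unfolded) (use s43 s\<kappa> nn in \<open>auto simp: power2_eq_square\<close>)
  then show 2: "(rotor s \<kappa> ^^ 2) w = pt (s ^ 2 * p1 $ 1) (- (s ^ 2) * p1 $ 2)"
    using 1 by (simp add: numeral_2_eq_2)
  have "max 0 (s ^ 2 * p1 $ 1 - - (s ^ 2) * p1 $ 2 - \<kappa>)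
      = max (s\<^sup>2 * 0) (s\<^sup>2 * (p1 $ 1 + p1 $ 2 - \<kappa> / s\<^sup>2))"
    using s s2 by (simp add: algebra_simps)
  also have "\<dots> = s\<^sup>2 * max 0 (p1 $ 1 + p1 $ 2 - \<kappa> / s\<^sup>2)"
    by (simp add: max_mult_distrib_left)
  finally have "rotor s \<kappa> (pt (s ^ 2 * p1 $ 1) (- (s ^ 2) * p1 $ 2))
      = pt (s ^ 3 * p2 $ 2) (s ^ 3 * p2 $ 1)"
    using nn by (simp add: rotor_def Let_def p2_def fold_diag_def flip: p1_def)
      (simp add: algebra_simps power_numeral_reduce)
  then show 3: "(rotor s \<kappa> ^^ 3) w = pt (s ^ 3 * p2 $ 2) (s ^ 3 * p2 $ 1)"
    using 2 by (simp add: numeral_eq_Suc)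
  have "s ^ 3 * p2 $ 2 \<le> s ^ 3 * p2 $ 1" "0 \<le> s ^ 3 * p2 $ 2"
    using s b by (simp_all add: mult_left_mono)
  moreover have "0 \<le> \<kappa>" using \<kappa> s2 by linarith
  ultimately have "rotor s \<kappa> (pt (s ^ 3 * p2 $ 2) (s ^ 3 * p2 $ 1))
      = pt (- (s ^ 4) * p2 $ 1) (s ^ 4 * p2 $ 2)"
    by (subst rotor_unfolded) (auto simp: power_numeral_reduce)
  then show "(rotor s \<kappa> ^^ 4) w = pt (- (s ^ 4) * p2 $ 1) (s ^ 4 * p2 $ 2)"
    using 3 by (simp add: numeral_eq_Suc)
qed

text \<open>The other cycle of corners. Here the quarter turns bring the second line into play already at the
second step, after a single expansion, whence \<open>\<kappa> / s\<close>.\<close>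

lemma rotor_orbit_minus:
  assumes s: "1 < s" "s ^ 3 \<le> 4/3" and \<kappa>: "4/3 * s\<^sup>2 \<le> \<kappa>" and p: "p \<in> T"
  defines "p1 \<equiv> fold_x (4/3) p" and "p2 \<equiv> fold_diag (\<kappa> / s) (fold_x (4/3) p)"
    and "w \<equiv> pt (- p $ 1) (- p $ 2)"
  shows "rotor s \<kappa> w = pt (s * p1 $ 2) (- s * p1 $ 1)"
    "(rotor s \<kappa> ^^ 2) w = pt (s ^ 2 * p2 $ 1) (s ^ 2 * p2 $ 2)"
    "(rotor s \<kappa> ^^ 3) w = pt (- (s ^ 3) * p2 $ 2) (s ^ 3 * p2 $ 1)"
    "(rotor s \<kappa> ^^ 4) w = pt (- (s ^ 4) * p2 $ 1) (- (s ^ 4) * p2 $ 2)"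
proof -
  have s2: "1 < s\<^sup>2" "s \<le> s\<^sup>2" "s \<le> s ^ 3"
    using s by (simp_all add: less_1_mult power2_eq_square self_le_power)
  have \<kappa>': "4/3 \<le> \<kappa> / s" using \<kappa> s s2 by (subst pos_le_divide_eq) (auto simp: mult.commute)
  note b = folded_bounds[OF p \<kappa>', folded p2_def, folded p1_def]
  have s\<kappa>: "s\<^sup>2 * p2 $ 1 \<le> \<kappa>"
    using mult_left_mono[of "p2 $ 1" "4/3" "s\<^sup>2"] s2 b \<kappa> by simp
  have s43: "s ^ 3 * p2 $ 2 \<le> 4/3"
    using mult_mono[of "s ^ 3" "4/3" "p2 $ 2" 1] s s2 b by simp
  have nn: "0 \<le> s * p1 $ 2" "0 \<le> s\<^sup>2 * p2 $ 1" "0 \<le> s\<^sup>2 * p2 $ 2"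
      "0 \<le> s ^ 3 * p2 $ 2" "0 \<le> s ^ 3 * p2 $ 1" "0 < \<kappa>"
    using s b \<kappa> s2 by simp_all
  have "max (- p $ 1) (- 8/3 - - p $ 1) = - p1 $ 1" "p $ 2 = p1 $ 2"
    by (simp_all only: p1_def fold_x_minus) (simp add: fold_x_def)
  then show 1: "rotor s \<kappa> w = pt (s * p1 $ 2) (- s * p1 $ 1)"
    using b nn by (simp add: w_def rotor_def Let_def max_def)
  have "max 0 (s * p1 $ 2 - - s * p1 $ 1 - \<kappa>)
      = max (s * 0) (s * (p1 $ 1 + p1 $ 2 - \<kappa> / s))"
    using s by (simp add: algebra_simps)
  also have "\<dots> = s * max 0 (p1 $ 1 + p1 $ 2 - \<kappa> / s)"
    using s by (simp add: max_mult_distrib_left)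
  finally have "rotor s \<kappa> (pt (s * p1 $ 2) (- s * p1 $ 1))
      = pt (s ^ 2 * p2 $ 1) (s ^ 2 * p2 $ 2)"
    using nn by (simp add: rotor_def Let_def p2_def fold_diag_def flip: p1_def)
      (simp add: algebra_simps power_numeral_reduce)
  then show 2: "(rotor s \<kappa> ^^ 2) w = pt (s ^ 2 * p2 $ 1) (s ^ 2 * p2 $ 2)"
    using 1 by (simp add: numeral_2_eq_2)
  have "rotor s \<kappa> (pt (s ^ 2 * p2 $ 1) (s ^ 2 * p2 $ 2))
      = pt (- (s ^ 3) * p2 $ 2) (s ^ 3 * p2 $ 1)"
    by (subst rotor_unfolded) (use nn s\<kappa> in \<open>auto simp: power_numeral_reduce\<close>)
  then show 3: "(rotor s \<kappa> ^^ 3) w = pt (- (s ^ 3) * p2 $ 2) (s ^ 3 * p2 $ 1)"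
    using 2 by (simp add: numeral_eq_Suc)
  have "rotor s \<kappa> (pt (- (s ^ 3) * p2 $ 2) (s ^ 3 * p2 $ 1))
      = pt (- (s ^ 4) * p2 $ 1) (- (s ^ 4) * p2 $ 2)"
    by (subst rotor_unfolded) (use nn s43 in \<open>auto simp: power_numeral_reduce\<close>)
  then show "(rotor s \<kappa> ^^ 4) w = pt (- (s ^ 4) * p2 $ 1) (- (s ^ 4) * p2 $ 2)"
    using 3 by (simp add: numeral_eq_Suc)
qed

section \<open>Cycles of corners\<close>

lemma T_bounds:
  assumes "p \<in> T"
  shows "0 \<le> p $ 2" "p $ 2 \<le> p $ 1" "0 \<le> p $ 1" "p $ 1 \<le> 2" "p $ 2 \<le> 1"
  using assms by (auto simp: T_iff)

lemma sector_interiors_disjoint: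
  fixes F G :: "real^2 \<Rightarrow> real^2"
  assumes cd: "(c, d) \<noteq> (0, 0)" and r: "0 < r"
    and F: "\<And>p. p \<in> T \<Longrightarrow> c * F p $ 1 + d * F p $ 2 \<le> 0"
    and G: "\<And>p. p \<in> T \<Longrightarrow> 0 \<le> c * G p $ 1 + d * G p $ 2"
  shows "interior ((\<lambda>p. q + r *\<^sub>R F p) ` T) \<inter> interior ((\<lambda>p. q + r *\<^sub>R G p) ` T) = {}"
proof -
  have e: "c * (q + r *\<^sub>R u) $ 1 + d * (q + r *\<^sub>R u) $ 2
      = c * q $ 1 + d * q $ 2 + r * (c * u $ 1 + d * u $ 2)" for u :: "real^2"
    by (simp add: algebra_simps)
  have "c * x $ 1 + d * x $ 2 \<le> c * q $ 1 + d * q $ 2"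
    if "x \<in> (\<lambda>p. q + r *\<^sub>R F p) ` T" for x
    using that F r by (auto simp only: e) (simp add: mult_nonneg_nonpos)
  moreover have "c * q $ 1 + d * q $ 2 \<le> c * x $ 1 + d * x $ 2"
    if "x \<in> (\<lambda>p. q + r *\<^sub>R G p) ` T" for x
    using that G r by (auto simp only: e) (simp add: mult_nonneg_nonneg)
  ultimately show ?thesis by (rule interiors_disjoint[OF cd])
qed

lemma place_T:
  assumes r: "0 < r" and \<sigma>: "\<bar>\<sigma>\<bar> = 1"
    and q: "r \<le> q $ 2" "3 * r \<le> q $ 1 - q $ 2" "q $ 1 + q $ 2 + 3 * r \<le> 2"
  shows "place q r \<sigma> ` T \<subset> T"
proof -
  have b: "0 \<le> r * p $ 1" "r * p $ 1 \<le> 2 * r" "\<bar>\<sigma> * (r * p $ 2)\<bar> \<le> r" if "p \<in> T" for p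
  proof -
    have "0 \<le> p $ 1" "p $ 1 \<le> 2" "0 \<le> p $ 2" "p $ 2 \<le> 1"
      using that by (auto simp: T_iff)
    then have "r * p $ 2 \<le> r * 1" "r * p $ 1 \<le> r * 2" "0 \<le> r * p $ 1" "0 \<le> r * p $ 2"
      using r by simp_all
    moreover have "\<bar>\<sigma> * (r * p $ 2)\<bar> = \<bar>r * p $ 2\<bar>"
      using \<sigma> by (simp only: abs_mult[of \<sigma>] mult_1)
    ultimately show "0 \<le> r * p $ 1" "r * p $ 1 \<le> 2 * r" "\<bar>\<sigma> * (r * p $ 2)\<bar> \<le> r"
      by simp_all
  qed
  have "place q r \<sigma> p \<in> T \<and> place q r \<sigma> p \<noteq> 0" if "p \<in> T" for p
  proof -
    have c: "place q r \<sigma> p $ 1 = q $ 1 - r * p $ 1"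
      "place q r \<sigma> p $ 2 = q $ 2 + \<sigma> * (r * p $ 2)"
      by (simp_all add: place_def)
    define A B where AB: "A = r * p $ 1" "B = \<sigma> * (r * p $ 2)"
    have "0 \<le> A" "A \<le> 2 * r" "B \<le> r" "- r \<le> B"
      using b[OF that] unfolding AB by (simp_all only: abs_le_iff) linarith+
    then show ?thesis
      using q r unfolding T_iff pt_eq_iff[of _ 0] c AB[symmetric] by auto
  qed
  then have "place q r \<sigma> ` T \<subseteq> T" "0 \<notin> place q r \<sigma> ` T"
    by auto
  moreover have "0 \<in> T" by (simp add: T_iff)
  ultimately show ?thesis by (metis psubsetI)
qed

text \<open>The conditions under which \<open>Psi s b\<close> is an expanding baker map, no unwanted fold occurs along the two
cycles of corners, and the corners lie in the triangle. All of them except \<open>1 < s\<close> are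
strict at the limit parameters.\<close>

definition admissible :: "real \<Rightarrow> real \<Rightarrow> bool" where
  "admissible s b \<longleftrightarrow> 1 < s \<and> s ^ 3 \<le> 4/3 \<and> 4/3 < b \<and> s * b \<le> 2 \<and> b * s < 4/3 * (s + 1) \<and>
     4/3 * s\<^sup>2 \<le> ratio s b \<and> scale s b \<le> centre_y s b \<and>
     3 * scale s b \<le> centre_x s b - centre_y s b \<and>
     centre_x s b + centre_y s b + 3 * scale s b \<le> 2"

lemma scale_pos: "admissible s b \<Longrightarrow> 0 < scale s b"
proof -
  have "1 + s\<^sup>2 > 0" using zero_le_power2[of s] by linarith
  then show "admissible s b \<Longrightarrow> 0 < scale s b" by (simp add: admissible_def scale_eq)
qed

abbreviation "centre s b \<equiv> pt (centre_x s b) (centre_y s b)"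

lemma Psi_iterate_place:
  assumes "admissible s b"
  shows "(Psi s b ^^ j) (place (centre s b) (scale s b) \<sigma> p)
     = centre s b + scale s b *\<^sub>R (rotor s (ratio s b) ^^ j) (pt (- p $ 1) (\<sigma> * p $ 2))"
  using assms unfolding place_def admissible_def by (intro Psi_rotor_iterate) auto

lemma Psi_image_place:
  assumes "admissible s b"
  shows "(Psi s b ^^ j) ` place (centre s b) (scale s b) \<sigma> ` T
     = (\<lambda>p. centre s b + scale s b *\<^sub>R (rotor s (ratio s b) ^^ j) (pt (- p $ 1) (\<sigma> * p $ 2))) ` T"
  unfolding image_image Psi_iterate_place[OF assms] ..

lemma place_image: "place q r \<sigma> ` T = (\<lambda>p. q + r *\<^sub>R pt (- p $ 1) (\<sigma> * p $ 2)) ` T"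
  by (simp add: place_def)

lemma admissible_bounds:
  assumes "admissible s b"
  shows "1 < s" "s ^ 3 \<le> 4/3" "4/3 * s\<^sup>2 \<le> ratio s b" "4/3 \<le> ratio s b / s\<^sup>2" "4/3 \<le> ratio s b / s"
proof -
  show g: "1 < s" "s ^ 3 \<le> 4/3" "4/3 * s\<^sup>2 \<le> ratio s b"
    using assms by (auto simp: admissible_def)
  have "1 < s\<^sup>2" "s \<le> s\<^sup>2" using g by (simp_all add: less_1_mult power2_eq_square)
  then show "4/3 \<le> ratio s b / s\<^sup>2" "4/3 \<le> ratio s b / s"
    using g by (subst pos_le_divide_eq; auto simp: mult.commute)+
qed

text \<open>The images of the corner lie in sectors that a line through the centre separates from it.\<close>

lemma Psi_small_copy_plus:
  assumes g: "admissible s b"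
  shows "small_copy (Psi s b) (Psi (s ^ 4) (ratio s b / s\<^sup>2)) 4 (place (centre s b) (scale s b) 1)"
proof -
  let ?\<kappa> = "ratio s b" and ?r = "scale s b" and ?q = "centre s b"
  note gb = admissible_bounds[OF g]
  note orbit = rotor_orbit_plus[OF gb(1-3)]
  note bounds = folded_bounds[OF _ gb(4)]
  have "interior ((Psi s b ^^ j) ` place ?q ?r 1 ` T) \<inter> interior (place ?q ?r 1 ` T) = {}"
    if "j \<in> {1..<4}" for j
  proof -
    have "j = 1 \<or> j = 2 \<or> j = 3" using that by auto
    then show ?thesis
    proof (elim disjE)
      assume "j = 1"
      then show ?thesis unfolding Psi_image_place[OF g] unfolding place_image
        using gb
        by (intro sector_interiors_disjoint[of 0 1] scale_pos[OF g])
          (auto simp: orbit bounds T_bounds zero_le_mult_iff mult_le_0_iff)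
    next
      assume "j = 2"
      then show ?thesis unfolding Psi_image_place[OF g] unfolding place_image
        using gb
        by (intro sector_interiors_disjoint[of 0 1] scale_pos[OF g])
          (auto simp: orbit bounds T_bounds zero_le_mult_iff mult_le_0_iff)
    next
      assume "j = 3"
      then show ?thesis unfolding Psi_image_place[OF g] unfolding place_image
        using gb
        by (subst Int_commute, intro sector_interiors_disjoint[of 1 0] scale_pos[OF g])
          (auto simp: orbit bounds T_bounds zero_le_mult_iff mult_le_0_iff)
    qed
  qed
  moreover have "(Psi s b ^^ 4) (place ?q ?r 1 p) = place ?q ?r 1 (Psi (s ^ 4) (?\<kappa> / s\<^sup>2) p)"
    if "p \<in> T" for p
    using that unfolding Psi_iterate_place[OF g] by (simp add: orbit place_def Psi_def)
  moreover have "place ?q ?r 1 ` T \<subset> T"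
    using g scale_pos[OF g] by (intro place_T) (auto simp: admissible_def)
  ultimately show ?thesis by (simp add: small_copy_def)
qed

lemma Psi_small_copy_minus:
  assumes g: "admissible s b"
  shows "small_copy (Psi s b) (Psi (s ^ 4) (ratio s b / s)) 4 (place (centre s b) (scale s b) (-1))"
proof -
  let ?\<kappa> = "ratio s b" and ?r = "scale s b" and ?q = "centre s b"
  note gb = admissible_bounds[OF g]
  note orbit = rotor_orbit_minus[OF gb(1-3)]
  note bounds = folded_bounds[OF _ gb(5)]
  have "interior ((Psi s b ^^ j) ` place ?q ?r (-1) ` T) \<inter> interior (place ?q ?r (-1) ` T) = {}"
    if "j \<in> {1..<4}" for j
  proof -
    have "j = 1 \<or> j = 2 \<or> j = 3" using that by auto
    then show ?thesis
    proof (elim disjE)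
      assume "j = 1"
      then show ?thesis unfolding Psi_image_place[OF g] unfolding place_image
        using gb
        by (subst Int_commute, intro sector_interiors_disjoint[of 1 0] scale_pos[OF g])
          (auto simp: orbit bounds T_bounds zero_le_mult_iff mult_le_0_iff)
    next
      assume "j = 2"
      then show ?thesis unfolding Psi_image_place[OF g] unfolding place_image
        using gb
        by (subst Int_commute, intro sector_interiors_disjoint[of 1 0] scale_pos[OF g])
          (auto simp: orbit bounds T_bounds zero_le_mult_iff mult_le_0_iff)
    next
      assume "j = 3"
      then show ?thesis unfolding Psi_image_place[OF g] unfolding place_image
        using gb
        by (subst Int_commute, intro sector_interiors_disjoint[of 0 1] scale_pos[OF g])
          (auto simp: orbit bounds T_bounds zero_le_mult_iff mult_le_0_iff)
    qed
  qed
  moreover have "(Psi s b ^^ 4) (place ?q ?r (-1) p) = place ?q ?r (-1) (Psi (s ^ 4) (?\<kappa> / s) p)"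
    if "p \<in> T" for p
    using that unfolding Psi_iterate_place[OF g] by (simp add: orbit place_def Psi_def)
  moreover have "place ?q ?r (-1) ` T \<subset> T"
    using g scale_pos[OF g] by (intro place_T) (auto simp: admissible_def)
  ultimately show ?thesis by (simp add: small_copy_def)
qed

text \<open>The two cycles occupy different sectors, which is the source of the doubling.\<close>

lemma Psi_copies_apart:
  assumes g: "admissible s b" and j: "j < 4"
  shows "interior (place (centre s b) (scale s b) 1 ` T) \<inter>
     interior ((Psi s b ^^ j) ` place (centre s b) (scale s b) (-1) ` T) = {}"
proof -
  note gb = admissible_bounds[OF g]
  note orbit = rotor_orbit_minus[OF gb(1-3)]
  note bounds = folded_bounds[OF _ gb(5)]
  have "j = 0 \<or> j = 1 \<or> j = 2 \<or> j = 3" using j by auto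
  then show ?thesis
  proof (elim disjE)
    assume "j = 0"
    then show ?thesis unfolding Psi_image_place[OF g] unfolding place_image
      by (subst Int_commute, intro sector_interiors_disjoint[of 0 1] scale_pos[OF g])
        (auto simp: T_bounds)
  next
    assume "j = 1"
    then show ?thesis unfolding Psi_image_place[OF g] unfolding place_image
      using gb
      by (intro sector_interiors_disjoint[of 1 0] scale_pos[OF g])
        (auto simp: orbit bounds T_bounds zero_le_mult_iff mult_le_0_iff)
  next
    assume "j = 2"
    then show ?thesis unfolding Psi_image_place[OF g] unfolding place_image
      using gb
      by (intro sector_interiors_disjoint[of 1 0] scale_pos[OF g])
        (auto simp: orbit bounds T_bounds zero_le_mult_iff mult_le_0_iff)
  next
    assume "j = 3"
    then show ?thesis unfolding Psi_image_place[OF g] unfolding place_image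
      using gb
      by (intro sector_interiors_disjoint[of 1 1] scale_pos[OF g])
        (auto simp: orbit bounds T_bounds zero_le_mult_iff mult_le_0_iff)
  qed
qed

section \<open>The original family near its fixed point\<close>

text \<open>The map \<open>Lambda t\<close> seen from its fixed point \<open>hub t\<close>, in units of \<open>hub_scale t\<close>: one fold, followed by
a rotation by \<open>- 3 * pi / 4\<close> and an expansion by \<open>t * sqrt 2\<close>.\<close>

definition spinner :: "real \<Rightarrow> real^2 \<Rightarrow> real^2" where
  "spinner t p = (let u = max (p $ 1) (- 8/3 - p $ 1) in pt (t * (p $ 2 - u)) (- t * (u + p $ 2)))"

definition hub :: "real \<Rightarrow> real^2" where
  "hub t = (1 / (1 + 2 * t + 2 * t\<^sup>2)) *\<^sub>R pt (2 * t + 4 * t\<^sup>2) (2 * t)"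

definition hub_scale :: "real \<Rightarrow> real" where
  "hub_scale t = 3/4 * (2 * t\<^sup>2 - 1) / (1 + 2 * t + 2 * t\<^sup>2)"

lemma Lambda_spinner:
  assumes t: "1 < 2 * t\<^sup>2" "0 < t" and T: "hub t + hub_scale t *\<^sub>R p \<in> T"
  shows "Lambda t (hub t + hub_scale t *\<^sub>R p) = hub t + hub_scale t *\<^sub>R spinner t p"
proof -
  let ?x = "hub t $ 1" and ?y = "hub t $ 2" and ?r = "hub_scale t"
  let ?u = "max (p $ 1) (- 8/3 - p $ 1)"
  define N where "N = 1 + 2 * t + 2 * t\<^sup>2"
  have N: "0 < N" using t by (simp add: N_def)
  have r: "0 < ?r" using t N by (simp add: hub_scale_def N_def)
  have hN: "?x * N = 2 * t + 4 * t\<^sup>2" "?y * N = 2 * t" "?r * N = 3/4 * (2 * t\<^sup>2 - 1)"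
    using N unfolding hub_def hub_scale_def N_def[symmetric] by simp_all
  have eqI: "a = b" if "a * N = b * N" for a b using that N by simp
  have e: "?x = 1 + 4/3 * ?r"
    by (rule eqI) (use hN in \<open>simp add: ring_distribs N_def\<close>)
  have x: "?x = t * (2 - ?x + ?y)"
  proof (rule eqI)
    have "t * (2 - ?x + ?y) * N = t * (2 * N - ?x * N + ?y * N)" by (simp add: algebra_simps)
    also have "\<dots> = ?x * N" unfolding hN by (simp add: N_def algebra_simps power2_eq_square)
    finally show "?x * N = t * (2 - ?x + ?y) * N" by (rule sym)
  qed
  have y: "?y = t * (2 - ?x - ?y)"
  proof (rule eqI)
    have "t * (2 - ?x - ?y) * N = t * (2 * N - ?x * N - ?y * N)" by (simp add: algebra_simps)
    also have "\<dots> = ?y * N" unfolding hN by (simp add: N_def algebra_simps power2_eq_square)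
    finally show "?y * N = t * (2 - ?x - ?y) * N" by (rule sym)
  qed
  have f: "min (?x + ?r * p $ 1) (2 - (?x + ?r * p $ 1)) = 2 - ?x - ?r * ?u"
  proof (cases "p $ 1 \<le> - 8/3 - p $ 1")
    case True
    then have "?r * p $ 1 \<le> ?r * (- 8/3 - p $ 1)" using r by (intro mult_left_mono) auto
    with True show ?thesis unfolding e by (simp add: min_def max_def algebra_simps)
  next
    case False
    then have "?r * (- 8/3 - p $ 1) \<le> ?r * p $ 1" using r by (intro mult_left_mono) auto
    with False show ?thesis unfolding e by (simp add: min_def max_def algebra_simps)
  qed
  have "t * (2 - ?x - ?r * ?u + (?y + ?r * p $ 2)) = t * (2 - ?x + ?y) + ?r * (t * (p $ 2 - ?u))"
    "t * (2 - ?x - ?r * ?u - (?y + ?r * p $ 2)) = t * (2 - ?x - ?y) + ?r * (- t * (?u + p $ 2))"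
    by (simp_all add: algebra_simps)
  then show ?thesis
    unfolding Lambda_eq[OF T] x[symmetric] y[symmetric]
    by (simp add: pt_eq_iff tent_step_def fold_x_def f spinner_def Let_def)
qed

lemma spinner_unfolded:
  assumes "- 4/3 \<le> x"
  shows "spinner t (pt x y) = pt (t * (y - x)) (- t * (x + y))"
  using assms by (simp add: spinner_def Let_def max_def)

text \<open>Eight rotations by \<open>- 3 * pi / 4\<close> lead back to the start. The single fold line is met twice by the
triangle: at the first step and, from the other side of the corner, at the sixth one.\<close>

lemma spinner_orbit:
  assumes t: "0 < t" "t ^ 2 \<le> 2/3" "t ^ 3 \<le> 1/2" "t ^ 5 \<le> 1/4" and p: "p \<in> T"
  defines "p1 \<equiv> fold_x (4/3) p" and "p2 \<equiv> fold_diag (1 / (3 * t ^ 5)) (fold_x (4/3) p)"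
    and "w \<equiv> pt (- p $ 1) (p $ 2)"
  shows "spinner t w = pt (t * (p1 $ 1 + p1 $ 2)) (t * (p1 $ 1 - p1 $ 2))"
    "(spinner t ^^ 2) w = pt (- (t ^ 2) * (2 * p1 $ 2)) (- (t ^ 2) * (2 * p1 $ 1))"
    "(spinner t ^^ 3) w = pt (- (t ^ 3) * (2 * (p1 $ 1 - p1 $ 2))) (t ^ 3 * (2 * (p1 $ 1 + p1 $ 2)))"
    "(spinner t ^^ 4) w = pt (t ^ 4 * (4 * p1 $ 1)) (- (t ^ 4) * (4 * p1 $ 2))"
    "(spinner t ^^ 5) w = pt (- (t ^ 5) * (4 * (p1 $ 1 + p1 $ 2))) (- (t ^ 5) * (4 * (p1 $ 1 - p1 $ 2)))"
    "(spinner t ^^ 6) w = pt (t ^ 6 * (8 * p2 $ 2)) (t ^ 6 * (8 * p2 $ 1))"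
    "(spinner t ^^ 7) w = pt (t ^ 7 * (8 * (p2 $ 1 - p2 $ 2))) (- (t ^ 7) * (8 * (p2 $ 1 + p2 $ 2)))"
    "(spinner t ^^ 8) w = pt (- (t ^ 8) * (16 * p2 $ 1)) (t ^ 8 * (16 * p2 $ 2))"
proof -
  have tn: "0 < t ^ n" for n using t by simp
  have b': "4/3 \<le> 1 / (3 * t ^ 5)" using t tn[of 5] by (subst pos_le_divide_eq) auto
  note b = folded_bounds[OF p b', folded p2_def, folded p1_def]
  have nn: "0 \<le> t ^ n * c" if "0 \<le> c" for n and c using that tn[of n] by simp
  have "max (- p $ 1) (- 8/3 - - p $ 1) = - p1 $ 1" "p $ 2 = p1 $ 2"
    by (simp_all only: p1_def fold_x_minus) (simp add: fold_x_def)
  then show 1: "spinner t w = pt (t * (p1 $ 1 + p1 $ 2)) (t * (p1 $ 1 - p1 $ 2))"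
    by (simp add: w_def spinner_def Let_def algebra_simps)
  have "spinner t (pt (t * (p1 $ 1 + p1 $ 2)) (t * (p1 $ 1 - p1 $ 2)))
      = pt (- (t ^ 2) * (2 * p1 $ 2)) (- (t ^ 2) * (2 * p1 $ 1))"
    by (subst spinner_unfolded)
      (use nn[of "p1 $ 1 + p1 $ 2" 1] b in \<open>auto simp: algebra_simps power2_eq_square\<close>)
  then show 2: "(spinner t ^^ 2) w = pt (- (t ^ 2) * (2 * p1 $ 2)) (- (t ^ 2) * (2 * p1 $ 1))"
    using 1 by (simp add: numeral_2_eq_2)
  have "spinner t (pt (- (t ^ 2) * (2 * p1 $ 2)) (- (t ^ 2) * (2 * p1 $ 1)))
      = pt (- (t ^ 3) * (2 * (p1 $ 1 - p1 $ 2))) (t ^ 3 * (2 * (p1 $ 1 + p1 $ 2)))"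
    by (subst spinner_unfolded)
      (use mult_mono[of "t ^ 2" "2/3" "p1 $ 2" 1] t b in
        \<open>auto simp: algebra_simps power_numeral_reduce\<close>)
  then show 3: "(spinner t ^^ 3) w
      = pt (- (t ^ 3) * (2 * (p1 $ 1 - p1 $ 2))) (t ^ 3 * (2 * (p1 $ 1 + p1 $ 2)))"
    using 2 by (simp add: numeral_eq_Suc)
  have "spinner t (pt (- (t ^ 3) * (2 * (p1 $ 1 - p1 $ 2))) (t ^ 3 * (2 * (p1 $ 1 + p1 $ 2))))
      = pt (t ^ 4 * (4 * p1 $ 1)) (- (t ^ 4) * (4 * p1 $ 2))"
    by (subst spinner_unfolded)
      (use mult_mono[of "t ^ 3" "1/2" "p1 $ 1 - p1 $ 2" "4/3"] t b in
        \<open>auto simp: algebra_simps power_numeral_reduce\<close>)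
  then show 4: "(spinner t ^^ 4) w = pt (t ^ 4 * (4 * p1 $ 1)) (- (t ^ 4) * (4 * p1 $ 2))"
    using 3 by (simp add: numeral_eq_Suc)
  have "spinner t (pt (t ^ 4 * (4 * p1 $ 1)) (- (t ^ 4) * (4 * p1 $ 2)))
      = pt (- (t ^ 5) * (4 * (p1 $ 1 + p1 $ 2))) (- (t ^ 5) * (4 * (p1 $ 1 - p1 $ 2)))"
    by (subst spinner_unfolded)
      (use nn[of "p1 $ 1" 4] b in \<open>auto simp: algebra_simps power_numeral_reduce\<close>)
  then show 5: "(spinner t ^^ 5) w
      = pt (- (t ^ 5) * (4 * (p1 $ 1 + p1 $ 2))) (- (t ^ 5) * (4 * (p1 $ 1 - p1 $ 2)))"
    using 4 by (simp add: numeral_eq_Suc)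
  define z where "z = t ^ 5 * (4 * (p1 $ 1 + p1 $ 2))"
  have z: "- (t ^ 5) * (4 * (p1 $ 1 + p1 $ 2)) = - z" by (simp add: z_def)
  \<comment> \<open>the second fold, rewritten in the coordinates of the original triangle\<close>
  define \<mu> where "\<mu> = max 0 (p1 $ 1 + p1 $ 2 - 1 / (3 * t ^ 5))"
  have p2: "p2 = pt (p1 $ 1 - \<mu>) (p1 $ 2 - \<mu>)"
    by (simp add: p2_def p1_def \<mu>_def fold_diag_def Let_def)
  have "8 * t ^ 5 * \<mu> = max (8 * t ^ 5 * 0) (8 * t ^ 5 * (p1 $ 1 + p1 $ 2 - 1 / (3 * t ^ 5)))"
    unfolding \<mu>_def using tn[of 5] by (simp only: max_mult_distrib_left) simp
  also have "8 * t ^ 5 * (p1 $ 1 + p1 $ 2 - 1 / (3 * t ^ 5)) = 2 * z - 8/3"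
    using tn[of 5] by (simp add: z_def field_simps)
  finally have "max (- z) (- 8/3 - - z) = 8 * t ^ 5 * \<mu> - z"
    by (simp add: max_def)
  then have "spinner t (pt (- (t ^ 5) * (4 * (p1 $ 1 + p1 $ 2))) (- (t ^ 5) * (4 * (p1 $ 1 - p1 $ 2))))
      = pt (t ^ 6 * (8 * p2 $ 2)) (t ^ 6 * (8 * p2 $ 1))"
    unfolding spinner_def pt_nth Let_def p2 z
    by (simp only:) (simp add: z_def algebra_simps power_numeral_reduce)
  then show 6: "(spinner t ^^ 6) w = pt (t ^ 6 * (8 * p2 $ 2)) (t ^ 6 * (8 * p2 $ 1))"
    using 5 by (simp add: numeral_eq_Suc)
  have "spinner t (pt (t ^ 6 * (8 * p2 $ 2)) (t ^ 6 * (8 * p2 $ 1)))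
      = pt (t ^ 7 * (8 * (p2 $ 1 - p2 $ 2))) (- (t ^ 7) * (8 * (p2 $ 1 + p2 $ 2)))"
    by (subst spinner_unfolded)
      (use nn[of "p2 $ 2" 6] b in \<open>auto simp: algebra_simps power_numeral_reduce\<close>)
  then show 7: "(spinner t ^^ 7) w
      = pt (t ^ 7 * (8 * (p2 $ 1 - p2 $ 2))) (- (t ^ 7) * (8 * (p2 $ 1 + p2 $ 2)))"
    using 6 by (simp add: numeral_eq_Suc)
  have "spinner t (pt (t ^ 7 * (8 * (p2 $ 1 - p2 $ 2))) (- (t ^ 7) * (8 * (p2 $ 1 + p2 $ 2))))
      = pt (- (t ^ 8) * (16 * p2 $ 1)) (t ^ 8 * (16 * p2 $ 2))"
    by (subst spinner_unfolded)
      (use nn[of "p2 $ 1 - p2 $ 2" 7] b in \<open>auto simp: algebra_simps power_numeral_reduce\<close>)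
  then show "(spinner t ^^ 8) w = pt (- (t ^ 8) * (16 * p2 $ 1)) (t ^ 8 * (16 * p2 $ 2))"
    using 7 by (simp add: numeral_eq_Suc)
qed


definition admissible_time :: "real \<Rightarrow> bool" where
  "admissible_time t \<longleftrightarrow> 1 / sqrt 2 < t \<and> t \<le> 1 \<and> t ^ 2 \<le> 2/3 \<and> t ^ 3 \<le> 1/2 \<and> t ^ 5 \<le> 1/4 \<and>
     hub_scale t \<le> hub t $ 2 \<and> 3 * hub_scale t \<le> hub t $ 1 - hub t $ 2 \<and>
     hub t $ 1 + hub t $ 2 + 3 * hub_scale t \<le> 2"

lemma Lambda_small_copy:
  assumes g: "admissible_time t"
  shows "small_copy (Lambda t) (Psi (16 * t ^ 8) (1 / (3 * t ^ 5))) 8 (place (hub t) (hub_scale t) 1)"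
proof -
  let ?h = "place (hub t) (hub_scale t) 1"
  have gt: "1 / sqrt 2 < t" "t \<le> 1" "t ^ 2 \<le> 2/3" "t ^ 3 \<le> 1/2" "t ^ 5 \<le> 1/4"
    using g by (auto simp: admissible_time_def)
  note t = half_less_square[OF gt(1)]
  have tn: "0 < t ^ n" for n using t by simp
  have "0 < 1 + 2 * t + 2 * t\<^sup>2" using t by simp
  then have r: "0 < hub_scale t" using t by (simp add: hub_scale_def)
  have sub: "?h ` T \<subset> T"
    using g r by (intro place_T) (auto simp: admissible_time_def)
  have inT: "(Lambda t ^^ j) p \<in> T" if "p \<in> T" for j p
    using that by (induction j) (auto intro: Lambda_T[OF gt(1,2)])
  have it: "(Lambda t ^^ j) (hub t + hub_scale t *\<^sub>R p) = hub t + hub_scale t *\<^sub>R (spinner t ^^ j) p"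
    if "hub t + hub_scale t *\<^sub>R p \<in> T" for j p
  proof (induction j)
    case (Suc j)
    have "hub t + hub_scale t *\<^sub>R (spinner t ^^ j) p \<in> T"
      using inT[OF that, of j] Suc by simp
    then show ?case using Suc Lambda_spinner[OF t(2,1)] by simp
  qed simp
  have it': "(Lambda t ^^ j) (?h p)
      = hub t + hub_scale t *\<^sub>R (spinner t ^^ j) (pt (- p $ 1) (1 * p $ 2))" if "p \<in> T" for j p
  proof -
    have "?h p \<in> T" using sub that by blast
    then show ?thesis unfolding place_def by (rule it)
  qed
  then have im: "(Lambda t ^^ j) ` ?h ` T
      = (\<lambda>p. hub t + hub_scale t *\<^sub>R (spinner t ^^ j) (pt (- p $ 1) (1 * p $ 2))) ` T" for j
    unfolding image_image by (intro image_cong refl)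
  have b': "4/3 \<le> 1 / (3 * t ^ 5)" using gt tn[of 5] by (subst pos_le_divide_eq) auto
  note orbit = spinner_orbit[OF t(1) gt(3-5)]
  note bounds = folded_bounds[OF _ b']
  have "interior ((Lambda t ^^ j) ` ?h ` T) \<inter> interior (?h ` T) = {}" if "j \<in> {1..<8}" for j
  proof -
    have "j = 1 \<or> j = 2 \<or> j = 3 \<or> j = 4 \<or> j = 5 \<or> j = 6 \<or> j = 7" using that by auto
    then show ?thesis
    proof (elim disjE)
      assume "j = 1"
      then show ?thesis unfolding im unfolding place_image
        using tn t by (subst Int_commute, intro sector_interiors_disjoint[of 1 0] r)
          (auto simp: orbit bounds T_bounds zero_le_mult_iff mult_le_0_iff)
    next
      assume "j = 2"
      then show ?thesis unfolding im unfolding place_image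
        using tn t by (intro sector_interiors_disjoint[of 0 1] r)
          (auto simp: orbit bounds T_bounds zero_le_mult_iff mult_le_0_iff)
    next
      assume "j = 3"
      then show ?thesis unfolding im unfolding place_image
        using tn t by (subst Int_commute, intro sector_interiors_disjoint[of 1 1] r)
          (auto simp: orbit bounds T_bounds zero_le_mult_iff mult_le_0_iff)
    next
      assume "j = 4"
      then show ?thesis unfolding im unfolding place_image
        using tn t by (subst Int_commute, intro sector_interiors_disjoint[of 1 0] r)
          (auto simp: orbit bounds T_bounds zero_le_mult_iff mult_le_0_iff)
    next
      assume "j = 5"
      then show ?thesis unfolding im unfolding place_image
        using tn t by (intro sector_interiors_disjoint[of 0 1] r)
          (auto simp: orbit bounds T_bounds zero_le_mult_iff mult_le_0_iff)
    next
      assume "j = 6"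
      then show ?thesis unfolding im unfolding place_image
        using tn t by (subst Int_commute, intro sector_interiors_disjoint[of 1 0] r)
          (auto simp: orbit bounds T_bounds zero_le_mult_iff mult_le_0_iff)
    next
      assume "j = 7"
      then show ?thesis unfolding im unfolding place_image
        using tn t by (subst Int_commute, intro sector_interiors_disjoint[of 1 0] r)
          (auto simp: orbit bounds T_bounds zero_le_mult_iff mult_le_0_iff)
    qed
  qed
  moreover have "(Lambda t ^^ 8) (?h p) = ?h (Psi (16 * t ^ 8) (1 / (3 * t ^ 5)) p)" if "p \<in> T" for p
    using that unfolding it'[OF that] by (simp add: orbit place_def Psi_def algebra_simps)
  ultimately show ?thesis using sub by (simp add: small_copy_def)
qed

section \<open>Parameters close to the limit\<close>

text \<open>The value \<open>4/3 * sqrt 2\<close> makes the two fold lines equidistant from the origin.\<close>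

definition limit_params :: "real \<times> real" where
  "limit_params = (1, 4/3 * sqrt 2)"

lemma isCont_tendsto_nhds: "isCont f x \<Longrightarrow> (f \<longlongrightarrow> f x) (nhds x)"
  unfolding isCont_def by (rule tendsto_at_iff_tendsto_nhds[THEN iffD1])

lemma eventually_nhds_less:
  fixes F G :: "'a :: t2_space \<Rightarrow> real"
  assumes "isCont F x" "isCont G x" "F x < G x"
  shows "\<forall>\<^sub>F p in nhds x. F p < G p"
proof -
  have "((\<lambda>p. G p - F p) \<longlongrightarrow> G x - F x) (nhds x)"
    using isCont_tendsto_nhds[OF isCont_diff[OF assms(2,1)]] .
  then have "\<forall>\<^sub>F p in nhds x. 0 < G p - F p"
    by (rule order_tendstoD) (use assms(3) in simp)
  then show ?thesis by simp
qed

lemma sqrt2_bounds: "(1.41::real) < sqrt 2" "sqrt 2 < (1.42::real)"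
  by (rule real_less_rsqrt, simp add: power2_eq_square)
    (rule real_less_lsqrt, simp_all add: power2_eq_square)

lemma limit_values:
  "centre_x (fst limit_params) (snd limit_params) = 4/3"
  "centre_y (fst limit_params) (snd limit_params) = 4/3 * sqrt 2 - 4/3"
  "scale (fst limit_params) (snd limit_params) = 0"
  "ratio (fst limit_params) (snd limit_params) = 4/3 * sqrt 2"
proof -
  show c: "centre_x (fst limit_params) (snd limit_params) = 4/3" by (simp add: limit_params_def centre_x_def)
  then show "centre_y (fst limit_params) (snd limit_params) = 4/3 * sqrt 2 - 4/3" "scale (fst limit_params) (snd limit_params) = 0"
    by (simp_all add: centre_y_def scale_def) (simp add: limit_params_def)
  have "8/3 - 4/3 * sqrt 2 \<noteq> 0" using sqrt2_bounds by simp
  then show "ratio (fst limit_params) (snd limit_params) = 4/3 * sqrt 2"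
    by (simp add: ratio_def limit_params_def field_simps)
qed

lemma limit_continuity:
  "isCont (\<lambda>p. centre_x (fst p) (snd p)) limit_params"
  "isCont (\<lambda>p. centre_y (fst p) (snd p)) limit_params"
  "isCont (\<lambda>p. scale (fst p) (snd p)) limit_params"
  "isCont (\<lambda>p. ratio (fst p) (snd p)) limit_params"
proof -
  show c: "isCont (\<lambda>p. centre_x (fst p) (snd p)) limit_params"
    unfolding centre_x_def by (intro continuous_intros) (simp add: limit_params_def)
  then show "isCont (\<lambda>p. centre_y (fst p) (snd p)) limit_params"
    unfolding centre_y_def by (intro continuous_intros)
  show "isCont (\<lambda>p. scale (fst p) (snd p)) limit_params"
    unfolding scale_def by (intro continuous_intros c)
  show "isCont (\<lambda>p. ratio (fst p) (snd p)) limit_params"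
    unfolding ratio_def
    by (intro continuous_intros) (use sqrt2_bounds in \<open>simp add: limit_params_def\<close>)
qed

lemma eventually_admissible: "\<forall>\<^sub>F p in nhds limit_params. 1 < fst p \<longrightarrow> admissible (fst p) (snd p)"
proof -
  note sq = sqrt2_bounds
  note c = continuous_intros limit_continuity
  have "\<forall>\<^sub>F p in nhds limit_params. fst p ^ 3 < 4/3"
    by (intro eventually_nhds_less c) (simp add: limit_params_def)
  moreover have "\<forall>\<^sub>F p in nhds limit_params. 4/3 < snd p"
    by (intro eventually_nhds_less c) (use sq in \<open>simp add: limit_params_def\<close>)
  moreover have "\<forall>\<^sub>F p in nhds limit_params. fst p * snd p < 2"
    by (intro eventually_nhds_less c) (use sq in \<open>simp add: limit_params_def\<close>)
  moreover have "\<forall>\<^sub>F p in nhds limit_params. snd p * fst p < 4/3 * (fst p + 1)"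
    by (intro eventually_nhds_less c) (use sq in \<open>simp add: limit_params_def\<close>)
  moreover have "\<forall>\<^sub>F p in nhds limit_params. 4/3 * (fst p)\<^sup>2 < ratio (fst p) (snd p)"
    by (intro eventually_nhds_less c) (use sq in \<open>simp add: limit_values, simp add: limit_params_def\<close>)
  moreover have "\<forall>\<^sub>F p in nhds limit_params. scale (fst p) (snd p) < centre_y (fst p) (snd p)"
    by (intro eventually_nhds_less c) (use sq in \<open>simp add: limit_values\<close>)
  moreover have "\<forall>\<^sub>F p in nhds limit_params.
      3 * scale (fst p) (snd p) < centre_x (fst p) (snd p) - centre_y (fst p) (snd p)"
    by (intro eventually_nhds_less c) (use sq in \<open>simp add: limit_values\<close>)
  moreover have "\<forall>\<^sub>F p in nhds limit_params.
      centre_x (fst p) (snd p) + centre_y (fst p) (snd p) + 3 * scale (fst p) (snd p) < 2"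
    by (intro eventually_nhds_less c) (use sq in \<open>simp add: limit_values\<close>)
  ultimately show ?thesis
    by eventually_elim (auto simp: admissible_def)
qed

definition next_plus :: "real \<times> real \<Rightarrow> real \<times> real" where
  "next_plus p = (fst p ^ 4, ratio (fst p) (snd p) / (fst p)\<^sup>2)"
definition next_minus :: "real \<times> real \<Rightarrow> real \<times> real" where
  "next_minus p = (fst p ^ 4, ratio (fst p) (snd p) / fst p)"

lemma next_tendsto:
  "filterlim next_plus (nhds limit_params) (nhds limit_params)" "filterlim next_minus (nhds limit_params) (nhds limit_params)"
proof -
  have "isCont next_plus limit_params" "isCont next_minus limit_params"
    unfolding next_plus_def next_minus_def
    by (intro continuous_intros limit_continuity; simp add: limit_params_def)+
  moreover have "next_plus limit_params = limit_params" "next_minus limit_params = limit_params"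
    unfolding next_plus_def next_minus_def limit_values by (simp_all add: limit_params_def)
  ultimately show "filterlim next_plus (nhds limit_params) (nhds limit_params)" "filterlim next_minus (nhds limit_params) (nhds limit_params)"
    using isCont_tendsto_nhds[where f = next_plus and x = limit_params] isCont_tendsto_nhds[where f = next_minus and x = limit_params] by simp_all
qed

text \<open>Since the maps of the parameters fix the limit, a neighbourhood that is good for \<open>n\<close> steps can be
pulled back along them. The neighbourhood shrinks with \<open>n\<close>: the limit is a repelling fixed point.\<close>

lemma near_limit_induct:
  assumes zero: "\<And>s b. admissible s b \<Longrightarrow> P 0 s b"
    and step: "\<And>n s b. admissible s b \<Longrightarrow> P n (s ^ 4) (ratio s b / s\<^sup>2) \<Longrightarrow>
      P n (s ^ 4) (ratio s b / s) \<Longrightarrow> P (Suc n) s b"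
  shows "\<forall>\<^sub>F p in nhds limit_params. 1 < fst p \<longrightarrow> P n (fst p) (snd p)"
proof (induction n)
  case 0
  show ?case using eventually_admissible by eventually_elim (auto intro: zero)
next
  case (Suc n)
  have "\<forall>\<^sub>F p in nhds limit_params. 1 < fst (next_plus p) \<longrightarrow> P n (fst (next_plus p)) (snd (next_plus p))"
    using eventually_compose_filterlim[OF Suc next_tendsto(1)] .
  moreover have "\<forall>\<^sub>F p in nhds limit_params. 1 < fst (next_minus p) \<longrightarrow> P n (fst (next_minus p)) (snd (next_minus p))"
    using eventually_compose_filterlim[OF Suc next_tendsto(2)] .
  ultimately show ?case
    using eventually_admissible
    by eventually_elim (auto simp: next_plus_def next_minus_def one_less_power intro!: step)
qed

text \<open>The parameters of the map \<open>Psi\<close> to which \<open>Lambda t\<close> renormalizes: the exponent 8 counts the steps, and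
the exponent 5 the expansions that precede the second fold.\<close>

definition hub_params :: "real \<Rightarrow> real \<times> real" where
  "hub_params t = (16 * t ^ 8, 1 / (3 * t ^ 5))"

lemma hub_params_limit: "hub_params (1 / sqrt 2) = limit_params"
proof -
  have "sqrt 2 ^ 8 = 16" "sqrt 2 ^ 5 = 4 * sqrt 2"
    by (simp_all add: power_numeral_reduce algebra_simps)
  then show ?thesis
    by (simp add: hub_params_def limit_params_def power_divide real_div_sqrt field_simps)
qed

lemma eventually_admissible_time: "\<forall>\<^sub>F t in at_right (1 / sqrt 2). admissible_time t"
proof -
  let ?c = "1 / sqrt 2"
  have sq: "sqrt 2 ^ 2 = 2" "sqrt 2 ^ 3 = 2 * sqrt 2" "sqrt 2 ^ 5 = 4 * sqrt 2" "sqrt 2 * sqrt 2 = 2"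
    by (simp_all add: power_numeral_reduce algebra_simps)
  note sb = sqrt2_bounds
  have N: "1 + 2 * ?c + 2 * ?c\<^sup>2 \<noteq> 0"
  proof -
    have "0 < ?c" by simp
    then have "0 < 1 + 2 * ?c + 2 * ?c\<^sup>2" by (simp add: add_pos_nonneg)
    then show ?thesis by simp
  qed
  have h1: "hub t $ 1 = (2 * t + 4 * t\<^sup>2) / (1 + 2 * t + 2 * t\<^sup>2)"
    and h2: "hub t $ 2 = 2 * t / (1 + 2 * t + 2 * t\<^sup>2)" for t
    by (simp_all add: hub_def)
  have c: "isCont (\<lambda>t. hub t $ 1) ?c" "isCont (\<lambda>t. hub t $ 2) ?c" "isCont hub_scale ?c"
    unfolding h1 h2 hub_scale_def using N by (intro continuous_intros; simp)+
  have c2: "?c\<^sup>2 = 1/2" by (simp add: power_divide)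
  have d: "?c = sqrt 2 / 2" by (simp add: real_div_sqrt field_simps)
  have v: "hub ?c $ 1 = 1" "hub_scale ?c = 0"
    unfolding h1 hub_scale_def c2 using N[unfolded c2] by simp_all
  have v2: "0 < hub ?c $ 2" "hub ?c $ 2 < 1"
    unfolding h2 c2 d using sb by (simp_all add: field_simps)
  note c = c continuous_intros
  have "\<forall>\<^sub>F t in nhds ?c. t < 1"
    by (intro eventually_nhds_less c) simp
  moreover have "\<forall>\<^sub>F t in nhds ?c. t ^ 2 < 2/3"
    by (intro eventually_nhds_less c) (simp add: c2)
  moreover have "\<forall>\<^sub>F t in nhds ?c. t ^ 3 < 1/2"
    by (intro eventually_nhds_less c) (use sb in \<open>simp add: power_divide sq field_simps\<close>)
  moreover have "\<forall>\<^sub>F t in nhds ?c. t ^ 5 < 1/4"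
    by (intro eventually_nhds_less c) (use sb in \<open>simp add: power_divide sq field_simps\<close>)
  moreover have "\<forall>\<^sub>F t in nhds ?c. hub_scale t < hub t $ 2"
    by (intro eventually_nhds_less c) (use v v2 in simp)
  moreover have "\<forall>\<^sub>F t in nhds ?c. 3 * hub_scale t < hub t $ 1 - hub t $ 2"
    by (intro eventually_nhds_less c) (use v v2 in simp)
  moreover have "\<forall>\<^sub>F t in nhds ?c. hub t $ 1 + hub t $ 2 + 3 * hub_scale t < 2"
    by (intro eventually_nhds_less c) (use v v2 in simp)
  ultimately have "\<forall>\<^sub>F t in nhds ?c. ?c < t \<longrightarrow> admissible_time t"
    by eventually_elim (auto simp: admissible_time_def)
  then show ?thesis
    unfolding eventually_at_filter by eventually_elim auto
qed

lemma eventually_hub_params: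
  assumes "\<forall>\<^sub>F p in nhds limit_params. 1 < fst p \<longrightarrow> P (fst p) (snd p)"
  shows "\<forall>\<^sub>F t in at_right (1 / sqrt 2). P (16 * t ^ 8) (1 / (3 * t ^ 5))"
proof -
  have "isCont hub_params (1 / sqrt 2)"
    unfolding hub_params_def by (intro continuous_intros) simp
  then have "filterlim hub_params (nhds limit_params) (nhds (1 / sqrt 2))"
    using isCont_tendsto_nhds[where f = hub_params and x = "1 / sqrt 2"] by (simp only: hub_params_limit)
  then have "\<forall>\<^sub>F t in nhds (1 / sqrt 2). 1 < fst (hub_params t) \<longrightarrow> P (fst (hub_params t)) (snd (hub_params t))"
    using assms by (rule eventually_compose_filterlim[rotated])
  then show ?thesis
    unfolding eventually_at_filter
  proof eventually_elim
    case (elim t)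
    show ?case
    proof (intro impI)
      assume "t \<in> {1 / sqrt 2<..}"
      then have "1 < (2 * t\<^sup>2) ^ 4" using half_less_square(2)[of t] by (intro one_less_power) auto
      then have "1 < 16 * t ^ 8" by (simp add: power_mult_distrib flip: power_mult)
      then show "P (16 * t ^ 8) (1 / (3 * t ^ 5))" using elim by (simp add: hub_params_def)
    qed
  qed
qed

lemma eventually_renormalizable_Psi:
  "\<forall>\<^sub>F p in nhds limit_params. 1 < fst p \<longrightarrow> renormalizable_EBM n T (Psi (fst p) (snd p))"
proof (rule near_limit_induct)
  show "renormalizable_EBM 0 T (Psi s b)" if "admissible s b" for s b
    using that is_EBM_Psi by (simp add: admissible_def)
next
  fix n s b
  assume g: "admissible s b" and r: "renormalizable_EBM n T (Psi (s ^ 4) (ratio s b / s\<^sup>2))"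
  have "is_EBM T (Psi (s ^ 4) (ratio s b / s\<^sup>2))" using r by (cases n) auto
  then have "renormalizes_to T (Psi s b) (Psi (s ^ 4) (ratio s b / s\<^sup>2))"
    using renormalizes_to_small_copy[OF Psi_small_copy_plus[OF g] scale_pos[OF g]] by simp
  then show "renormalizable_EBM (Suc n) T (Psi s b)"
    using r g is_EBM_Psi[of s b] by (auto simp: admissible_def)
qed

lemma hub_scale_pos: "1 / sqrt 2 < t \<Longrightarrow> 0 < hub_scale t"
  using half_less_square[of t] by (simp add: hub_scale_def add_pos_pos)

lemma eventually_renormalizable_Lambda:
  "\<forall>\<^sub>F t in at_right (1 / sqrt 2). renormalizable_EBM n T (Lambda t)"
proof (cases n)
  case 0
  show ?thesis using eventually_admissible_time
    by eventually_elim (auto simp: 0 admissible_time_def intro: is_EBM_Lambda)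
next
  case (Suc m)
  show ?thesis
    using eventually_admissible_time eventually_hub_params[OF eventually_renormalizable_Psi[of m]]
  proof eventually_elim
    case (elim t)
    then have t: "1 / sqrt 2 < t" "t \<le> 1" by (auto simp: admissible_time_def)
    have "is_EBM T (Psi (16 * t ^ 8) (1 / (3 * t ^ 5)))" using elim by (cases m) auto
    then have "renormalizes_to T (Lambda t) (Psi (16 * t ^ 8) (1 / (3 * t ^ 5)))"
      using renormalizes_to_small_copy[OF Lambda_small_copy[OF elim(1)] hub_scale_pos[OF t(1)]] by simp
    then show ?case using elim is_EBM_Lambda[OF t] by (auto simp: Suc)
  qed
qed

lemma decreasing_thresholds:
  fixes a c :: real
  assumes ev: "\<And>n. \<forall>\<^sub>F t in at_right a. P n t" and c: "a < c"
  shows "\<exists>ts. (\<forall>n. ts (Suc n) < ts n) \<and> (\<forall>n. ts n \<le> c) \<and> ts \<longlonglongrightarrow> a \<and>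
     (\<forall>n::nat. \<forall>t. a < t \<and> t < ts n \<longrightarrow> P n t)"
proof -
  have "\<exists>b>a. \<forall>t>a. t < b \<longrightarrow> P n t" for n
    using ev[of n] eventually_at_right[OF c] by blast
  then obtain b where b: "\<And>n. a < b n" "\<And>n t. a < t \<Longrightarrow> t < b n \<Longrightarrow> P n t"
    by metis
  \<comment> \<open>taking minima makes the thresholds weakly decreasing; the factor \<open>1 / (n + 1)\<close> makes them strictly decreasing and forces the limit\<close>
  define m where "m n = Min (insert c (b ` {..n})) - a" for n
  define ts where "ts n = a + m n / (real n + 1)" for n
  have m: "0 < m n" "m n \<le> c - a" "m n \<le> b n - a" "m (Suc n) \<le> m n" for n
  proof -
    have "Min (insert c (b ` {..n})) \<le> b n" by (rule Min_le) auto
    moreover have "Min (insert c (b ` {..Suc n})) \<le> Min (insert c (b ` {..n}))"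
      by (rule Min_antimono) auto
    ultimately show "m n \<le> b n - a" "m (Suc n) \<le> m n" by (simp_all only: m_def diff_right_mono)
    show "0 < m n" using b(1) c by (simp add: m_def)
    have "Min (insert c (b ` {..n})) \<le> c" by (rule Min_le) auto
    then show "m n \<le> c - a" by (simp only: m_def diff_right_mono)
  qed
  have "ts (Suc n) < ts n" for n
  proof -
    have "m (Suc n) / (real (Suc n) + 1) < m (Suc n) / (real n + 1)"
      using m(1)[of "Suc n"] by (intro divide_strict_left_mono) auto
    also have "\<dots> \<le> m n / (real n + 1)" using m(4)[of n] by (intro divide_right_mono) auto
    finally show ?thesis by (simp add: ts_def)
  qed
  moreover have le: "ts n \<le> a + m n" for n
  proof -
    have "m n / (real n + 1) \<le> m n / 1"
      using m(1)[of n] by (intro divide_left_mono) auto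
    then show ?thesis by (simp add: ts_def)
  qed
  moreover have "ts \<longlonglongrightarrow> a"
  proof (rule real_tendsto_sandwich)
    show "\<forall>\<^sub>F n in sequentially. a \<le> ts n"
      using m(1) by (auto simp: ts_def intro!: always_eventually divide_nonneg_nonneg less_imp_le)
    show "\<forall>\<^sub>F n in sequentially. ts n \<le> a + (c - a) * inverse (real (Suc n))"
      using m(2) by (auto simp: ts_def divide_inverse add.commute intro!: always_eventually mult_right_mono)
    have "(\<lambda>n. a + (c - a) * inverse (real (Suc n))) \<longlonglongrightarrow> a + (c - a) * 0"
      by (intro tendsto_intros LIMSEQ_inverse_real_of_nat)
    then show "(\<lambda>n. a + (c - a) * inverse (real (Suc n))) \<longlonglongrightarrow> a" by simp
  qed simp
  moreover have "P n t" if "a < t" "t < ts n" for n t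
    using that b(2)[of t n] le[of n] m(3)[of n] by linarith
  moreover have "ts n \<le> c" for n using le[of n] m(2)[of n] by linarith
  ultimately show ?thesis by blast
qed

section \<open>Images with interior\<close>

lemma continuous_on_pt [continuous_intros]:
  assumes "continuous_on S f" "continuous_on S g"
  shows "continuous_on S (\<lambda>p. pt (f p) (g p))"
proof -
  have "continuous_on S (\<lambda>p. f p *\<^sub>R pt 1 0 + g p *\<^sub>R pt 0 1)"
    using assms by (intro continuous_intros)
  then show ?thesis by simp
qed

lemma open_image_inverse:
  assumes "continuous_on UNIV g'" "\<And>p. g' (g p) = p" "\<And>p. g (g' p) = p" "open U"
  shows "open (g ` U)"
proof -
  have "g ` U = g' -` U"
  proof
    show "g ` U \<subseteq> g' -` U" using assms(2) by auto
    show "g' -` U \<subseteq> g ` U"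
    proof
      fix p assume "p \<in> g' -` U"
      then show "p \<in> g ` U" using assms(3)[of p] by (intro image_eqI[of _ _ "g' p"]) auto
    qed
  qed
  then show ?thesis using open_vimage[OF assms(4,1)] by simp
qed

text \<open>A fold is not an open map, as it sends an open set that meets the fold line into a closed half plane
with points on the boundary; that interiors stay nonempty is the substitute used below.\<close>

definition fat_images :: "(real^2 \<Rightarrow> real^2) \<Rightarrow> bool" where
  "fat_images f \<longleftrightarrow> (\<forall>W. interior W \<noteq> {} \<longrightarrow> interior (f ` W) \<noteq> {})"

lemma fat_imagesD: "fat_images f \<Longrightarrow> interior W \<noteq> {} \<Longrightarrow> interior (f ` W) \<noteq> {}"
  by (simp add: fat_images_def)

lemma fat_images_comp: "fat_images f \<Longrightarrow> fat_images g \<Longrightarrow> fat_images (\<lambda>p. f (g p))"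
  by (simp add: fat_images_def flip: image_image)

lemma fat_images_piecewise:
  assumes n: "n \<noteq> 0"
    and g1: "\<And>U. open U \<Longrightarrow> open (g1 ` U)" "\<And>p. n \<bullet> p < e \<Longrightarrow> f p = g1 p"
    and g2: "\<And>U. open U \<Longrightarrow> open (g2 ` U)" "\<And>p. n \<bullet> p > e \<Longrightarrow> f p = g2 p"
  shows "fat_images f"
  unfolding fat_images_def
proof (intro allI impI)
  fix W :: "(real^2) set" assume W: "interior W \<noteq> {}"
  let ?L = "interior W \<inter> {p. n \<bullet> p < e}" and ?R = "interior W \<inter> {p. n \<bullet> p > e}"
  have "\<not> interior W \<subseteq> {p. n \<bullet> p = e}"
    using W interior_hyperplane[OF n, of e] interior_maximal[OF _ open_interior]
    by (metis subset_empty)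
  then obtain p where p: "p \<in> interior W" "n \<bullet> p \<noteq> e" by auto
  then have "?L \<noteq> {} \<or> ?R \<noteq> {}" by (cases "n \<bullet> p < e") auto
  moreover have "interior (f ` W) \<noteq> {}" if "?L \<noteq> {}"
  proof -
    have "f ` ?L = g1 ` ?L" by (intro image_cong refl) (auto simp: g1)
    moreover have "open (g1 ` ?L)" by (intro g1 open_Int open_interior open_halfspace_lt)
    moreover have "f ` ?L \<subseteq> f ` W" using interior_subset by auto
    ultimately show ?thesis using that interior_maximal[of "f ` ?L" "f ` W"] by auto
  qed
  moreover have "interior (f ` W) \<noteq> {}" if "?R \<noteq> {}"
  proof -
    have "f ` ?R = g2 ` ?R" by (intro image_cong refl) (auto simp: g2)
    moreover have "open (g2 ` ?R)" by (intro g2 open_Int open_interior open_halfspace_gt)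
    moreover have "f ` ?R \<subseteq> f ` W" using interior_subset by auto
    ultimately show ?thesis using that interior_maximal[of "f ` ?R" "f ` W"] by auto
  qed
  ultimately show "interior (f ` W) \<noteq> {}" by blast
qed

lemma fat_images_open_map:
  assumes "\<And>U. open U \<Longrightarrow> open (g ` U)" shows "fat_images g"
  by (rule fat_images_piecewise[of "pt 1 0" g 0 g g]) (use assms in \<open>auto simp: zero_eq_pt\<close>)

lemma fat_images_fold_x: "fat_images (fold_x a)"
proof (rule fat_images_piecewise[of "pt 1 0" id a _ "\<lambda>p. pt (2 * a - p $ 1) (p $ 2)"])
  show "open ((\<lambda>p. pt (2 * a - p $ 1) (p $ 2)) ` U)" if "open U" for U :: "(real^2) set"
    by (rule open_image_inverse[OF _ _ _ that, of "\<lambda>p. pt (2 * a - p $ 1) (p $ 2)"])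
      (auto intro!: continuous_intros)
qed (auto simp: zero_eq_pt inner_pt fold_x_def)

lemma fat_images_fold_diag: "fat_images (fold_diag b)"
proof (rule fat_images_piecewise[of "pt 1 1" id b _ "\<lambda>p. pt (b - p $ 2) (b - p $ 1)"])
  show "open ((\<lambda>p. pt (b - p $ 2) (b - p $ 1)) ` U)" if "open U" for U :: "(real^2) set"
    by (rule open_image_inverse[OF _ _ _ that, of "\<lambda>p. pt (b - p $ 2) (b - p $ 1)"])
      (auto intro!: continuous_intros)
qed (auto simp: zero_eq_pt inner_pt fold_diag_def Let_def max_def pt_eq_iff)

lemma fat_images_Psi:
  assumes "s \<noteq> 0" shows "fat_images (Psi s b)"
proof -
  have "fat_images ((*\<^sub>R) s)"
    using open_scaling[OF assms] by (rule fat_images_open_map)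
  from fat_images_comp[OF this fat_images_comp[OF fat_images_fold_diag fat_images_fold_x]]
  show ?thesis unfolding Psi_def .
qed

definition tent_inv :: "real \<Rightarrow> real^2 \<Rightarrow> real^2" where
  "tent_inv t p = pt ((p $ 1 + p $ 2) / (2 * t)) ((p $ 1 - p $ 2) / (2 * t))"

lemma tent_inverse:
  assumes "t \<noteq> 0" shows "tent_inv t (tent_step t p) = p" "tent_step t (tent_inv t p) = p"
  using assms by (simp_all add: tent_inv_def tent_step_def pt_eq_iff field_simps)

lemma fat_images_tent:
  assumes "t \<noteq> 0" shows "fat_images (\<lambda>p. tent_step t (fold_x 1 p))"
proof (rule fat_images_comp[OF fat_images_open_map fat_images_fold_x])
  have "continuous_on UNIV (tent_inv t)"
    unfolding tent_inv_def using assms by (intro continuous_intros) auto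
  then show "open (tent_step t ` U)" if "open U" for U :: "(real^2) set"
    using tent_inverse[OF assms] that by (rule open_image_inverse)
qed

section \<open>Families of separated open sets\<close>

definition fat_self_map :: "(real^2 \<Rightarrow> real^2) \<Rightarrow> bool" where
  "fat_self_map f \<longleftrightarrow> f ` T \<subseteq> T \<and> (\<forall>W. W \<subseteq> T \<longrightarrow> interior W \<noteq> {} \<longrightarrow> interior (f ` W) \<noteq> {})"

lemma fat_self_map_iterate:
  assumes f: "fat_self_map f"
  shows "fat_self_map (f ^^ n)"
proof (induction n)
  case 0
  show ?case by (simp add: fat_self_map_def)
next
  case (Suc n)
  show ?case
    unfolding fat_self_map_def
  proof (intro conjI allI impI)
    show "(f ^^ Suc n) ` T \<subseteq> T"
      using Suc f by (simp add: fat_self_map_def image_subset_iff)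
    fix W assume W: "W \<subseteq> T" "interior W \<noteq> {}"
    then have "(f ^^ n) ` W \<subseteq> T" "interior ((f ^^ n) ` W) \<noteq> {}"
      using Suc by (auto simp: fat_self_map_def)
    then have "interior (f ` (f ^^ n) ` W) \<noteq> {}" using f by (simp add: fat_self_map_def)
    then show "interior ((f ^^ Suc n) ` W) \<noteq> {}" by (simp add: image_comp)
  qed
qed

text \<open>Orbits of disjoint cycles may still touch along boundaries, so overlaps without interior are
permitted.\<close>

definition separated :: "(real^2 \<Rightarrow> real^2) \<Rightarrow> (real^2) set \<Rightarrow> (real^2) set \<Rightarrow> bool" where
  "separated f U V \<longleftrightarrow> (\<forall>m n. interior ((f ^^ m) ` U \<inter> (f ^^ n) ` V) = {})"

lemma funpow_image_add: "(f ^^ m) ` (f ^^ n) ` X = (f ^^ (m + n)) ` X"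
  by (simp add: funpow_add image_comp)

text \<open>An overlap of iterates at arbitrary times is carried along until the time of the first set is a multiple
of the period.\<close>

lemma overlap_push_forward:
  assumes f: "fat_self_map f" and k: "1 \<le> k" and XY: "X \<subseteq> T" "Y \<subseteq> T"
    and ov: "interior ((f ^^ m) ` X \<inter> (f ^^ n) ` Y) \<noteq> {}"
  obtains m' n' j where "j < k"
    "interior ((f ^^ (k * m')) ` X \<inter> (f ^^ j) ` (f ^^ (k * n')) ` Y) \<noteq> {}"
proof -
  let ?r = "k * m - m" and ?W = "(f ^^ m) ` X \<inter> (f ^^ n) ` Y"
  have r: "?r + m = k * m" using k by simp
  let ?n' = "(?r + n) div k" and ?j = "(?r + n) mod k"
  have rn: "?r + n = ?j + k * ?n'" by simp
  have "?W \<subseteq> T" using fat_self_map_iterate[OF f, of m] XY by (auto simp: fat_self_map_def)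
  then have "interior ((f ^^ ?r) ` ?W) \<noteq> {}"
    using fat_self_map_iterate[OF f, of ?r] ov by (simp add: fat_self_map_def)
  moreover have "(f ^^ ?r) ` ?W \<subseteq> (f ^^ (k * m)) ` X \<inter> (f ^^ ?j) ` (f ^^ (k * ?n')) ` Y"
  proof -
    have "(f ^^ ?r) ` ?W \<subseteq> (f ^^ ?r) ` (f ^^ m) ` X \<inter> (f ^^ ?r) ` (f ^^ n) ` Y" by blast
    then show ?thesis unfolding funpow_image_add r rn[symmetric] .
  qed
  ultimately have "interior ((f ^^ (k * m)) ` X \<inter> (f ^^ ?j) ` (f ^^ (k * ?n')) ` Y) \<noteq> {}"
    using interior_mono by blast
  moreover have "?j < k" using k by simp
  ultimately show ?thesis using that by blast
qed

lemma small_copy_subset: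
  assumes "small_copy f g k h" shows "1 \<le> k" "X \<subseteq> T \<Longrightarrow> h ` X \<subseteq> T"
  using assms by (auto simp: small_copy_def dest!: psubset_imp_subset)

lemma small_copy_iterate:
  assumes sc: "small_copy f g k h" and g: "g ` T \<subseteq> T" and p: "p \<in> T"
  shows "(g ^^ m) p \<in> T \<and> (f ^^ (k * m)) (h p) = h ((g ^^ m) p)"
proof (induction m)
  case 0
  show ?case using p by simp
next
  case (Suc m)
  have "(f ^^ (k * Suc m)) (h p) = (f ^^ k) ((f ^^ (k * m)) (h p))"
    by (simp add: funpow_add)
  then show ?case using Suc sc g by (auto simp: small_copy_def)
qed

lemma small_copy_iterate_image:
  assumes "small_copy f g k h" "g ` T \<subseteq> T" "X \<subseteq> T"
  shows "(f ^^ (k * m)) ` h ` X = h ` (g ^^ m) ` X" "(f ^^ (k * m)) ` h ` X \<subseteq> h ` T"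
proof -
  show e: "(f ^^ (k * m)) ` h ` X = h ` (g ^^ m) ` X"
    unfolding image_image using small_copy_iterate[OF assms(1,2)] assms(3)
    by (intro image_cong refl) blast
  show "(f ^^ (k * m)) ` h ` X \<subseteq> h ` T"
    unfolding e using small_copy_iterate[OF assms(1,2)] assms(3) by blast
qed

lemma separated_apart:
  assumes f: "fat_self_map f"
    and sc: "small_copy f g k h" "g ` T \<subseteq> T" "small_copy f g' k h'" "g' ` T \<subseteq> T"
    and apart: "\<And>j. j < k \<Longrightarrow> interior (h ` T) \<inter> interior ((f ^^ j) ` h' ` T) = {}"
    and UV: "U \<subseteq> T" "V \<subseteq> T"
  shows "separated f (h ` U) (h' ` V)"
proof (rule ccontr)
  assume "\<not> separated f (h ` U) (h' ` V)"
  then obtain m n where "interior ((f ^^ m) ` h ` U \<inter> (f ^^ n) ` h' ` V) \<noteq> {}"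
    by (auto simp: separated_def)
  moreover have "1 \<le> k" "h ` U \<subseteq> T" "h' ` V \<subseteq> T"
    using small_copy_subset[OF sc(1)] small_copy_subset[OF sc(3)] UV by simp_all
  ultimately obtain m' n' j where j: "j < k"
    and ov: "interior ((f ^^ (k * m')) ` h ` U \<inter> (f ^^ j) ` (f ^^ (k * n')) ` h' ` V) \<noteq> {}"
    using overlap_push_forward[OF f] by metis
  have "(f ^^ (k * m')) ` h ` U \<inter> (f ^^ j) ` (f ^^ (k * n')) ` h' ` V \<subseteq> h ` T \<inter> (f ^^ j) ` h' ` T"
    using small_copy_iterate_image(2)[OF sc(1,2) UV(1)] small_copy_iterate_image(2)[OF sc(3,4) UV(2)]
    by blast
  then have "interior (h ` T \<inter> (f ^^ j) ` h' ` T) \<noteq> {}" using ov interior_mono by blast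
  then show False using apart[OF j] by simp
qed

text \<open>After an overlap has been pushed forward, either both times are multiples of the period, and the
overlap takes place for the renormalized map, or the second set is in a position of the cycle
that has no interior point in common with the first position.\<close>

lemma separated_copy:
  assumes f: "fat_self_map f" and sc: "small_copy f g k h" and g: "g ` T \<subseteq> T"
    and h: "inj h" "continuous_on UNIV h"
    and UV: "U \<subseteq> T" "V \<subseteq> T" and sep: "separated g U V"
  shows "separated f (h ` U) (h ` V)"
proof (rule ccontr)
  assume "\<not> separated f (h ` U) (h ` V)"
  then obtain m n where "interior ((f ^^ m) ` h ` U \<inter> (f ^^ n) ` h ` V) \<noteq> {}"
    by (auto simp: separated_def)
  moreover have "1 \<le> k" "h ` U \<subseteq> T" "h ` V \<subseteq> T"
    using small_copy_subset[OF sc] UV by simp_all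
  ultimately obtain m' n' j where j: "j < k"
    and ov: "interior ((f ^^ (k * m')) ` h ` U \<inter> (f ^^ j) ` (f ^^ (k * n')) ` h ` V) \<noteq> {}"
    using overlap_push_forward[OF f] by metis
  note it = small_copy_iterate_image[OF sc g]
  show False
  proof (cases "j = 0")
    case True
    let ?X = "(g ^^ m') ` U \<inter> (g ^^ n') ` V"
    have "interior (h ` ?X) \<noteq> {}"
      using ov it(1)[OF UV(1)] it(1)[OF UV(2)] True by (simp add: image_Int[OF h(1)])
    then obtain y where y: "y \<in> interior (h ` ?X)" by blast
    then obtain x where x: "x \<in> ?X" "y = h x" using interior_subset by blast
    have "open (h -` interior (h ` ?X))"
      by (rule open_vimage[OF open_interior h(2)])
    moreover have "h -` interior (h ` ?X) \<subseteq> ?X"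
      using interior_subset[of "h ` ?X"] inj_image_mem_iff[OF h(1), of _ ?X] by blast
    ultimately have "x \<in> interior ?X" using x y interior_maximal by blast
    then show False using sep by (auto simp: separated_def)
  next
    case False
    have "(f ^^ (k * m')) ` h ` U \<inter> (f ^^ j) ` (f ^^ (k * n')) ` h ` V \<subseteq> h ` T \<inter> (f ^^ j) ` h ` T"
      using it(2)[OF UV(1)] it(2)[OF UV(2)] by blast
    then have "interior (h ` T \<inter> (f ^^ j) ` h ` T) \<noteq> {}" using ov interior_mono by blast
    moreover have "interior ((f ^^ j) ` h ` T) \<inter> interior (h ` T) = {}"
      using sc False j by (simp add: small_copy_def)
    ultimately show False by (simp add: Int_commute)
  qed
qed

definition has_separated_family :: "nat \<Rightarrow> (real^2 \<Rightarrow> real^2) \<Rightarrow> bool" where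
  "has_separated_family n f \<longleftrightarrow> (\<exists>\<U>. card \<U> = 2 ^ n \<and>
     (\<forall>U\<in>\<U>. open U \<and> U \<noteq> {} \<and> U \<subseteq> T) \<and>
     (\<forall>U\<in>\<U>. \<forall>V\<in>\<U>. U \<noteq> V \<longrightarrow> separated f U V))"

lemma has_separated_family_0: "has_separated_family 0 f"
  unfolding has_separated_family_def
  by (rule exI[of _ "{interior T}"]) (use interior_T_nonempty interior_subset in auto)

lemma place_maps:
  assumes "r \<noteq> 0" "\<sigma> * \<sigma> = 1"
  shows "inj (place q r \<sigma>)" "continuous_on UNIV (place q r \<sigma>)" "open U \<Longrightarrow> open (place q r \<sigma> ` U)"
proof -
  define h' where "h' p = pt (- (p $ 1 - q $ 1) / r) (\<sigma> * (p $ 2 - q $ 2) / r)" for p :: "real^2"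
  have ss: "\<sigma> * (\<sigma> * x) = x" for x using assms(2) by (simp flip: mult.assoc)
  have inv: "h' (place q r \<sigma> p) = p" "place q r \<sigma> (h' p) = p" for p
    using assms by (simp_all add: h'_def place_def pt_eq_iff field_simps ss)
  show "inj (place q r \<sigma>)" using inv(1) by (rule inj_on_inverseI)
  show "continuous_on UNIV (place q r \<sigma>)" unfolding place_def by (intro continuous_intros)
  have "continuous_on UNIV h'" unfolding h'_def using assms by (intro continuous_intros) auto
  then show "open (place q r \<sigma> ` U)" if "open U"
    using inv that by (rule open_image_inverse)
qed

lemma separated_commute: "separated f U V \<Longrightarrow> separated f V U"
  by (auto simp: separated_def Int_commute)

text \<open>A separated family is stated through its witness, because the two copies of \<open>Psi\<close> require
the union of two such families.\<close>

lemma has_separated_family_copy: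
  assumes f: "fat_self_map f" and sc: "small_copy f g k (place q r \<sigma>)" and g: "g ` T \<subseteq> T"
    and r: "r \<noteq> 0" "\<sigma> * \<sigma> = 1"
    and \<U>: "card \<U> = 2 ^ n" "\<forall>U\<in>\<U>. open U \<and> U \<noteq> {} \<and> U \<subseteq> T"
      "\<forall>U\<in>\<U>. \<forall>V\<in>\<U>. U \<noteq> V \<longrightarrow> separated g U V"
  shows "card ((`) (place q r \<sigma>) ` \<U>) = 2 ^ n"
    "\<forall>U\<in>(`) (place q r \<sigma>) ` \<U>. open U \<and> U \<noteq> {} \<and> U \<subseteq> T"
    "\<forall>U\<in>(`) (place q r \<sigma>) ` \<U>. \<forall>V\<in>(`) (place q r \<sigma>) ` \<U>. U \<noteq> V \<longrightarrow> separated f U V"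
proof -
  note h = place_maps[OF r, where q = q]
  show "card ((`) (place q r \<sigma>) ` \<U>) = 2 ^ n"
    using \<U>(1) by (subst card_image) (auto intro!: inj_onI simp: inj_image_eq_iff[OF h(1)])
  show "\<forall>U\<in>(`) (place q r \<sigma>) ` \<U>. open U \<and> U \<noteq> {} \<and> U \<subseteq> T"
  proof
    fix U assume "U \<in> (`) (place q r \<sigma>) ` \<U>"
    then obtain V where "V \<in> \<U>" "U = place q r \<sigma> ` V" by blast
    then show "open U \<and> U \<noteq> {} \<and> U \<subseteq> T"
      using \<U>(2) h(3)[of V] small_copy_subset(2)[OF sc, of V] by simp
  qed
  show "\<forall>U\<in>(`) (place q r \<sigma>) ` \<U>. \<forall>V\<in>(`) (place q r \<sigma>) ` \<U>. U \<noteq> V \<longrightarrow> separated f U V"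
  proof (intro ballI impI)
    fix U V assume "U \<in> (`) (place q r \<sigma>) ` \<U>" "V \<in> (`) (place q r \<sigma>) ` \<U>" "U \<noteq> V"
    then obtain U' V' where UV: "U' \<in> \<U>" "V' \<in> \<U>" "U' \<noteq> V'"
        "U = place q r \<sigma> ` U'" "V = place q r \<sigma> ` V'"
      by auto
    have "U' \<subseteq> T" "V' \<subseteq> T" "separated g U' V'" using \<U>(2,3) UV(1-3) by simp_all
    then show "separated f U V"
      unfolding UV(4,5) by (rule separated_copy[OF f sc g h(1,2)])
  qed
qed

lemma has_separated_family_Psi_Suc:
  assumes g: "admissible s b"
    and A: "has_separated_family n (Psi (s ^ 4) (ratio s b / s\<^sup>2))"
      "Psi (s ^ 4) (ratio s b / s\<^sup>2) ` T \<subseteq> T"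
    and B: "has_separated_family n (Psi (s ^ 4) (ratio s b / s))"
      "Psi (s ^ 4) (ratio s b / s) ` T \<subseteq> T"
  shows "has_separated_family (Suc n) (Psi s b)"
proof -
  have f: "fat_self_map (Psi s b)"
    using fat_images_Psi[of s b] g Psi_T[of s b]
    by (auto simp: fat_self_map_def fat_images_def admissible_def)
  let ?h = "place (centre s b) (scale s b) 1" and ?h' = "place (centre s b) (scale s b) (-1)"
  note sc = Psi_small_copy_plus[OF g] and sc' = Psi_small_copy_minus[OF g]
  have r: "scale s b \<noteq> 0" using scale_pos[OF g] by simp
  obtain \<U> where \<U>: "card \<U> = 2 ^ n" "\<forall>U\<in>\<U>. open U \<and> U \<noteq> {} \<and> U \<subseteq> T"
      "\<forall>U\<in>\<U>. \<forall>V\<in>\<U>. U \<noteq> V \<longrightarrow> separated (Psi (s ^ 4) (ratio s b / s\<^sup>2)) U V"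
    using A(1) unfolding has_separated_family_def by blast
  obtain \<V> where \<V>: "card \<V> = 2 ^ n" "\<forall>U\<in>\<V>. open U \<and> U \<noteq> {} \<and> U \<subseteq> T"
      "\<forall>U\<in>\<V>. \<forall>V\<in>\<V>. U \<noteq> V \<longrightarrow> separated (Psi (s ^ 4) (ratio s b / s)) U V"
    using B(1) unfolding has_separated_family_def by blast
  have "(1::real) * 1 = 1" "(-1::real) * (-1) = 1" by simp_all
  note U = has_separated_family_copy[OF f sc A(2) r this(1) \<U>]
    and V = has_separated_family_copy[OF f sc' B(2) r this(2) \<V>]
  let ?U = "(`) ?h ` \<U>" and ?V = "(`) ?h' ` \<V>"
  have ap: "separated (Psi s b) X Y" if XY: "X \<in> ?U" "Y \<in> ?V" for X Y
  proof -
    obtain X' Y' where "X' \<in> \<U>" "X = ?h ` X'" "Y' \<in> \<V>" "Y = ?h' ` Y'"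
      using XY by blast
    then show ?thesis
      using separated_apart[OF f sc A(2) sc' B(2) Psi_copies_apart[OF g], of X' Y'] \<U>(2) \<V>(2)
      by simp
  qed
  have dj: "?U \<inter> ?V = {}"
  proof (rule ccontr)
    assume "?U \<inter> ?V \<noteq> {}"
    then obtain X where X: "X \<in> ?U" "X \<in> ?V" by blast
    have "interior ((Psi s b ^^ 0) ` X \<inter> (Psi s b ^^ 0) ` X) = {}"
      by (rule ap[OF X, unfolded separated_def, rule_format])
    moreover have "open X" "X \<noteq> {}" using U(2)[rule_format, OF X(1)] by simp_all
    ultimately show False by (simp add: interior_open)
  qed
  have "finite ?U" "finite ?V"
    using card_ge_0_finite[of ?U] card_ge_0_finite[of ?V] unfolding U(1) V(1) by simp_all
  then have "card (?U \<union> ?V) = card ?U + card ?V" using dj by (rule card_Un_disjoint)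
  then have "card (?U \<union> ?V) = 2 ^ Suc n" unfolding U(1) V(1) by simp
  moreover have "\<forall>X\<in>?U \<union> ?V. open X \<and> X \<noteq> {} \<and> X \<subseteq> T"
    using U(2) V(2) by (simp only: ball_Un)
  moreover have "\<forall>X\<in>?U \<union> ?V. \<forall>Y\<in>?U \<union> ?V. X \<noteq> Y \<longrightarrow> separated (Psi s b) X Y"
  proof (intro ballI impI)
    fix X Y assume "X \<in> ?U \<union> ?V" "Y \<in> ?U \<union> ?V" "X \<noteq> Y"
    then consider "X \<in> ?U" "Y \<in> ?U" | "X \<in> ?V" "Y \<in> ?V" | "X \<in> ?U" "Y \<in> ?V"
      | "Y \<in> ?U" "X \<in> ?V" by (simp only: Un_iff) metis
    then show "separated (Psi s b) X Y"
    proof cases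
      case 1 then show ?thesis by (rule U(3)[rule_format, OF _ _ \<open>X \<noteq> Y\<close>])
    next
      case 2 then show ?thesis by (rule V(3)[rule_format, OF _ _ \<open>X \<noteq> Y\<close>])
    next
      case 3 then show ?thesis by (rule ap)
    next
      case 4 then show ?thesis by (rule separated_commute[OF ap])
    qed
  qed
  ultimately show ?thesis unfolding has_separated_family_def by (intro exI conjI)
qed

lemma eventually_separated_Psi:
  "\<forall>\<^sub>F p in nhds limit_params. 1 < fst p \<longrightarrow>
     Psi (fst p) (snd p) ` T \<subseteq> T \<and> has_separated_family n (Psi (fst p) (snd p))"
proof (rule near_limit_induct)
  have T: "Psi s b ` T \<subseteq> T" if "admissible s b" for s b
    using that Psi_T[of s b] by (auto simp: admissible_def)
  show "Psi s b ` T \<subseteq> T \<and> has_separated_family 0 (Psi s b)" if "admissible s b" for s b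
    using T[OF that] has_separated_family_0 by blast
  show "Psi s b ` T \<subseteq> T \<and> has_separated_family (Suc n) (Psi s b)"
    if "admissible s b"
      "Psi (s ^ 4) (ratio s b / s\<^sup>2) ` T \<subseteq> T \<and> has_separated_family n (Psi (s ^ 4) (ratio s b / s\<^sup>2))"
      "Psi (s ^ 4) (ratio s b / s) ` T \<subseteq> T \<and> has_separated_family n (Psi (s ^ 4) (ratio s b / s))"
    for n s b
    using T[OF that(1)] has_separated_family_Psi_Suc[OF that(1)] that(2,3) by simp
qed

lemma fat_self_map_Lambda:
  assumes t: "1 / sqrt 2 < t" "t \<le> 1"
  shows "fat_self_map (Lambda t)"
  unfolding fat_self_map_def
proof (intro conjI allI impI)
  show "Lambda t ` T \<subseteq> T" using Lambda_T[OF t] by blast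
  fix W assume W: "W \<subseteq> T" "interior W \<noteq> {}"
  have "Lambda t ` W = (\<lambda>p. tent_step t (fold_x 1 p)) ` W"
    using W(1) by (intro image_cong refl Lambda_eq) blast
  then show "interior (Lambda t ` W) \<noteq> {}"
    using fat_imagesD[OF fat_images_tent W(2), of t] half_less_square(1)[OF t(1)] by simp
qed

lemma eventually_separated_Lambda:
  "\<forall>\<^sub>F t in at_right (1 / sqrt 2). has_separated_family n (Lambda t)"
  using eventually_admissible_time eventually_hub_params[OF eventually_separated_Psi[of n]]
proof eventually_elim
  case (elim t)
  then have t: "1 / sqrt 2 < t" "t \<le> 1" by (auto simp: admissible_time_def)
  have r: "hub_scale t \<noteq> 0" using hub_scale_pos[OF t(1)] by simp
  obtain \<U> where \<U>: "card \<U> = 2 ^ n" "\<forall>U\<in>\<U>. open U \<and> U \<noteq> {} \<and> U \<subseteq> T"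
      "\<forall>U\<in>\<U>. \<forall>V\<in>\<U>. U \<noteq> V \<longrightarrow> separated (Psi (16 * t ^ 8) (1 / (3 * t ^ 5))) U V"
    using elim(2) unfolding has_separated_family_def by blast
  show ?case
    using has_separated_family_copy[OF fat_self_map_Lambda[OF t] Lambda_small_copy[OF elim(1)] _ r _ \<U>]
      elim(2)
    unfolding has_separated_family_def by (intro exI[of _ "(`) (place (hub t) (hub_scale t) 1) ` \<U>"]) simp
qed

section \<open>Growth of discs\<close>

lemma ball_image_similarity:
  fixes g :: "'a :: metric_space \<Rightarrow> 'a"
  assumes l: "0 < l" and d: "\<And>p q. dist (g p) (g q) = l * dist p q" and s: "\<And>p. g (g' p) = p"
  shows "g ` ball z \<rho> = ball (g z) (l * \<rho>)"
proof
  show "g ` ball z \<rho> \<subseteq> ball (g z) (l * \<rho>)" using l by (auto simp: d)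
  show "ball (g z) (l * \<rho>) \<subseteq> g ` ball z \<rho>"
  proof
    fix p assume "p \<in> ball (g z) (l * \<rho>)"
    then have "l * dist z (g' p) < l * \<rho>" using d[of z "g' p"] by (simp add: s)
    then have "g' p \<in> ball z \<rho>" using l by simp
    then show "p \<in> g ` ball z \<rho>" using s[of p] by (metis image_eqI)
  qed
qed

definition mirror_x :: "real^2 \<Rightarrow> real^2" where
  "mirror_x p = pt (2 - p $ 1) (p $ 2)"

lemma dist_pt_square: "(dist p q)\<^sup>2 = (p $ 1 - q $ 1)\<^sup>2 + (p $ 2 - q $ (2::2))\<^sup>2" for p q :: "real^2"
  unfolding dist_norm norm_pt_square by simp

lemma dist_tent_step:
  assumes "0 < t"
  shows "dist (tent_step t p) (tent_step t q) = (t * sqrt 2) * dist p q"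
proof -
  have "(dist (tent_step t p) (tent_step t q))\<^sup>2 = ((t * sqrt 2) * dist p q)\<^sup>2"
    unfolding power_mult_distrib dist_pt_square
    by (simp add: tent_step_def power2_eq_square algebra_simps)
  then show ?thesis using assms by simp
qed

lemma dist_mirror_x: "dist (mirror_x p) (mirror_x q) = dist p q"
proof -
  have "(dist (mirror_x p) (mirror_x q))\<^sup>2 = (dist p q)\<^sup>2"
    unfolding dist_pt_square by (simp add: mirror_x_def power2_eq_square algebra_simps)
  then show ?thesis by simp
qed

lemma mirror_x_mirror_x: "mirror_x (mirror_x p) = p"
  by (simp add: mirror_x_def pt_eq_iff)

lemma Lambda_branches:
  assumes "p \<in> T"
  shows "p $ 1 \<le> 1 \<Longrightarrow> Lambda t p = tent_step t p"
    "1 \<le> p $ 1 \<Longrightarrow> Lambda t p = tent_step t (mirror_x p)"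
  unfolding Lambda_eq[OF assms] by (auto simp: fold_x_def mirror_x_def min_def)

lemma Lambda_ball:
  assumes t: "0 < t" and T: "ball z \<rho> \<subseteq> T" and \<rho>: "0 < \<rho>" and av: "\<forall>p\<in>ball z \<rho>. p $ 1 \<noteq> 1"
  shows "Lambda t ` ball z \<rho> = ball (Lambda t z) ((t * sqrt 2) * \<rho>)"
proof -
  have z: "z \<in> ball z \<rho>" using \<rho> by simp
  have lam: "0 < t * sqrt 2" using t by simp
  have "(\<forall>p\<in>ball z \<rho>. p $ 1 \<le> 1) \<or> (\<forall>p\<in>ball z \<rho>. 1 \<le> p $ 1)"
  proof (rule ccontr)
    assume "\<not> ?thesis"
    then obtain p q where pq: "p \<in> ball z \<rho>" "1 \<le> p $ 1" "q \<in> ball z \<rho>" "q $ 1 \<le> 1"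
      by (meson linear)
    then have "\<exists>x\<in>ball z \<rho>. x $ 1 = 1"
      by (intro connected_ivt_component_cart[of _ q p]) (auto simp: convex_connected)
    then show False using av by blast
  qed
  then show ?thesis
  proof
    assume "\<forall>p\<in>ball z \<rho>. p $ 1 \<le> 1"
    then have L: "Lambda t p = tent_step t p" if "p \<in> ball z \<rho>" for p
      using that T Lambda_branches(1)[of p t] by blast
    then have "Lambda t ` ball z \<rho> = tent_step t ` ball z \<rho>" by (rule image_cong[OF refl])
    then show ?thesis
      using ball_image_similarity[OF lam dist_tent_step[OF t], of "tent_inv t" z \<rho>]
        tent_inverse(2)[of t] t L[OF z] by simp
  next
    assume "\<forall>p\<in>ball z \<rho>. 1 \<le> p $ 1"
    then have L: "Lambda t p = tent_step t (mirror_x p)" if "p \<in> ball z \<rho>" for p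
      using that T Lambda_branches(2)[of p t] by blast
    then have "Lambda t ` ball z \<rho> = (\<lambda>p. tent_step t (mirror_x p)) ` ball z \<rho>"
      by (rule image_cong[OF refl])
    then show ?thesis
      using ball_image_similarity[of "t * sqrt 2" "\<lambda>p. tent_step t (mirror_x p)"
          "\<lambda>p. mirror_x (tent_inv t p)" z \<rho>]
        lam dist_tent_step[OF t] dist_mirror_x mirror_x_mirror_x
        tent_inverse(2)[of t] t L[OF z] by simp
  qed
qed

text \<open>The four linear functionals correspond to the four directions of lines that are permuted by the
linear parts of both branches.\<close>

definition avoids :: "real set \<Rightarrow> (real^2) set \<Rightarrow> bool" where
  "avoids C B \<longleftrightarrow> (\<forall>p\<in>B. p $ 1 \<notin> C \<and> p $ 2 \<notin> C \<and> p $ 1 + p $ 2 \<notin> C \<and> p $ 1 - p $ 2 \<notin> C)"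

text \<open>Pulling a line back through a branch changes its functional among the four and its level \<open>c\<close> into
one of the four values listed. It is harmless to attach every level to every functional.\<close>

fun critical_levels :: "real \<Rightarrow> nat \<Rightarrow> real set" where
  "critical_levels t 0 = {}"
| "critical_levels t (Suc n) = insert 1 (\<Union>c\<in>critical_levels t n.
     {c / t, c / (2 * t), 2 - c / t, 2 - c / (2 * t)})"

lemma finite_critical_levels: "finite (critical_levels t n)"
  by (induction n) auto

lemma avoids_image:
  assumes t: "0 < t" and B: "B \<subseteq> T" and av: "avoids (critical_levels t (Suc n)) B"
  shows "avoids (critical_levels t n) (Lambda t ` B)"
  unfolding avoids_def
proof
  fix q assume "q \<in> Lambda t ` B"
  then obtain p where p: "p \<in> B" "q = Lambda t p" by blast
  have pT: "p \<in> T" using p B by blast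
  define x where "x = fold_x 1 p $ 1"
  have x: "x = p $ 1 \<or> x = 2 - p $ 1" by (auto simp: x_def fold_x_def min_def)
  have q: "q $ 1 = t * (x + p $ 2)" "q $ 2 = t * (x - p $ 2)"
    "q $ 1 + q $ 2 = 2 * t * x" "q $ 1 - q $ 2 = 2 * t * p $ 2"
    unfolding p(2) Lambda_eq[OF pT] tent_step_def x_def
    by (simp_all add: fold_x_def algebra_simps)
  have *: "p $ 1 \<noteq> d \<and> p $ 2 \<noteq> d \<and> p $ 1 + p $ 2 \<noteq> d \<and> p $ 1 - p $ 2 \<noteq> d"
    if "c \<in> critical_levels t n" "d \<in> {c / t, c / (2 * t), 2 - c / t, 2 - c / (2 * t)}" for c d
  proof -
    have "d \<in> critical_levels t (Suc n)" using that by auto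
    then show ?thesis using av p(1) unfolding avoids_def by blast
  qed
  have "q $ 1 \<noteq> c \<and> q $ 2 \<noteq> c \<and> q $ 1 + q $ 2 \<noteq> c \<and> q $ 1 - q $ 2 \<noteq> c"
    if c: "c \<in> critical_levels t n" for c
  proof -
    have eq: "t * u = c \<longleftrightarrow> u = c / t" "2 * t * u = c \<longleftrightarrow> u = c / (2 * t)" for u
      using t by (auto simp: field_simps)
    define \<alpha> \<beta> where \<alpha>_\<beta>_def: "\<alpha> = c / t" "\<beta> = c / (2 * t)"
    have "x + p $ 2 \<noteq> \<alpha> \<and> x - p $ 2 \<noteq> \<alpha> \<and> x \<noteq> \<beta> \<and> p $ 2 \<noteq> \<beta>"
      using x *[OF c, of \<alpha>] *[OF c, of \<beta>] *[OF c, of "2 - \<alpha>"] *[OF c, of "2 - \<beta>"]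
      unfolding \<alpha>_\<beta>_def by (simp only: insert_iff) argo
    then show ?thesis unfolding q(3,4) unfolding q(1,2) eq \<alpha>_\<beta>_def .
  qed
  then show "q $ 1 \<notin> critical_levels t n \<and> q $ 2 \<notin> critical_levels t n \<and>
      q $ 1 + q $ 2 \<notin> critical_levels t n \<and> q $ 1 - q $ 2 \<notin> critical_levels t n"
    by metis
qed

text \<open>A disc that avoids the critical lines is never folded, so it is mapped by a composition of
similarities.\<close>

lemma Lambda_iterate_ball:
  assumes t: "1 / sqrt 2 < t" "t \<le> 1"
  shows "ball z \<rho> \<subseteq> T \<Longrightarrow> 0 < \<rho> \<Longrightarrow> avoids (critical_levels t n) (ball z \<rho>) \<Longrightarrow>
    (Lambda t ^^ n) ` ball z \<rho> = ball ((Lambda t ^^ n) z) ((t * sqrt 2) ^ n * \<rho>)"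
proof (induction n arbitrary: z \<rho>)
  case (Suc n)
  have t0: "0 < t" using half_less_square[OF t(1)] by simp
  have "\<forall>p\<in>ball z \<rho>. p $ 1 \<noteq> 1" using Suc.prems(3) by (auto simp: avoids_def)
  then have 1: "Lambda t ` ball z \<rho> = ball (Lambda t z) ((t * sqrt 2) * \<rho>)"
    using Suc.prems t0 by (intro Lambda_ball)
  have "ball (Lambda t z) ((t * sqrt 2) * \<rho>) \<subseteq> T"
    unfolding 1[symmetric] using Suc.prems(1) Lambda_T[OF t] by blast
  moreover have "avoids (critical_levels t n) (ball (Lambda t z) ((t * sqrt 2) * \<rho>))"
    unfolding 1[symmetric] using t0 Suc.prems by (intro avoids_image)
  ultimately have "(Lambda t ^^ n) ` ball (Lambda t z) ((t * sqrt 2) * \<rho>)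
      = ball ((Lambda t ^^ n) (Lambda t z)) ((t * sqrt 2) ^ n * ((t * sqrt 2) * \<rho>))"
    using t0 Suc.prems(2) by (intro Suc.IH) auto
  then show ?case
    unfolding funpow_Suc_right image_comp[symmetric] 1 by (simp add: mult_ac)
qed simp

lemma half_ball_off_line:
  fixes n z :: "'a :: real_inner"
  assumes n: "n \<noteq> 0" and \<rho>: "0 < \<rho>"
  obtains z' where "ball z' (\<rho> / 2) \<subseteq> ball z \<rho>" "\<And>p. p \<in> ball z' (\<rho> / 2) \<Longrightarrow> n \<bullet> p \<noteq> e"
proof -
  define s where "s = (if n \<bullet> z \<ge> e then 1 else - 1 :: real)"
  \<comment> \<open>move the centre by half the radius away from the line\<close>
  define z' where "z' = z + (s * \<rho> / 2 / norm n) *\<^sub>R n"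
  have nn: "0 < norm n" using n by simp
  have d: "dist z z' = \<rho> / 2"
    using nn \<rho> by (simp add: z'_def dist_norm s_def)
  have "ball z' (\<rho> / 2) \<subseteq> ball z \<rho>"
  proof
    fix p assume "p \<in> ball z' (\<rho> / 2)"
    then show "p \<in> ball z \<rho>" using d dist_triangle[of z p z'] by simp
  qed
  moreover have "n \<bullet> p \<noteq> e" if "p \<in> ball z' (\<rho> / 2)" for p
  proof -
    have "\<bar>n \<bullet> (p - z')\<bar> \<le> norm n * norm (p - z')" by (rule Cauchy_Schwarz_ineq2)
    also have "\<dots> < norm n * (\<rho> / 2)"
      using that nn by (intro mult_strict_left_mono) (auto simp: dist_norm norm_minus_commute)
    finally have *: "\<bar>n \<bullet> (p - z')\<bar> < norm n * (\<rho> / 2)" .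
    have "n \<bullet> z' = n \<bullet> z + s * (norm n * (\<rho> / 2))"
      using nn by (simp add: z'_def inner_add_right dot_square_norm power2_eq_square)
    then have "n \<bullet> p = n \<bullet> z + s * (norm n * (\<rho> / 2)) + n \<bullet> (p - z')"
      by (simp add: inner_diff_right)
    then show ?thesis using * by (auto simp: s_def abs_less_iff split: if_splits)
  qed
  ultimately show ?thesis using that by blast
qed

text \<open>The levels in \<open>C\<close> are so far apart that the functional takes at most one of them on the ball, and a
ball of half the radius fits on one side of the corresponding hyperplane.\<close>

lemma half_ball_off_levels:
  fixes n z :: "'a :: real_inner"
  assumes n: "n \<noteq> 0" "norm n \<le> 2" and \<rho>: "0 < \<rho>"
    and gap: "\<And>c c'. c \<in> C \<Longrightarrow> c' \<in> C \<Longrightarrow> c \<noteq> c' \<Longrightarrow> 4 * \<rho> \<le> \<bar>c - c'\<bar>"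
  obtains z' where "ball z' (\<rho> / 2) \<subseteq> ball z \<rho>" "\<And>p. p \<in> ball z' (\<rho> / 2) \<Longrightarrow> n \<bullet> p \<notin> C"
proof (cases "\<exists>p\<in>ball z \<rho>. n \<bullet> p \<in> C")
  case False
  have "ball z (\<rho> / 2) \<subseteq> ball z \<rho>" using \<rho> by auto
  then show ?thesis using False that by blast
next
  case True
  then obtain p where p: "p \<in> ball z \<rho>" "n \<bullet> p \<in> C" by blast
  obtain z' where z': "ball z' (\<rho> / 2) \<subseteq> ball z \<rho>"
      "\<And>q. q \<in> ball z' (\<rho> / 2) \<Longrightarrow> n \<bullet> q \<noteq> n \<bullet> p"
    using half_ball_off_line[OF n(1) \<rho>] by blast
  have "n \<bullet> q \<notin> C" if q: "q \<in> ball z' (\<rho> / 2)" for q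
  proof
    assume "n \<bullet> q \<in> C"
    then have "4 * \<rho> \<le> \<bar>n \<bullet> q - n \<bullet> p\<bar>" using z'(2)[OF q] p(2) by (intro gap)
    also have "\<dots> \<le> norm n * norm (q - p)"
      unfolding inner_diff_right[symmetric] by (rule Cauchy_Schwarz_ineq2)
    also have "\<dots> \<le> 2 * norm (q - p)" using n(2) by (intro mult_right_mono) auto
    also have "norm (q - p) < 2 * \<rho>"
    proof -
      have "dist z q < \<rho>" "dist z p < \<rho>" using q z'(1) p by auto
      then show ?thesis using dist_triangle3[of q p z] by (simp add: dist_norm)
    qed
    finally show False by simp
  qed
  then show ?thesis using z'(1) that by blast
qed

lemma finite_gap:
  fixes C :: "real set"
  assumes "finite C"
  obtains \<delta> where "0 < \<delta>" "\<And>c c'. c \<in> C \<Longrightarrow> c' \<in> C \<Longrightarrow> c \<noteq> c' \<Longrightarrow> \<delta> \<le> \<bar>c - c'\<bar>"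
proof -
  let ?D = "insert 1 ((\<lambda>(c, c'). \<bar>c - c'\<bar>) ` {(c, c'). c \<in> C \<and> c' \<in> C \<and> c \<noteq> c'})"
  have "finite {(c, c'). c \<in> C \<and> c' \<in> C \<and> c \<noteq> c'}"
    by (rule finite_subset[OF _ finite_cartesian_product[OF assms assms]]) auto
  then have fin: "finite ?D" by simp
  have "0 < Min ?D" using fin by (subst Min_gr_iff) auto
  moreover have "Min ?D \<le> \<bar>c - c'\<bar>" if "c \<in> C" "c' \<in> C" "c \<noteq> c'" for c c'
    using that fin by (intro Min_le) auto
  ultimately show ?thesis using that by blast
qed

lemma sub_ball_avoids:
  fixes z :: "real^2"
  assumes \<rho>: "0 < \<rho>"
    and gap: "\<And>c c'. c \<in> C \<Longrightarrow> c' \<in> C \<Longrightarrow> c \<noteq> c' \<Longrightarrow> 4 * \<rho> \<le> \<bar>c - c'\<bar>"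
  obtains z' where "ball z' (\<rho> / 16) \<subseteq> ball z \<rho>" "avoids C (ball z' (\<rho> / 16))"
proof -
  have gap': "4 * \<rho>' \<le> \<bar>c - c'\<bar>" if "\<rho>' \<le> \<rho>" "c \<in> C" "c' \<in> C" "c \<noteq> c'" for \<rho>' c c'
    using gap[OF that(2-4)] that(1) by linarith
  have nrm: "norm (pt x y) \<le> 2" if "\<bar>x\<bar> \<le> 1" "\<bar>y\<bar> \<le> 1" for x y
    using norm_le_l1_cart[of "pt x y"] that by (simp add: sum_2)
  obtain z1 where z1: "ball z1 (\<rho> / 2) \<subseteq> ball z \<rho>" "\<And>p. p \<in> ball z1 (\<rho> / 2) \<Longrightarrow> pt 1 0 \<bullet> p \<notin> C"
    using half_ball_off_levels[of "pt 1 0" \<rho> C] gap'[of \<rho>] nrm \<rho> by (auto simp: zero_eq_pt)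
  obtain z2 where z2: "ball z2 (\<rho> / 4) \<subseteq> ball z1 (\<rho> / 2)" "\<And>p. p \<in> ball z2 (\<rho> / 4) \<Longrightarrow> pt 0 1 \<bullet> p \<notin> C"
    using half_ball_off_levels[of "pt 0 1" "\<rho> / 2" C z1] gap'[of "\<rho> / 2"] nrm \<rho> by (auto simp: zero_eq_pt)
  obtain z3 where z3: "ball z3 (\<rho> / 8) \<subseteq> ball z2 (\<rho> / 4)" "\<And>p. p \<in> ball z3 (\<rho> / 8) \<Longrightarrow> pt 1 1 \<bullet> p \<notin> C"
    using half_ball_off_levels[of "pt 1 1" "\<rho> / 4" C z2] gap'[of "\<rho> / 4"] nrm \<rho> by (auto simp: zero_eq_pt)
  obtain z4 where z4: "ball z4 (\<rho> / 16) \<subseteq> ball z3 (\<rho> / 8)"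
      "\<And>p. p \<in> ball z4 (\<rho> / 16) \<Longrightarrow> pt 1 (-1) \<bullet> p \<notin> C"
    using half_ball_off_levels[of "pt 1 (-1)" "\<rho> / 8" C z3] gap'[of "\<rho> / 8"] nrm \<rho> by (auto simp: zero_eq_pt)
  have "avoids C (ball z4 (\<rho> / 16))"
    unfolding avoids_def
  proof
    fix p assume p4: "p \<in> ball z4 (\<rho> / 16)"
    then have p3: "p \<in> ball z3 (\<rho> / 8)" using z4(1) by blast
    then have p2: "p \<in> ball z2 (\<rho> / 4)" using z3(1) by blast
    then have p1: "p \<in> ball z1 (\<rho> / 2)" using z2(1) by blast
    show "p $ 1 \<notin> C \<and> p $ 2 \<notin> C \<and> p $ 1 + p $ 2 \<notin> C \<and> p $ 1 - p $ 2 \<notin> C"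
      using z1(2)[OF p1] z2(2)[OF p2] z3(2)[OF p3] z4(2)[OF p4] by (simp add: inner_pt)
  qed
  moreover have "ball z4 (\<rho> / 16) \<subseteq> ball z \<rho>" using z1(1) z2(1) z3(1) z4(1) by blast
  ultimately show ?thesis using that by blast
qed

text \<open>Avoiding one line in each of the four directions costs a factor 16 in the radius; the exponent
\<open>N\<close> is chosen so that the expansion makes up for twice that factor.\<close>

lemma Lambda_doubles_small_balls:
  assumes t: "1 / sqrt 2 < t" "t \<le> 1"
  obtains N r where "0 < r" "\<And>z \<rho>. ball z \<rho> \<subseteq> T \<Longrightarrow> 0 < \<rho> \<Longrightarrow> \<rho> \<le> r \<Longrightarrow>
     \<exists>z'. ball z' (2 * \<rho>) \<subseteq> (Lambda t ^^ N) ` ball z \<rho>"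
proof -
  have "1 < t * sqrt 2" using t(1) by (simp add: field_simps)
  then obtain N where N: "32 < (t * sqrt 2) ^ N" using real_arch_pow by blast
  obtain \<delta> where \<delta>: "0 < \<delta>" "\<And>c c'. c \<in> critical_levels t N \<Longrightarrow> c' \<in> critical_levels t N \<Longrightarrow>
      c \<noteq> c' \<Longrightarrow> \<delta> \<le> \<bar>c - c'\<bar>"
    using finite_gap[OF finite_critical_levels] by blast
  have "\<exists>z'. ball z' (2 * \<rho>) \<subseteq> (Lambda t ^^ N) ` ball z \<rho>"
    if T: "ball z \<rho> \<subseteq> T" and \<rho>: "0 < \<rho>" "\<rho> \<le> \<delta> / 4" for z \<rho>
  proof -
    have "4 * \<rho> \<le> \<bar>c - c'\<bar>"
      if "c \<in> critical_levels t N" "c' \<in> critical_levels t N" "c \<noteq> c'" for c c'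
      using \<delta>(2)[OF that] \<rho>(2) by linarith
    then obtain z' where z': "ball z' (\<rho> / 16) \<subseteq> ball z \<rho>"
        "avoids (critical_levels t N) (ball z' (\<rho> / 16))"
      using sub_ball_avoids[OF \<rho>(1), of "critical_levels t N" z] by blast
    have "(Lambda t ^^ N) ` ball z' (\<rho> / 16) = ball ((Lambda t ^^ N) z') ((t * sqrt 2) ^ N * (\<rho> / 16))"
      using z' T \<rho>(1) by (intro Lambda_iterate_ball[OF t]) auto
    moreover have "2 * \<rho> \<le> (t * sqrt 2) ^ N * (\<rho> / 16)"
    proof -
      have "32 * (\<rho> / 16) \<le> (t * sqrt 2) ^ N * (\<rho> / 16)"
        using N \<rho>(1) by (intro mult_right_mono) auto
      then show ?thesis by simp
    qed
    ultimately have "ball ((Lambda t ^^ N) z') (2 * \<rho>) \<subseteq> (Lambda t ^^ N) ` ball z' (\<rho> / 16)"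
      by (simp add: subset_ball)
    then show ?thesis using z'(1) by (meson image_mono order_trans)
  qed
  moreover have "0 < \<delta> / 4" using \<delta>(1) by simp
  ultimately show ?thesis using that by blast
qed

lemma Lambda_expands_to_scale:
  assumes t: "1 / sqrt 2 < t" "t \<le> 1"
  obtains r where "0 < r" "\<And>W. open W \<Longrightarrow> W \<noteq> {} \<Longrightarrow> W \<subseteq> T \<Longrightarrow> \<exists>n z. ball z r \<subseteq> (Lambda t ^^ n) ` W"
proof -
  obtain N r where r: "0 < r" and dbl: "\<And>z \<rho>. ball z \<rho> \<subseteq> T \<Longrightarrow> 0 < \<rho> \<Longrightarrow> \<rho> \<le> r \<Longrightarrow>
     \<exists>z'. ball z' (2 * \<rho>) \<subseteq> (Lambda t ^^ N) ` ball z \<rho>"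
    by (rule Lambda_doubles_small_balls[OF t]) (rule that)
  have it: "(Lambda t ^^ n) ` X \<subseteq> T" if "X \<subseteq> T" for n X
    using order_trans[OF image_mono[OF that], of "Lambda t ^^ n" T]
      fat_self_map_iterate[OF fat_self_map_Lambda[OF t], of n]
    by (simp add: fat_self_map_def)
  have grow: "\<exists>n z'. ball z' r \<subseteq> (Lambda t ^^ n) ` ball z \<rho>"
    if "ball z \<rho> \<subseteq> T" "0 < \<rho>" "r \<le> \<rho> * 2 ^ k" for k z \<rho>
    using that
  proof (induction k arbitrary: z \<rho>)
    case 0
    then have "ball z r \<subseteq> (Lambda t ^^ 0) ` ball z \<rho>" by (simp add: subset_ball)
    then show ?case by (intro exI)
  next
    case (Suc k)
    show ?case
    proof (cases "\<rho> \<le> r")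
      case False
      then have "ball z r \<subseteq> (Lambda t ^^ 0) ` ball z \<rho>" by (simp add: subset_ball)
      then show ?thesis by (intro exI)
    next
      case True
      obtain z1 where z1: "ball z1 (2 * \<rho>) \<subseteq> (Lambda t ^^ N) ` ball z \<rho>"
        using dbl[OF Suc.prems(1,2) True] by (elim exE)
      then have T1: "ball z1 (2 * \<rho>) \<subseteq> T" using it[OF Suc.prems(1), of N] by (rule order_trans)
      then obtain n z' where "ball z' r \<subseteq> (Lambda t ^^ n) ` ball z1 (2 * \<rho>)"
      proof -
        have "0 < 2 * \<rho>" "r \<le> 2 * \<rho> * 2 ^ k" using Suc.prems(2,3) by (simp_all add: mult_ac)
        from Suc.IH[OF T1 this] show thesis by (elim exE) (rule that)
      qed
      also have "\<dots> \<subseteq> (Lambda t ^^ n) ` (Lambda t ^^ N) ` ball z \<rho>" using z1 by (rule image_mono)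
      finally show ?thesis unfolding funpow_image_add by (intro exI)
    qed
  qed
  have "\<exists>n z. ball z r \<subseteq> (Lambda t ^^ n) ` W" if W: "open W" "W \<noteq> {}" "W \<subseteq> T" for W
  proof -
    obtain z \<rho> where z: "0 < \<rho>" "ball z \<rho> \<subseteq> W"
    proof -
      obtain x where "x \<in> W" using W(2) by blast
      from openE[OF W(1) this] show thesis by (metis that)
    qed
    obtain k where "r / \<rho> < 2 ^ k" using real_arch_pow[of 2 "r / \<rho>"] by auto
    then have "r \<le> \<rho> * 2 ^ k" using z(1) by (simp add: field_simps)
    from grow[OF order_trans[OF z(2) W(3)] z(1) this]
    obtain n z' where "ball z' r \<subseteq> (Lambda t ^^ n) ` ball z \<rho>" by (elim exE)
    also have "\<dots> \<subseteq> (Lambda t ^^ n) ` W" using z(2) by (rule image_mono)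
    finally show ?thesis by (intro exI)
  qed
  then show ?thesis by (rule that[OF r])
qed

section \<open>Attractors of expanding maps\<close>

text \<open>A continuous map under which every open set grows to a definite scale, while images of open sets
always have interior; this is all that the construction of attractors uses.\<close>

locale expanding_map =
  fixes M :: "'a :: euclidean_space set" and f :: "'a \<Rightarrow> 'a" and r :: real
  assumes compact_M: "compact M" and cont: "continuous_on M f" and maps: "f ` M \<subseteq> M"
    and fat: "\<And>W. open W \<Longrightarrow> W \<noteq> {} \<Longrightarrow> W \<subseteq> M \<Longrightarrow> interior (f ` W) \<noteq> {}"
    and r_pos: "0 < r"
    and expands: "\<And>W. open W \<Longrightarrow> W \<noteq> {} \<Longrightarrow> W \<subseteq> M \<Longrightarrow> \<exists>n z. ball z r \<subseteq> (f ^^ n) ` W"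
begin

lemma iterate_maps: "X \<subseteq> M \<Longrightarrow> (f ^^ n) ` X \<subseteq> M"
proof (induction n)
  case (Suc n)
  have "(f ^^ Suc n) ` X = f ` (f ^^ n) ` X" by (simp add: image_comp)
  also have "\<dots> \<subseteq> f ` M" using Suc by (intro image_mono) simp
  finally show ?case using maps by (rule order_trans)
qed simp

lemma iterate_cont: "continuous_on M (f ^^ n)"
proof (induction n)
  case (Suc n)
  have "continuous_on ((f ^^ n) ` M) f"
    using cont iterate_maps[OF order_refl] by (rule continuous_on_subset)
  then show ?case using continuous_on_compose[OF Suc] by simp
qed (simp add: id_def)

lemma open_iterate_preimage:
  assumes "open W" "W \<subseteq> M" "open V"
  shows "open (W \<inter> (f ^^ n) -` V)"
  using continuous_on_subset[OF iterate_cont assms(2)] assms(1,3) by (rule continuous_open_preimage)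

lemma fat_iterate:
  assumes "open W" "W \<noteq> {}" "W \<subseteq> M"
  shows "interior ((f ^^ n) ` W) \<noteq> {}"
proof (induction n)
  case 0
  show ?case using assms by (simp add: interior_open)
next
  case (Suc n)
  let ?V = "interior ((f ^^ n) ` W)"
  have "?V \<subseteq> M" using interior_subset iterate_maps[OF assms(3)] by (rule order_trans)
  then have "interior (f ` ?V) \<noteq> {}" using Suc by (intro fat) auto
  moreover have "f ` ?V \<subseteq> (f ^^ Suc n) ` W"
    using image_mono[OF interior_subset[of "(f ^^ n) ` W"], of f] by (simp add: image_comp)
  ultimately show ?case using interior_mono by blast
qed

definition recurrent :: "'a set \<Rightarrow> bool" where
  "recurrent B \<longleftrightarrow> open B \<and> B \<noteq> {} \<and> B \<subseteq> M \<and>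
     (\<forall>W. open W \<and> W \<noteq> {} \<and> (\<exists>n. W \<subseteq> (f ^^ n) ` B) \<longrightarrow> (\<exists>k\<ge>1. B \<subseteq> (f ^^ k) ` W))"

lemma recurrentI:
  assumes B: "open B" "B \<noteq> {}" "B \<subseteq> M"
    and ret: "\<And>W n. open W \<Longrightarrow> W \<noteq> {} \<Longrightarrow> W \<subseteq> (f ^^ n) ` B \<Longrightarrow> \<exists>k. B \<subseteq> (f ^^ k) ` W"
  shows "recurrent B"
  unfolding recurrent_def
proof (intro conjI B allI impI, elim conjE exE)
  fix W n assume W: "open W" "W \<noteq> {}" "W \<subseteq> (f ^^ n) ` B"
  have WM: "W \<subseteq> M" using W(3) iterate_maps[OF B(3)] by (rule order_trans)
  let ?V = "interior (f ` W)"
  have "f ` W \<subseteq> (f ^^ Suc n) ` B" using image_mono[OF W(3), of f] by (simp add: image_comp)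
  then have "?V \<subseteq> (f ^^ Suc n) ` B" using interior_subset by (rule order_trans[rotated])
  from ret[OF open_interior fat[OF W(1,2) WM] this]
  obtain k where "B \<subseteq> (f ^^ k) ` ?V" by (elim exE)
  also have "\<dots> \<subseteq> (f ^^ k) ` (f ^^ 1) ` W"
    using image_mono[OF interior_subset[of "f ` W"], of "f ^^ k"] by simp
  finally have "B \<subseteq> (f ^^ (k + 1)) ` W" unfolding funpow_image_add .
  then show "\<exists>k\<ge>1. B \<subseteq> (f ^^ k) ` W" by (intro exI[of _ "k + 1"]) simp
qed

text \<open>Fix a finite set of discs such that every disc of radius \<open>r\<close> in \<open>M\<close> contains one of them. Reachability
is a transitive relation on this finite set in which every disc inside \<open>M\<close> has a successor. Among the
discs reachable from \<open>U\<close>, one from which the fewest discs are reachable leads into a class of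
mutually reachable discs.\<close>

lemma recurrent_ball_exists:
  assumes U: "open U" "U \<noteq> {}" "U \<subseteq> M"
  obtains B m where "recurrent B" "B \<subseteq> (f ^^ m) ` U"
proof -
  have "M \<subseteq> (\<Union>z\<in>M. ball z (r / 2))" using r_pos by auto
  then obtain Z where Z: "Z \<subseteq> M" "finite Z" "M \<subseteq> (\<Union>z\<in>Z. ball z (r / 2))"
    using compactE_image[OF compact_M, of M "\<lambda>z. ball z (r / 2)"] by auto
  define cell where "cell z = ball z (r / 2)" for z :: 'a
  define targets where "targets X = {z \<in> Z. \<exists>n. cell z \<subseteq> (f ^^ n) ` X}" for X
  have cell: "open (cell z)" "cell z \<noteq> {}" for z using r_pos by (auto simp: cell_def)
  have targetsD: "\<exists>n. cell z \<subseteq> (f ^^ n) ` X" if "z \<in> targets X" for z X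
    using that by (simp add: targets_def)
  have cell_M: "cell z \<subseteq> M" if z: "z \<in> targets X" and X: "X \<subseteq> M" for z X
  proof -
    from targetsD[OF z] obtain n where "cell z \<subseteq> (f ^^ n) ` X" by (elim exE)
    then show ?thesis using iterate_maps[OF X] by (rule order_trans)
  qed
  have nonempty: "targets W \<noteq> {}" if W: "open W" "W \<noteq> {}" "W \<subseteq> M" for W
  proof -
    from expands[OF W] obtain n z' where z': "ball z' r \<subseteq> (f ^^ n) ` W" by (elim exE)
    have "z' \<in> ball z' r" using r_pos by simp
    then have "z' \<in> M" using z' iterate_maps[OF W(3), of n] by (meson subsetD)
    then obtain z where z: "z \<in> Z" "z' \<in> ball z (r / 2)" using Z(3) by (meson UN_E subsetD)
    have "cell z \<subseteq> ball z' r"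
    proof
      fix p assume "p \<in> cell z"
      then show "p \<in> ball z' r"
        using z(2) dist_triangle3[of z' p z] by (simp add: cell_def dist_commute)
    qed
    then have "cell z \<subseteq> (f ^^ n) ` W" using z' by (rule order_trans)
    then have "z \<in> targets W" using z(1) unfolding targets_def by (intro CollectI conjI exI)
    then show ?thesis by (rule ex_in_conv[THEN iffD1, OF exI])
  qed
  have mono: "targets X \<subseteq> targets Y" if X: "X \<subseteq> (f ^^ n) ` Y" for X Y n
  proof
    fix z assume "z \<in> targets X"
    then obtain k where k: "z \<in> Z" "cell z \<subseteq> (f ^^ k) ` X" by (auto simp: targets_def)
    note k(2)
    also have "(f ^^ k) ` X \<subseteq> (f ^^ k) ` (f ^^ n) ` Y" using X by (rule image_mono)
    finally have "cell z \<subseteq> (f ^^ (k + n)) ` Y" unfolding funpow_image_add .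
    then show "z \<in> targets Y" using k(1) unfolding targets_def by (intro CollectI conjI exI)
  qed
  have mono': "targets (cell z) \<subseteq> targets X" if z: "z \<in> targets X" for z X
  proof -
    from targetsD[OF z] obtain n where "cell z \<subseteq> (f ^^ n) ` X" by (elim exE)
    then show ?thesis by (rule mono)
  qed
  have fin: "finite (targets X)" for X using Z(2) by (simp add: targets_def)
  obtain u where u: "u \<in> targets U" using nonempty[OF U] by blast
  obtain z0 where z0: "z0 \<in> targets U"
    and min: "\<And>z. z \<in> targets U \<Longrightarrow> card (targets (cell z0)) \<le> card (targets (cell z))"
    using ex_has_least_nat[of "\<lambda>z. z \<in> targets U" u "\<lambda>z. card (targets (cell z))"] u by auto
  \<comment> \<open>minimality forces the descending sets of targets to stabilize\<close>
  have eq: "targets (cell z) = targets (cell z0)" if z: "z \<in> targets (cell z0)" for z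
  proof (rule card_seteq[OF fin mono'[OF z]])
    have "z \<in> targets U" using z mono'[OF z0] by (rule rev_subsetD)
    then show "card (targets (cell z0)) \<le> card (targets (cell z))" by (rule min)
  qed
  obtain z1 where z1: "z1 \<in> targets (cell z0)"
    using nonempty[OF cell cell_M[OF z0 U(3)]] by blast
  have z1U: "z1 \<in> targets U" using z1 mono'[OF z0] by (rule rev_subsetD)
  have "recurrent (cell z1)"
  proof (rule recurrentI[OF cell cell_M[OF z1U U(3)]])
    fix W n assume W: "open W" "W \<noteq> {}" "W \<subseteq> (f ^^ n) ` cell z1"
    have WM: "W \<subseteq> M" using W(3) iterate_maps[OF cell_M[OF z1U U(3)]] by (rule order_trans)
    obtain z2 where z2: "z2 \<in> targets W" using nonempty[OF W(1,2) WM] by blast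
    have "z2 \<in> targets (cell z1)" using z2 mono[OF W(3)] by (rule rev_subsetD)
    then have "targets (cell z2) = targets (cell z0)" using eq[OF z1] eq by simp
    then have "z1 \<in> targets (cell z2)" using z1 by simp
    then have "z1 \<in> targets W" using mono'[OF z2] by (rule rev_subsetD)
    then show "\<exists>k. cell z1 \<subseteq> (f ^^ k) ` W" by (rule targetsD)
  qed
  moreover from targetsD[OF z1U] obtain m where "cell z1 \<subseteq> (f ^^ m) ` U" by (elim exE)
  ultimately show ?thesis by (rule that)
qed

definition orbit_closure :: "'a set \<Rightarrow> 'a set" where
  "orbit_closure B = closure (\<Union>n. (f ^^ n) ` B)"

context
  fixes B
  assumes rec: "recurrent B"
begin

lemma recurrent_facts: "open B" "B \<noteq> {}" "B \<subseteq> M"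
  using rec by (simp_all add: recurrent_def)

lemma returns:
  assumes "open W" "W \<noteq> {}" "W \<subseteq> (f ^^ n) ` B"
  obtains k where "1 \<le> k" "B \<subseteq> (f ^^ k) ` W"
  using rec assms that unfolding recurrent_def by metis

lemma late_return:
  assumes W: "open W" "W \<noteq> {}" "W \<subseteq> B"
  obtains k where "j \<le> k" "B \<subseteq> (f ^^ k) ` W"
proof -
  have "\<exists>k\<ge>j. B \<subseteq> (f ^^ k) ` W"
  proof (induction j)
    case 0
    have "W \<subseteq> (f ^^ 0) ` B" using W(3) by simp
    from returns[OF W(1,2) this] obtain k where "B \<subseteq> (f ^^ k) ` W" by metis
    then show ?case by (intro exI[of _ k]) simp
  next
    case (Suc j)
    then obtain k where k: "j \<le> k" "B \<subseteq> (f ^^ k) ` W" by (elim exE conjE)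
    have "B \<subseteq> (f ^^ 0) ` B" by simp
    from returns[OF recurrent_facts(1,2) this] obtain m where m: "1 \<le> m" "B \<subseteq> (f ^^ m) ` B" by metis
    note m(2)
    also have "(f ^^ m) ` B \<subseteq> (f ^^ m) ` (f ^^ k) ` W" using k(2) by (rule image_mono)
    finally have "B \<subseteq> (f ^^ (m + k)) ` W" unfolding funpow_image_add .
    then show ?case using k m by (intro exI[of _ "m + k"]) simp
  qed
  then show ?thesis using that by (elim exE conjE)
qed

lemma orbit_M: "(\<Union>n. (f ^^ n) ` B) \<subseteq> M"
  using iterate_maps[OF recurrent_facts(3)] by (rule UN_least)

lemma orbit_closure_M: "orbit_closure B \<subseteq> M"
  unfolding orbit_closure_def using orbit_M compact_imp_closed[OF compact_M] by (rule closure_minimal)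

lemma iterate_subset_orbit_closure: "(f ^^ n) ` B \<subseteq> orbit_closure B"
  unfolding orbit_closure_def using closure_subset by (rule order_trans[rotated]) (rule UN_upper[OF UNIV_I])

lemma B_subset: "B \<subseteq> orbit_closure B"
  using iterate_subset_orbit_closure[of 0] by simp

lemma compact_orbit_closure: "compact (orbit_closure B)"
proof -
  have "orbit_closure B = M \<inter> orbit_closure B" using orbit_closure_M by (rule Int_absorb1[symmetric])
  moreover have "compact (M \<inter> orbit_closure B)"
    using compact_M by (rule compact_Int_closed) (simp add: orbit_closure_def)
  ultimately show ?thesis by simp
qed

lemma image_orbit_closure: "f ` orbit_closure B = orbit_closure B"
proof
  let ?O = "\<Union>n. (f ^^ n) ` B"
  have fO: "f ` ?O = ?O"
  proof
    show "f ` ?O \<subseteq> ?O"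
    proof (intro subsetI, elim imageE UN_E)
      fix p q n x assume "p = f q" "q = (f ^^ n) x" "x \<in> B"
      then show "p \<in> ?O" by (intro UN_I[of "Suc n"] image_eqI[of _ _ x]) simp_all
    qed
    show "?O \<subseteq> f ` ?O"
    proof
      fix p assume "p \<in> ?O"
      then obtain n x where x: "p = (f ^^ n) x" "x \<in> B" by (elim UN_E imageE)
      obtain k where k: "1 \<le> k" "B \<subseteq> (f ^^ k) ` B" using late_return[OF recurrent_facts(1,2) order_refl] .
      obtain y where y: "y \<in> B" "x = (f ^^ k) y" using x(2) k(2) by (meson imageE subsetD)
      have "p = (f ^^ (n + k)) y" unfolding x(1) y(2) by (simp add: funpow_add)
      also have "n + k = Suc (n + (k - 1))" using k(1) by simp
      finally have "p = f ((f ^^ (n + (k - 1))) y)" by simp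
      moreover have "(f ^^ (n + (k - 1))) y \<in> ?O" using y(1) by (intro UN_I[of "n + (k - 1)"] imageI UNIV_I)
      ultimately show "p \<in> f ` ?O" by (rule image_eqI)
    qed
  qed
  have cont': "continuous_on (orbit_closure B) f" using cont orbit_closure_M by (rule continuous_on_subset)
  show "f ` orbit_closure B \<subseteq> orbit_closure B"
    unfolding orbit_closure_def
    by (rule image_closure_subset[OF cont'[unfolded orbit_closure_def] closed_closure])
      (use fO closure_subset in simp)
  have "closed (f ` orbit_closure B)"
    using compact_continuous_image[OF cont' compact_orbit_closure] by (rule compact_imp_closed)
  moreover have "?O \<subseteq> f ` orbit_closure B"
    using image_mono[OF closure_subset[of ?O], of f] unfolding fO orbit_closure_def .
  ultimately show "orbit_closure B \<subseteq> f ` orbit_closure B"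
    by (subst orbit_closure_def) (rule closure_minimal)
qed

lemma meets_orbit:
  assumes "open V" "V \<inter> orbit_closure B \<noteq> {}"
  obtains n x where "x \<in> B" "(f ^^ n) x \<in> V"
proof -
  have "V \<inter> (\<Union>n. (f ^^ n) ` B) \<noteq> {}"
    using assms unfolding orbit_closure_def by (simp add: open_Int_closure_eq_empty)
  then obtain p where p: "p \<in> V" "p \<in> (\<Union>n. (f ^^ n) ` B)" by blast
  from p(2) obtain n x where "p = (f ^^ n) x" "x \<in> B" by (elim UN_E imageE)
  then show ?thesis using that p(1) by simp
qed

text \<open>A small open set first spreads over \<open>B\<close> and then follows \<open>B\<close> to any given place of the closure.\<close>

lemma visits:
  assumes W: "open W" "W \<noteq> {}" "W \<subseteq> B" and V: "open V" "V \<inter> orbit_closure B \<noteq> {}"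
  obtains n w where "j \<le> n" "w \<in> W" "(f ^^ n) w \<in> V"
proof -
  obtain i x where x: "x \<in> B" "(f ^^ i) x \<in> V" using meets_orbit[OF V] .
  obtain k where k: "j \<le> k" "B \<subseteq> (f ^^ k) ` W" using late_return[OF W] .
  obtain w where w: "w \<in> W" "x = (f ^^ k) w" using x(1) k(2) by (meson imageE subsetD)
  have "(f ^^ (i + k)) w \<in> V" using x(2) unfolding w(2) by (simp add: funpow_add)
  then show ?thesis using that[of "i + k" w] k(1) w(1) by simp
qed

lemma transitive_orbit_closure: "transitive_on f (orbit_closure B)"
  unfolding transitive_on_def
proof (intro allI impI, elim conjE)
  fix U V assume UV: "open U" "open V" "U \<inter> orbit_closure B \<noteq> {}" "V \<inter> orbit_closure B \<noteq> {}"
  obtain n x where x: "x \<in> B" "(f ^^ n) x \<in> U" using meets_orbit[OF UV(1,3)] .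
  let ?W = "B \<inter> (f ^^ n) -` U"
  have "open ?W" "?W \<noteq> {}" "?W \<subseteq> B"
    using open_iterate_preimage[OF recurrent_facts(1,3) UV(1)] x by auto
  from visits[OF this UV(2,4), of "Suc n"] obtain m w
    where w: "Suc n \<le> m" "w \<in> ?W" "(f ^^ m) w \<in> V" .
  have "m = (m - n) + n" using w(1) by simp
  then have "(f ^^ (m - n)) ((f ^^ n) w) \<in> V" using w(3) by (metis comp_apply funpow_add)
  moreover have "(f ^^ n) w \<in> U \<inter> orbit_closure B"
    using w(2) iterate_subset_orbit_closure[of n] by auto
  ultimately have "(f ^^ (m - n)) ` (U \<inter> orbit_closure B) \<inter> V \<noteq> {}" by blast
  then show "\<exists>n\<ge>1. (f ^^ n) ` (U \<inter> orbit_closure B) \<inter> V \<noteq> {}"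
    using w(1) by (intro exI[of _ "m - n"]) simp
qed

lemma attractor_orbit_closure: "attractor M f (orbit_closure B)"
proof -
  have "B \<subseteq> stable_set M f (orbit_closure B)"
  proof
    fix z assume z: "z \<in> B"
    have "(f ^^ n) z \<in> orbit_closure B" for n
      using z iterate_subset_orbit_closure[of n] by auto
    then show "z \<in> stable_set M f (orbit_closure B)"
      using z recurrent_facts(3) by (auto simp: stable_set_def)
  qed
  moreover have "openin (top_of_set M) B" using recurrent_facts(1,3) by (simp add: open_openin_trans open_subset)
  ultimately have "B \<subseteq> top_of_set M interior_of (stable_set M f (orbit_closure B))"
    by (rule interior_of_maximal)
  then show ?thesis
    unfolding attractor_def
    using recurrent_facts(2) B_subset orbit_closure_M compact_orbit_closure image_orbit_closure
      transitive_orbit_closure by auto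
qed

text \<open>Baire's theorem in a closed ball inside \<open>B\<close>: points whose orbit hits a given basic open set are open
and dense by recurrence, and so are points that avoid \<open>S\<close> at a given time, because images of open
sets have interior.\<close>

lemma dense_orbit_avoiding:
  assumes S: "closed S" "interior S = {}"
  obtains z where "z \<in> B" "orbit_closure B \<subseteq> closure (range (\<lambda>n. (f ^^ n) z))"
    "\<And>n. (f ^^ n) z \<notin> S"
proof -
  obtain x \<epsilon> where x: "0 < \<epsilon>" "cball x \<epsilon> \<subseteq> B"
    using recurrent_facts(1,2) by (metis ex_in_conv open_contains_cball)
  obtain \<V> :: "'a set set" where \<V>: "countable \<V>" "\<And>V. V \<in> \<V> \<Longrightarrow> open V"
      "\<And>U. open U \<Longrightarrow> \<exists>\<V>'\<subseteq>\<V>. U = \<Union>\<V>'"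
    using univ_second_countable by (metis (full_types))
  \<comment> \<open>\<open>hit\<close> and \<open>miss\<close> are the open dense sets to which Baire's theorem is applied\<close>
  define hit where "hit V = (\<Union>n. B \<inter> (f ^^ n) -` V)" for V
  define miss where "miss n = B \<inter> (f ^^ n) -` (- S)" for n
  define \<G> where "\<G> = (\<lambda>V. cball x \<epsilon> \<inter> hit V) ` {V \<in> \<V>. V \<inter> orbit_closure B \<noteq> {}}
      \<union> range (\<lambda>n. cball x \<epsilon> \<inter> miss n)"
  have dense: "openin (top_of_set (cball x \<epsilon>)) (cball x \<epsilon> \<inter> H) \<and> cball x \<epsilon> \<subseteq> closure (cball x \<epsilon> \<inter> H)"
    if H: "open H" and meets: "\<And>W. open W \<Longrightarrow> W \<noteq> {} \<Longrightarrow> W \<subseteq> B \<Longrightarrow> W \<inter> H \<noteq> {}" for H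
  proof
    show "openin (top_of_set (cball x \<epsilon>)) (cball x \<epsilon> \<inter> H)" using H by (rule openin_open_Int)
    have "ball x \<epsilon> \<subseteq> closure (cball x \<epsilon> \<inter> H)"
    proof
      fix y assume y: "y \<in> ball x \<epsilon>"
      show "y \<in> closure (cball x \<epsilon> \<inter> H)"
        unfolding closure_iff_nhds_not_empty
      proof (intro allI impI)
        fix A U assume A: "U \<subseteq> A" "open U" "y \<in> U"
        have "open (U \<inter> ball x \<epsilon>)" "U \<inter> ball x \<epsilon> \<noteq> {}" using A y by auto
        moreover have "U \<inter> ball x \<epsilon> \<subseteq> B" using x(2) ball_subset_cball[of x \<epsilon>] by (meson Int_lower2 order_trans)
        ultimately have "(U \<inter> ball x \<epsilon>) \<inter> H \<noteq> {}" by (rule meets)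
        then show "(cball x \<epsilon> \<inter> H) \<inter> A \<noteq> {}" using A(1) ball_subset_cball[of x \<epsilon>] by blast
      qed
    qed
    then have "closure (ball x \<epsilon>) \<subseteq> closure (cball x \<epsilon> \<inter> H)" by (rule closure_minimal) simp
    then show "cball x \<epsilon> \<subseteq> closure (cball x \<epsilon> \<inter> H)" using x(1) by simp
  qed
  have "cball x \<epsilon> \<subseteq> closure (\<Inter>\<G>)"
  proof (rule Baire)
    show "closed (cball x \<epsilon>)" by simp
    show "countable \<G>" unfolding \<G>_def using \<V>(1) by auto
    fix G assume "G \<in> \<G>"
    then consider V where "V \<in> \<V>" "V \<inter> orbit_closure B \<noteq> {}" "G = cball x \<epsilon> \<inter> hit V"
      | n where "G = cball x \<epsilon> \<inter> miss n" unfolding \<G>_def by auto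
    then show "openin (top_of_set (cball x \<epsilon>)) G \<and> cball x \<epsilon> \<subseteq> closure G"
    proof cases
      case 1
      show ?thesis unfolding 1(3)
      proof (rule dense)
        show "open (hit V)"
          unfolding hit_def using open_iterate_preimage[OF recurrent_facts(1,3) \<V>(2)[OF 1(1)]] by (intro open_UN) simp
        fix W assume W: "open W" "W \<noteq> {}" "W \<subseteq> B"
        obtain n w where "w \<in> W" "(f ^^ n) w \<in> V"
          using visits[OF W \<V>(2)[OF 1(1)] 1(2), of 0] by metis
        then show "W \<inter> hit V \<noteq> {}" using W(3) by (auto simp: hit_def)
      qed
    next
      case 2
      show ?thesis unfolding 2
      proof (rule dense)
        show "open (miss n)"
          unfolding miss_def using S(1) by (intro open_iterate_preimage[OF recurrent_facts(1,3)] open_Compl)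
        fix W assume W: "open W" "W \<noteq> {}" "W \<subseteq> B"
        have WM: "W \<subseteq> M" using W(3) recurrent_facts(3) by (rule order_trans)
        have "\<not> (f ^^ n) ` W \<subseteq> S"
          using fat_iterate[OF W(1,2) WM, of n] S(2) interior_mono by blast
        then obtain w where "w \<in> W" "(f ^^ n) w \<notin> S" by auto
        then show "W \<inter> miss n \<noteq> {}" using W(3) by (auto simp: miss_def)
      qed
    qed
  qed
  moreover have "x \<in> cball x \<epsilon>" using x(1) by simp
  ultimately have "\<Inter>\<G> \<noteq> {}" by force
  then obtain z where z: "\<And>G. G \<in> \<G> \<Longrightarrow> z \<in> G" by blast
  have zmiss: "z \<in> cball x \<epsilon> \<inter> miss n" for n by (rule z) (simp add: \<G>_def)
  have zhit: "\<exists>n. (f ^^ n) z \<in> V" if "V \<in> \<V>" "V \<inter> orbit_closure B \<noteq> {}" for V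
  proof -
    have "z \<in> cball x \<epsilon> \<inter> hit V" by (rule z) (use that in \<open>auto simp: \<G>_def\<close>)
    then show ?thesis by (auto simp: hit_def)
  qed
  have dense_orbit: "orbit_closure B \<subseteq> closure (range (\<lambda>n. (f ^^ n) z))"
  proof
    fix y assume y: "y \<in> orbit_closure B"
    show "y \<in> closure (range (\<lambda>n. (f ^^ n) z))"
      unfolding closure_iff_nhds_not_empty
    proof (intro allI impI)
      fix A U assume A: "U \<subseteq> A" "open U" "y \<in> U"
      obtain \<V>' where "\<V>' \<subseteq> \<V>" "U = \<Union>\<V>'" using \<V>(3)[OF A(2)] by metis
      then obtain V where V: "V \<in> \<V>" "y \<in> V" "V \<subseteq> U" using A(3) by auto
      have "V \<inter> orbit_closure B \<noteq> {}" using V(2) y by auto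
      then obtain n where "(f ^^ n) z \<in> V" using zhit[OF V(1)] by metis
      then have "(f ^^ n) z \<in> range (\<lambda>n. (f ^^ n) z) \<inter> A" using V(3) A(1) by auto
      then show "range (\<lambda>n. (f ^^ n) z) \<inter> A \<noteq> {}" by (metis empty_iff)
    qed
  qed
  have "z \<in> B" "(f ^^ n) z \<notin> S" for n using zmiss[of n] by (simp_all add: miss_def)
  then show ?thesis by (rule that[OF _ dense_orbit])
qed

end

text \<open>The open set \<open>B\<close> is part of the closure of the orbit of \<open>B'\<close>, so it meets this orbit itself, and it does
so in a set with interior.\<close>

lemma orbit_closures_overlap:
  assumes B: "recurrent B" and B': "recurrent B'" and eq: "orbit_closure B = orbit_closure B'"
  obtains n where "interior (B \<inter> (f ^^ n) ` B') \<noteq> {}"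
proof -
  have o: "open B" "B \<inter> orbit_closure B' \<noteq> {}"
    using recurrent_def B B_subset[OF B] eq by auto
  obtain n x where x: "x \<in> B'" "(f ^^ n) x \<in> B" using meets_orbit[OF B' o] .
  let ?W = "B' \<inter> (f ^^ n) -` B"
  have B'M: "open B'" "B' \<subseteq> M" using B' by (simp_all add: recurrent_def)
  have "open ?W" "?W \<noteq> {}" "?W \<subseteq> M"
    using open_iterate_preimage[OF B'M o(1)] x B'M(2) by auto
  then have "interior ((f ^^ n) ` ?W) \<noteq> {}" by (rule fat_iterate)
  moreover have "(f ^^ n) ` ?W \<subseteq> B \<inter> (f ^^ n) ` B'" by auto
  ultimately have "interior (B \<inter> (f ^^ n) ` B') \<noteq> {}" using interior_mono by blast
  then show ?thesis by (rule that)
qed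

end


section \<open>Expansion along orbits and the theorem\<close>

lemma linear_tent_step: "linear (tent_step t)"
  by (rule linearI) (simp_all add: tent_step_def pt_eq_iff algebra_simps)

lemma norm_tent_step: "0 < t \<Longrightarrow> norm (tent_step t v) = (t * sqrt 2) * norm v"
  using dist_tent_step[of t v 0] linear_0[OF linear_tent_step, of t] by (simp add: dist_norm)

lemma norm_tent_step_reflected:
  fixes v :: "real^2"
  assumes "0 < t"
  shows "norm (tent_step t (pt (- v $ 1) (v $ 2))) = (t * sqrt 2) * norm v"
proof -
  have "(norm (pt (- v $ 1) (v $ 2)))\<^sup>2 = (norm v)\<^sup>2" unfolding norm_pt_square by simp
  then have "norm (pt (- v $ 1) (v $ 2)) = norm v" by simp
  then show ?thesis using assms by (simp add: norm_tent_step)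
qed

text \<open>Away from the fold line only one affine branch is active, and its linear part is
\<open>t * sqrt 2\<close> times an isometry.\<close>

lemma Lambda_has_derivative:
  assumes t: "0 < t" and y: "y \<in> T" "y $ 1 \<noteq> 1"
  obtains D where "(Lambda t has_derivative D) (at y within T)"
    "\<And>v. norm (D v) = (t * sqrt 2) * norm v"
proof (cases "y $ 1 < 1")
  case True
  have "(tent_step t has_derivative tent_step t) (at y within T)"
    using linear_tent_step by (intro bounded_linear_imp_has_derivative) (simp add: linear_conv_bounded_linear)
  then have "(Lambda t has_derivative tent_step t) (at y within T)"
  proof (rule has_derivative_transform_within)
    show "0 < 1 - y $ 1" using True by simp
    fix x assume x: "x \<in> T" "dist x y < 1 - y $ 1"
    have "x $ 1 \<le> 1" using dist_vec_nth_le[of x 1 y] x(2) by (simp add: dist_real_def)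
    then show "tent_step t x = Lambda t x" using Lambda_branches(1)[OF x(1)] by simp
  qed (rule y)
  then show ?thesis using that norm_tent_step[OF t] by blast
next
  case False
  let ?R = "\<lambda>v. tent_step t (pt (- v $ 1) (v $ 2))"
  have lin: "linear ?R"
    by (rule linearI) (simp_all add: tent_step_def pt_eq_iff algebra_simps)
  have "(\<lambda>p. tent_step t (mirror_x p)) = (\<lambda>p. tent_step t (pt 2 0) + ?R p)"
    by (simp add: fun_eq_iff tent_step_def mirror_x_def algebra_simps)
  moreover have "((\<lambda>p. tent_step t (pt 2 0) + ?R p) has_derivative ?R) (at y within T)"
    using has_derivative_add[OF has_derivative_const bounded_linear_imp_has_derivative, of ?R "tent_step t (pt 2 0)"]
      lin by (simp add: linear_conv_bounded_linear)
  ultimately have "((\<lambda>p. tent_step t (mirror_x p)) has_derivative ?R) (at y within T)" by simp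
  then have "(Lambda t has_derivative ?R) (at y within T)"
  proof (rule has_derivative_transform_within)
    show "0 < y $ 1 - 1" using False y(2) by simp
    fix x assume x: "x \<in> T" "dist x y < y $ 1 - 1"
    have "1 \<le> x $ 1" using dist_vec_nth_le[of x 1 y] x(2) by (simp add: dist_real_def)
    then show "tent_step t (mirror_x x) = Lambda t x" using Lambda_branches(2)[OF x(1)] by simp
  qed (rule y)
  then show ?thesis using that norm_tent_step_reflected[OF t] by blast
qed

lemma Lambda_iterate_has_derivative:
  assumes t: "1 / sqrt 2 < t" "t \<le> 1" and z: "z \<in> T" and av: "\<And>n. (Lambda t ^^ n) z $ 1 \<noteq> 1"
  shows "\<exists>D. ((Lambda t ^^ n) has_derivative D) (at z within T) \<and> (\<forall>v. norm (D v) = (t * sqrt 2) ^ n * norm v)"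
proof (induction n)
  case 0
  show ?case by (intro exI[of _ "\<lambda>v. v"]) (simp add: id_def)
next
  case (Suc n)
  then obtain D where D: "((Lambda t ^^ n) has_derivative D) (at z within T)"
      "\<forall>v. norm (D v) = (t * sqrt 2) ^ n * norm v" by (elim exE conjE)
  have sub: "(Lambda t ^^ n) ` T \<subseteq> T"
    using fat_self_map_iterate[OF fat_self_map_Lambda[OF t], of n] by (simp add: fat_self_map_def)
  then have "(Lambda t ^^ n) z \<in> T" using z by (meson image_subset_iff)
  from Lambda_has_derivative[OF half_less_square(1)[OF t(1)] this av]
  obtain E where E: "(Lambda t has_derivative E) (at ((Lambda t ^^ n) z) within T)"
      "\<And>v. norm (E v) = (t * sqrt 2) * norm v" by metis
  have "(Lambda t \<circ> (Lambda t ^^ n) has_derivative E \<circ> D) (at z within T)"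
    using D(1) has_derivative_subset[OF E(1) sub] by (rule diff_chain_within)
  then have "((Lambda t ^^ Suc n) has_derivative E \<circ> D) (at z within T)"
    by (simp only: funpow.simps(2))
  moreover have "\<forall>v. norm ((E \<circ> D) v) = (t * sqrt 2) ^ Suc n * norm v"
    using D(2) E(2) by simp
  ultimately show ?case by (intro exI conjI)
qed

lemma expanding_map_Lambda:
  assumes t: "1 / sqrt 2 < t" "t \<le> 1"
  obtains r where "expanding_map T (Lambda t) r"
proof -
  obtain r where r: "0 < r"
    "\<And>W. open W \<Longrightarrow> W \<noteq> {} \<Longrightarrow> W \<subseteq> T \<Longrightarrow> \<exists>n z. ball z r \<subseteq> (Lambda t ^^ n) ` W"
    by (rule Lambda_expands_to_scale[OF t]) (rule that)
  have fold: "continuous_on T (fold_x 1)"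
    unfolding fold_x_def by (intro continuous_intros)
  have "continuous_on (fold_x 1 ` T) (tent_step t)"
    unfolding tent_step_def by (intro continuous_intros)
  then have "continuous_on T (\<lambda>p. tent_step t (fold_x 1 p))"
    using continuous_on_compose[OF fold] by (simp add: o_def)
  then have "continuous_on T (Lambda t)"
    by (subst continuous_on_cong[OF refl Lambda_eq])
  then have "expanding_map T (Lambda t) r"
    using compact_T r fat_self_map_Lambda[OF t]
    by unfold_locales (simp_all add: fat_self_map_def interior_open)
  then show ?thesis by (rule that)
qed

lemma strange_orbit_closure:
  assumes t: "1 / sqrt 2 < t" "t \<le> 1" and em: "expanding_map T (Lambda t) r"
    and rec: "expanding_map.recurrent T (Lambda t) B"
  shows "strange_attractor T (Lambda t) (expanding_map.orbit_closure (Lambda t) B)"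
proof -
  interpret expanding_map T "Lambda t" r by (rule em)
  have n: "pt 1 0 \<noteq> 0" by (simp add: zero_eq_pt)
  obtain z where z: "z \<in> B" "orbit_closure B \<subseteq> closure (range (\<lambda>n. (Lambda t ^^ n) z))"
      "\<And>n. (Lambda t ^^ n) z \<notin> {p. pt 1 0 \<bullet> p = 1}"
    using dense_orbit_avoiding[OF rec closed_hyperplane interior_hyperplane[OF n]] by metis
  have zT: "z \<in> T" using z(1) rec by (auto simp: recurrent_def)
  have av: "(Lambda t ^^ n) z $ 1 \<noteq> 1" for n using z(3)[of n] by (simp add: inner_pt)
  have lam: "1 < t * sqrt 2" using t(1) by (simp add: field_simps)
  have "\<exists>D. ((Lambda t ^^ n) has_derivative D) (at z within T) \<and> exp (ln (t * sqrt 2) * real n) \<le> onorm D" for n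
  proof -
    obtain D where D: "((Lambda t ^^ n) has_derivative D) (at z within T)"
        "\<forall>v. norm (D v) = (t * sqrt 2) ^ n * norm v"
      using Lambda_iterate_has_derivative[OF t zT av, of n] by (elim exE conjE)
    have "norm (D (axis 1 1)) \<le> onorm D * norm (axis 1 1 :: real^2)"
      using has_derivative_bounded_linear[OF D(1)] by (rule onorm)
    then have "(t * sqrt 2) ^ n \<le> onorm D" using D(2) by simp
    moreover have "exp (ln (t * sqrt 2) * real n) = (t * sqrt 2) ^ n"
      using lam by (simp only: mult.commute[of "ln _"] exp_of_nat_mult) simp
    ultimately show ?thesis using D(1) by (intro exI[of _ D]) simp
  qed
  moreover have "0 < ln (t * sqrt 2)" using lam by simp
  moreover have "z \<in> orbit_closure B" using z(1) B_subset[OF rec] by (rule rev_subsetD)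
  ultimately show ?thesis
    unfolding strange_attractor_def using attractor_orbit_closure[OF rec] z(2) by metis
qed

lemma strange_attractors_from_separated_family:
  assumes t: "1 / sqrt 2 < t" "t \<le> 1" and fam: "has_separated_family n (Lambda t)"
  shows "\<exists>\<A>. card \<A> = 2 ^ n \<and> (\<forall>A\<in>\<A>. strange_attractor T (Lambda t) A)"
proof -
  obtain r where em: "expanding_map T (Lambda t) r" using expanding_map_Lambda[OF t] .
  interpret expanding_map T "Lambda t" r by (rule em)
  obtain \<U> where \<U>: "card \<U> = 2 ^ n" "\<And>U. U \<in> \<U> \<Longrightarrow> open U \<and> U \<noteq> {} \<and> U \<subseteq> T"
      "\<And>U V. U \<in> \<U> \<Longrightarrow> V \<in> \<U> \<Longrightarrow> U \<noteq> V \<Longrightarrow> separated (Lambda t) U V"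
    using fam unfolding has_separated_family_def by metis
  have "\<exists>B m. recurrent B \<and> B \<subseteq> (Lambda t ^^ m) ` U" if "U \<in> \<U>" for U
    using recurrent_ball_exists[of U] \<U>(2)[OF that] by metis
  then obtain B m where B: "\<And>U. U \<in> \<U> \<Longrightarrow> recurrent (B U)"
      "\<And>U. U \<in> \<U> \<Longrightarrow> B U \<subseteq> (Lambda t ^^ m U) ` U" by metis
  have "inj_on (\<lambda>U. orbit_closure (B U)) \<U>"
  proof (rule inj_onI, rule ccontr)
    fix U V assume UV: "U \<in> \<U>" "V \<in> \<U>" "orbit_closure (B U) = orbit_closure (B V)" "U \<noteq> V"
    obtain k where k: "interior (B U \<inter> (Lambda t ^^ k) ` B V) \<noteq> {}"
      using orbit_closures_overlap[OF B(1)[OF UV(1)] B(1)[OF UV(2)] UV(3)] .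
    have "(Lambda t ^^ k) ` B V \<subseteq> (Lambda t ^^ (k + m V)) ` V"
      using image_mono[OF B(2)[OF UV(2)], of "Lambda t ^^ k"] unfolding funpow_image_add .
    then have "B U \<inter> (Lambda t ^^ k) ` B V \<subseteq> (Lambda t ^^ m U) ` U \<inter> (Lambda t ^^ (k + m V)) ` V"
      using B(2)[OF UV(1)] by (intro Int_mono)
    from interior_mono[OF this] k
    have "interior ((Lambda t ^^ m U) ` U \<inter> (Lambda t ^^ (k + m V)) ` V) \<noteq> {}" by auto
    then show False using \<U>(3)[OF UV(1,2,4)] by (simp add: separated_def)
  qed
  then have "card ((\<lambda>U. orbit_closure (B U)) ` \<U>) = 2 ^ n" using \<U>(1) by (simp add: card_image)
  moreover have "\<forall>A\<in>(\<lambda>U. orbit_closure (B U)) ` \<U>. strange_attractor T (Lambda t) A"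
    using strange_orbit_closure[OF t em B(1)] by simp
  ultimately show ?thesis by (intro exI conjI)
qed

theorem theorem2:
  "(\<exists>ts :: nat \<Rightarrow> real.
      (\<forall>n. ts (Suc n) < ts n) \<and> (\<forall>n. ts n \<le> 1) \<and> ts \<longlonglongrightarrow> 1 / sqrt 2 \<and>
      (\<forall>n. \<forall>t. 1 / sqrt 2 < t \<and> t < ts n \<longrightarrow> renormalizable_EBM n T (Lambda t))) \<and>
   (\<forall>n :: nat. \<exists>I :: real set.
      is_interval I \<and> interior I \<noteq> {} \<and> I \<subseteq> {0..1} \<and>
      (\<forall>t \<in> I. \<exists>\<A>. card \<A> = 2 ^ n \<and> (\<forall>A \<in> \<A>. strange_attractor T (Lambda t) A)))"
proof (intro conjI allI)
  show "\<exists>ts :: nat \<Rightarrow> real.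
      (\<forall>n. ts (Suc n) < ts n) \<and> (\<forall>n. ts n \<le> 1) \<and> ts \<longlonglongrightarrow> 1 / sqrt 2 \<and>
      (\<forall>n. \<forall>t. 1 / sqrt 2 < t \<and> t < ts n \<longrightarrow> renormalizable_EBM n T (Lambda t))"
    by (rule decreasing_thresholds[OF eventually_renormalizable_Lambda]) simp
next
  fix n :: nat
  have c: "0 \<le> 1 / sqrt 2" "1 / sqrt 2 < (1::real)" by simp_all
  obtain b where b: "1 / sqrt 2 < b" "\<And>t. 1 / sqrt 2 < t \<Longrightarrow> t < b \<Longrightarrow> has_separated_family n (Lambda t)"
    using eventually_separated_Lambda[of n] unfolding eventually_at_right[OF c(2)] by metis
  let ?I = "{1 / sqrt 2<..<min b 1}"
  have "1 / sqrt 2 < min b 1" using b(1) c(2) by (simp only: min_less_iff_conj)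
  then have "?I \<noteq> {}" by (simp only: greaterThanLessThan_empty_iff not_le)
  then have "interior ?I \<noteq> {}" by (simp only: interior_open open_greaterThanLessThan) simp
  moreover have "is_interval ?I" by (rule is_interval_oo)
  moreover have "?I \<subseteq> {0..1}"
  proof
    fix t assume "t \<in> ?I"
    then show "t \<in> {0..1}" using c(1) by (simp only: greaterThanLessThan_iff atLeastAtMost_iff) linarith
  qed
  moreover have "\<forall>t\<in>?I. \<exists>\<A>. card \<A> = 2 ^ n \<and> (\<forall>A \<in> \<A>. strange_attractor T (Lambda t) A)"
    using b(2) by (intro ballI strange_attractors_from_separated_family) simp_all
  ultimately show "\<exists>I :: real set.
      is_interval I \<and> interior I \<noteq> {} \<and> I \<subseteq> {0..1} \<and>
      (\<forall>t \<in> I. \<exists>\<A>. card \<A> = 2 ^ n \<and> (\<forall>A \<in> \<A>. strange_attractor T (Lambda t) A))"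
    by (intro exI conjI)
qed

end
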